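(* Let $A, B \in L(\mathcal{H})$ have closed ranges and let $W \in L(\mathcal{H})^+$ be such that $N(B)=R(A)^{\perp_W}$. Then the following are equivalent: \begin{enumerate} \item[i)] $W_{/R(A)}=\min_{\overset{-}{\leq}}\ \{(AXB-I)^*W(AXB-I): X\in L(\mathcal{H})\}$, i.e. $W_{/R(A)}$ is the minimum of this set with respect to the minus order; \item[ii)] the pair $(W,R(A))$ is compatible; \item[iii)] $W_{/R(A)}=\min_{\leq}\ \{(AXB-I)^*W(AXB-I): X\in L(\mathcal{H})\}$, i.e. $W_{/R(A)}$ is the minimum of this set with respect to the order $\leq$. \end{enumerate} If $W^{1/2}\in S_p$ for some $1\leq p<\infty$, conditions i), ii) and iii) are also equivalent to \begin{enumerate} \item[iv)] $\|W_{/R(A)}^{1/2}\|_p=\min_{X\in L(\mathcal{H})}\|AXB-I\|_{p,W}$ (the minimum being attained). \end{enumerate}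
   Context: $\mathcal{H}$ is a separable complex Hilbert space, $L(\mathcal{H})$ the algebra of bounded linear operators on $\mathcal{H}$, $L(\mathcal{H})^+$ the cone of positive semidefinite operators, and $\leq$ the order induced by this cone. $R(T)$ and $N(T)$ denote range and nullspace of $T$. For a subspace $\mathcal{S}$, $\mathcal{S}^{\perp_W}=\{x\in\mathcal{H}: \langle Wx,y\rangle=0 \text{ for all } y\in\mathcal{S}\}=W^{-1}(\mathcal{S}^\perp)$. Shorted operator: for a closed subspace $\mathcal{S}$, $W_{/\mathcal{S}}$ is the maximum, with respect to $\leq$ (known to exist), of $\{X\in L(\mathcal{H}): 0\leq X\leq W,\ R(X)\subseteq \mathcal{S}^\perp\}$; $W_{/\mathcal{S}}^{1/2}$ is the positive square root of $W_{/\mathcal{S}}$. Compatibility: the pair $(W,\mathcal{T})$, with $\mathcal{T}$ a closed subspace, is compatible if there exists $Q\in L(\mathcal{H})$ with $Q^2=Q$, $R(Q)=\mathcal{T}$ and $WQ=Q^*W$. Minus order: for $C,D\in L(\mathcal{H})$, $C \overset{-}{\leq} D$ means that there exist (oblique) projections $P,Q\in L(\mathcal{H})$ (i.e. $P^2=P$, $Q^2=Q$) such that $C=PD$ and $C^*=QD^*$. This is a partial order on $L(\mathcal{H})$. The minimum of a set with respect to an order is an element of the set which is a lower bound of the set. $S_p$ is the $p$-Schatten class with norm $\|\cdot\|_p$, and, when $W^{1/2}\in S_p$, $\|X\|_{p,W}=\|W^{1/2}X\|_p$ for $X\in L(\mathcal{H})$. *)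

theory Defs
  imports "HOL-Analysis.Analysis"
begin

section \<open>Complex Hilbert spaces\<close>

class complex_vector = real_vector +
  fixes scaleC :: "complex \<Rightarrow> 'a \<Rightarrow> 'a"  (infixr \<open>*\<^sub>C\<close> 75)
  assumes scaleC_add_right: "c *\<^sub>C (x + y) = c *\<^sub>C x + c *\<^sub>C y"
    and scaleC_add_left: "(c + d) *\<^sub>C x = c *\<^sub>C x + d *\<^sub>C x"
    and scaleC_scaleC: "c *\<^sub>C d *\<^sub>C x = (c * d) *\<^sub>C x"
    and scaleC_one: "1 *\<^sub>C x = x"
    and scaleR_scaleC: "r *\<^sub>R x = complex_of_real r *\<^sub>C x"

text \<open>The inner product is linear in its first argument. Definiteness and the relation to the norm
  are inherited from \<^class>\<open>real_inner\<close> through \<open>inner_eq_Re_cinner\<close>: the real inner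
  product is the real part of the complex one, so \<open>norm x = sqrt (Re (cinner x x))\<close>.\<close>

class complex_inner = complex_vector + real_inner +
  fixes cinner :: "'a \<Rightarrow> 'a \<Rightarrow> complex"
  assumes cinner_commute: "cinner x y = cnj (cinner y x)"
    and cinner_add_left: "cinner (x + y) z = cinner x z + cinner y z"
    and cinner_scaleC_left: "cinner (c *\<^sub>C x) y = c * cinner x y"
    and inner_eq_Re_cinner: "inner x y = Re (cinner x y)"

class complex_hilbert_space = complex_inner + complete_space

lemma vector_space_scaleC: "vector_space (scaleC :: complex \<Rightarrow> 'a \<Rightarrow> 'a::complex_vector)"
  by unfold_locales
    (simp_all add: scaleC_add_right scaleC_add_left scaleC_scaleC scaleC_one)

instantiation complex :: complex_hilbert_space
begin

definition scaleC_complex :: "complex \<Rightarrow> complex \<Rightarrow> complex"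
  where "scaleC_complex c x = c * x"

definition cinner_complex :: "complex \<Rightarrow> complex \<Rightarrow> complex"
  where "cinner_complex x y = x * cnj y"

instance
  by standard
    (simp_all add: scaleC_complex_def cinner_complex_def inner_complex_def algebra_simps
      scaleR_conv_of_real)

end

section \<open>Bounded operators\<close>

text \<open>\<open>L(H)\<close> consists of the complex-linear members of the library's type of bounded real-linear
  maps, from which it takes its algebraic operations and norm.\<close>

definition bounded_ops :: "('a::complex_hilbert_space \<Rightarrow>\<^sub>L 'a) set"
  where "bounded_ops = {T :: 'a \<Rightarrow>\<^sub>L 'a. \<forall>c x. T (c *\<^sub>C x) = c *\<^sub>C T x}"

text \<open>Existence and uniqueness of the adjoint are given by the Riesz representation theorem.\<close>

definition adj :: "('a::complex_hilbert_space \<Rightarrow>\<^sub>L 'a) \<Rightarrow> ('a \<Rightarrow>\<^sub>L 'a)"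
  where "adj T = (THE T'. T' \<in> bounded_ops \<and> (\<forall>x y. cinner (T x) y = cinner x (T' y)))"

definition nullspace :: "('a::complex_hilbert_space \<Rightarrow>\<^sub>L 'a) \<Rightarrow> 'a set"
  where "nullspace T = {x. T x = 0}"

definition ortho :: "'a::complex_hilbert_space set \<Rightarrow> 'a set"
  where "ortho S = {x. \<forall>y\<in>S. cinner x y = 0}"

definition ortho_weighted :: "('a::complex_hilbert_space \<Rightarrow>\<^sub>L 'a) \<Rightarrow> 'a set \<Rightarrow> 'a set"
  where "ortho_weighted W S = {x. \<forall>y\<in>S. cinner (W x) y = 0}"

definition pos_ops :: "('a::complex_hilbert_space \<Rightarrow>\<^sub>L 'a) set"
  where "pos_ops = {T \<in> bounded_ops. \<forall>x. cinner (T x) x \<in> \<real>\<^sub>\<ge>\<^sub>0}"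

definition op_le :: "('a::complex_hilbert_space \<Rightarrow>\<^sub>L 'a) \<Rightarrow> ('a \<Rightarrow>\<^sub>L 'a) \<Rightarrow> bool"
  where "op_le S T \<longleftrightarrow> T - S \<in> pos_ops"

definition oblique_projections :: "('a::complex_hilbert_space \<Rightarrow>\<^sub>L 'a) set"
  where "oblique_projections = {Q \<in> bounded_ops. Q o\<^sub>L Q = Q}"

definition minus_le :: "('a::complex_hilbert_space \<Rightarrow>\<^sub>L 'a) \<Rightarrow> ('a \<Rightarrow>\<^sub>L 'a) \<Rightarrow> bool"
  where "minus_le C D \<longleftrightarrow>
    (\<exists>P\<in>oblique_projections. \<exists>Q\<in>oblique_projections. C = P o\<^sub>L D \<and> adj C = Q o\<^sub>L adj D)"

definition is_minimum :: "('b \<Rightarrow> 'b \<Rightarrow> bool) \<Rightarrow> 'b \<Rightarrow> 'b set \<Rightarrow> bool"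
  where "is_minimum le m M \<longleftrightarrow> m \<in> M \<and> (\<forall>x\<in>M. le m x)"

text \<open>For positive \<open>T\<close> the positive square root exists and is unique.\<close>

definition op_sqrt :: "('a::complex_hilbert_space \<Rightarrow>\<^sub>L 'a) \<Rightarrow> ('a \<Rightarrow>\<^sub>L 'a)"
  where "op_sqrt T = (THE R. R \<in> pos_ops \<and> R o\<^sub>L R = T)"

definition op_abs :: "('a::complex_hilbert_space \<Rightarrow>\<^sub>L 'a) \<Rightarrow> ('a \<Rightarrow>\<^sub>L 'a)"
  where "op_abs T = op_sqrt (adj T o\<^sub>L T)"

text \<open>For positive \<open>W\<close> and a closed subspace \<open>S\<close> the maximum exists (Krein, Anderson--Trapp); it
  is unique since \<^const>\<open>op_le\<close> is antisymmetric.\<close>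

definition shorted_candidates ::
    "('a::complex_hilbert_space \<Rightarrow>\<^sub>L 'a) \<Rightarrow> 'a set \<Rightarrow> ('a \<Rightarrow>\<^sub>L 'a) set"
  where "shorted_candidates W S =
    {X \<in> bounded_ops. op_le 0 X \<and> op_le X W \<and> range X \<subseteq> ortho S}"

definition shorted :: "('a::complex_hilbert_space \<Rightarrow>\<^sub>L 'a) \<Rightarrow> 'a set \<Rightarrow> ('a \<Rightarrow>\<^sub>L 'a)"
  where "shorted W S =
    (THE X. X \<in> shorted_candidates W S \<and> (\<forall>Y\<in>shorted_candidates W S. op_le Y X))"

definition compatible :: "('a::complex_hilbert_space \<Rightarrow>\<^sub>L 'a) \<Rightarrow> 'a set \<Rightarrow> bool"
  where "compatible W T \<longleftrightarrow>
    (\<exists>Q\<in>bounded_ops. Q o\<^sub>L Q = Q \<and> range Q = T \<and> W o\<^sub>L Q = adj Q o\<^sub>L W)"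

section \<open>Schatten classes\<close>

definition compact_op :: "('a::complex_hilbert_space \<Rightarrow>\<^sub>L 'a) \<Rightarrow> bool"
  where "compact_op T \<longleftrightarrow> compact (closure (T ` cball 0 1))"

text \<open>The singular values of a compact operator \<open>T\<close> are the positive eigenvalues of \<open>|T|\<close>, each
  repeated according to its complex multiplicity. Sums over the singular values are written as sums
  over all real \<open>s > 0\<close> weighted by multiplicity, which is \<open>0\<close> unless \<open>s\<close> is an eigenvalue and is
  finite by compactness. (On an infinite-dimensional eigenspace the library's \<open>dim\<close> would be \<open>0\<close>;
  compactness in the definition of \<open>schatten_class\<close> rules this out.)\<close>

definition singular_multiplicity :: "('a::complex_hilbert_space \<Rightarrow>\<^sub>L 'a) \<Rightarrow> real \<Rightarrow> nat"
  where "singular_multiplicity T s =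
    vector_space.dim scaleC {x. op_abs T x = complex_of_real s *\<^sub>C x}"

definition schatten_class :: "real \<Rightarrow> ('a::complex_hilbert_space \<Rightarrow>\<^sub>L 'a) set"
  where "schatten_class p = {T \<in> bounded_ops. compact_op T \<and>
    (\<lambda>s. real (singular_multiplicity T s) * s powr p) summable_on {0<..}}"

definition schatten_norm :: "real \<Rightarrow> ('a::complex_hilbert_space \<Rightarrow>\<^sub>L 'a) \<Rightarrow> real"
  where "schatten_norm p T =
    (\<Sum>\<^sub>\<infinity>s\<in>{0<..}. real (singular_multiplicity T s) * s powr p) powr (1 / p)"

definition schatten_norm_weighted ::
    "real \<Rightarrow> ('a::complex_hilbert_space \<Rightarrow>\<^sub>L 'a) \<Rightarrow> ('a \<Rightarrow>\<^sub>L 'a) \<Rightarrow> real"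
  where "schatten_norm_weighted p W X = schatten_norm p (op_sqrt W o\<^sub>L X)"

section \<open>The residual operator\<close>

definition residual ::
    "('a::complex_hilbert_space \<Rightarrow>\<^sub>L 'a) \<Rightarrow> ('a \<Rightarrow>\<^sub>L 'a) \<Rightarrow> ('a \<Rightarrow>\<^sub>L 'a) \<Rightarrow> ('a \<Rightarrow>\<^sub>L 'a)"
  where "residual A B X = (A o\<^sub>L X o\<^sub>L B) - id_blinfun"

definition residual_forms ::
    "('a::complex_hilbert_space \<Rightarrow>\<^sub>L 'a) \<Rightarrow> ('a \<Rightarrow>\<^sub>L 'a) \<Rightarrow> ('a \<Rightarrow>\<^sub>L 'a) \<Rightarrow> ('a \<Rightarrow>\<^sub>L 'a) set"
  where "residual_forms W A B =
    {adj (residual A B X) o\<^sub>L W o\<^sub>L residual A B X | X. X \<in> bounded_ops}"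

end

theory Submission
  imports Defs
begin

text \<open>
  Write \<open>S = R(A)\<close> and \<open>F(X) = (AXB - I)\<^sup>* W (AXB - I)\<close>. With \<open>T = AXB\<close>, an operator whose range lies
  in \<open>S\<close>, the quadratic form of \<open>F(X)\<close> at \<open>x\<close> is the squared \<open>W\<close>-distance \<open>\<langle>W(x - Tx), x - Tx\<rangle>\<close>.
  A positive operator \<open>Y \<le> W\<close> with range orthogonal to \<open>S\<close> vanishes on \<open>S\<close>, so that
  \<open>\<langle>Yx, x\<rangle> = \<langle>Y(x - s), x - s\<rangle> \<le> \<langle>W(x - s), x - s\<rangle>\<close> for every \<open>s\<close> in \<open>S\<close>. Hence \<open>W\<^bsub>/S\<^esub> \<le> F(X)\<close> for
  all \<open>X\<close>, and everything turns on whether \<open>W\<^bsub>/S\<^esub>\<close> is itself some \<open>F(X)\<close>. This is equivalent to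
  compatibility.

  \<^item> Let \<open>Q\<close> be a projection onto \<open>S\<close> with \<open>WQ = Q\<^sup>* W\<close>. Then \<open>W\<^bsub>/S\<^esub> = W(I - Q)\<close>
  (\<open>shorted_of_compatible\<close>). Subtract from \<open>Q\<close> its component in \<open>S \<inter> N(W)\<close>, which \<open>W\<close> does not see.
  The result still gives \<open>W\<^bsub>/S\<^esub>\<close>, and it vanishes on the \<open>W\<close>-orthogonal complement of \<open>S\<close>, that is, on
  \<open>N(B)\<close>. As \<open>A\<close> and \<open>B\<close> have closed ranges, it factors as \<open>AXB\<close> (\<open>factorization_exists\<close>), and
  \<open>F(X) = W\<^bsub>/S\<^esub>\<close> (\<open>compatible_imp_attained\<close>).

  \<^item> Let \<open>F(X) = W\<^bsub>/S\<^esub>\<close>. Then \<open>Tx\<close> is a point of \<open>S\<close> of least \<open>W\<close>-distance from \<open>x\<close>, which gives the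
  normal equation \<open>W(x - Tx) \<bottom> S\<close>. On \<open>S\<close> the operator \<open>T\<close> therefore differs from the identity only by
  vectors of \<open>S \<inter> N(W)\<close>, and correcting it there yields the projection required for compatibility
  (\<open>attained_imp_compatible\<close>).

  For the minus order, let \<open>E = I - Q\<close>. The range of \<open>E\<close> lies in \<open>N(B)\<close>, so \<open>(AXB - I)E = -E\<close>, and
  \<open>E\<^sup>* F(X) = W\<^bsub>/S\<^esub>\<close> for all \<open>X\<close>. The oblique projection \<open>E\<^sup>*\<close> thus shows that \<open>W\<^bsub>/S\<^esub>\<close> lies below
  \<open>F(X)\<close> (\<open>compatible_imp_minus_le\<close>).

  For the Schatten norms, let \<open>C\<close> and \<open>D\<close> be the positive square roots of \<open>W\<^bsub>/S\<^esub>\<close> and \<open>F(X)\<close>; the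
  latter is the modulus of \<open>W\<^sup>1\<^sup>/\<^sup>2(AXB - I)\<close>. Square roots are monotone, so \<open>C \<le> D\<close>
  (\<open>pos_ops_form_mono\<close>). For \<open>p \<ge> 1\<close> the sum of the \<open>p\<close>-th powers of the eigenvalues of a compact
  positive operator \<open>D\<close> is the supremum of \<open>\<Sum>\<langle>De, e\<rangle>\<^sup>p\<close> over finite orthonormal families: eigenvectors
  approach it, and the inequalities of Jensen and Bessel show that it is never exceeded
  (\<open>orthonormal_form_sum_le\<close>). So the norm is monotone, and strictly so: equal finite norms force
  \<open>C = D\<close> (\<open>singular_sum_eq_imp_eq\<close>), which is again \<open>W\<^bsub>/S\<^esub> = F(X)\<close>. The norm of \<open>D\<close> is finite since
  \<open>W\<^sup>1\<^sup>/\<^sup>2\<close> is in the class (\<open>singular_summable_compose\<close>).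

  The real inner product, the real part of the complex one, carries most of the arguments. For
  complex-linear operators adjoints, self-adjointness and positivity mean the same with respect to
  either, provided that positivity is understood to include symmetry.
\<close>

section \<open>The complex inner product\<close>

interpretation complex_vec: vector_space "scaleC :: complex \<Rightarrow> 'a \<Rightarrow> 'a::complex_vector"
  by (rule vector_space_scaleC)

lemma cinner_add_right: "cinner x (y + z) = cinner x y + cinner x (z::'a::complex_inner)"
  by (metis cinner_add_left cinner_commute complex_cnj_add)

lemma cinner_scaleC_right: "cinner x (c *\<^sub>C y) = cnj c * cinner x (y::'a::complex_inner)"
  by (metis cinner_commute cinner_scaleC_left complex_cnj_mult)

lemma cinner_zero_left [simp]: "cinner 0 (y::'a::complex_inner) = 0"
  by (metis cinner_scaleC_left complex_vec.scale_zero_left mult_zero_left)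

lemma cinner_zero_right [simp]: "cinner (y::'a::complex_inner) 0 = 0"
  by (metis cinner_commute cinner_zero_left complex_cnj_zero)

lemma cinner_diff_left: "cinner (x - y) z = cinner x z - cinner y (z::'a::complex_inner)"
  by (metis add_diff_cancel cinner_add_left diff_add_cancel)

lemma cinner_diff_right: "cinner x (y - z) = cinner x y - cinner x (z::'a::complex_inner)"
  by (metis add_diff_cancel cinner_add_right diff_add_cancel)

lemma cinner_sum_left: "cinner (\<Sum>i\<in>I. f i) y = (\<Sum>i\<in>I. cinner (f i) (y::'a::complex_inner))"
  by (induction I rule: infinite_finite_induct) (simp_all add: cinner_add_left)

text \<open>The complex inner product is determined by the real one, so identities between real inner products
  that are stable under multiplication by \<open>\<i>\<close> lift to complex ones.\<close>

lemma cinner_eq_inner: "cinner x y = Complex (inner x y) (inner x (\<i> *\<^sub>C (y::'a::complex_inner)))"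
  by (simp add: complex_eq_iff inner_eq_Re_cinner cinner_scaleC_right)

lemma cinner_self: "cinner x x = complex_of_real ((norm (x::'a::complex_inner))\<^sup>2)"
proof -
  have "Im (cinner x x) = 0"
    by (metis add.inverse_neutral cinner_commute cnj.simps(2) equal_neg_zero)
  moreover have "Re (cinner x x) = (norm x)\<^sup>2"
    by (simp add: power2_norm_eq_inner inner_eq_Re_cinner)
  ultimately show ?thesis
    by (simp add: complex_eq_iff)
qed

lemma inner_scaleC_left: "inner (c *\<^sub>C x) y = inner x (cnj c *\<^sub>C (y::'a::complex_inner))"
  by (simp add: inner_eq_Re_cinner cinner_scaleC_right cinner_scaleC_left)

lemma norm_scaleC: "norm (c *\<^sub>C (x::'a::complex_inner)) = cmod c * norm x"
proof -
  have "complex_of_real ((norm (c *\<^sub>C x))\<^sup>2) = (c * cnj c) * complex_of_real ((norm x)\<^sup>2)"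
    by (simp only: cinner_self[symmetric] cinner_scaleC_left cinner_scaleC_right mult.assoc mult.left_commute)
  also have "\<dots> = complex_of_real ((cmod c * norm x)\<^sup>2)"
    by (simp add: complex_norm_square[symmetric] power_mult_distrib)
  finally have "(norm (c *\<^sub>C x))\<^sup>2 = (cmod c * norm x)\<^sup>2"
    using of_real_eq_iff by blast
  then show ?thesis by (simp add: power2_eq_iff_nonneg)
qed

lemma bounded_linear_scaleC: "bounded_linear (\<lambda>x::'a::complex_inner. c *\<^sub>C x)"
  by (rule bounded_linear_intro[where K = "cmod c"])
    (simp_all add: complex_vec.scale_right_distrib scaleR_scaleC scaleC_scaleC norm_scaleC mult.commute)

lemma bounded_linear_cinner_left: "bounded_linear (\<lambda>x::'a::complex_inner. cinner x y)"
proof (rule bounded_linear_intro[where K = "norm y + norm (\<i> *\<^sub>C y)"])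
  fix x :: 'a
  have "cmod (cinner x y) \<le> \<bar>inner x y\<bar> + \<bar>inner x (\<i> *\<^sub>C y)\<bar>"
    unfolding cinner_eq_inner by (rule order_trans[OF cmod_le]) simp
  also have "\<dots> \<le> norm x * norm y + norm x * norm (\<i> *\<^sub>C y)"
    by (intro add_mono Cauchy_Schwarz_ineq2)
  finally show "cmod (cinner x y) \<le> norm x * (norm y + norm (\<i> *\<^sub>C y))"
    by (simp add: algebra_simps)
qed (simp_all add: cinner_add_left scaleR_scaleC[where 'a = 'a] cinner_scaleC_left scaleR_conv_of_real)

section \<open>Closed subspaces and orthogonal projections\<close>

definition closed_csubspace :: "'a::complex_hilbert_space set \<Rightarrow> bool"
  where "closed_csubspace M \<longleftrightarrow> complex_vec.subspace M \<and> closed M"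

lemma csubspace_scaleR:
  "complex_vec.subspace M \<Longrightarrow> x \<in> M \<Longrightarrow> r *\<^sub>R (x::'a::complex_vector) \<in> M"
  by (simp add: scaleR_scaleC complex_vec.subspace_scale)

lemma closed_csubspace_ortho: "closed_csubspace (ortho S)"
proof -
  have "complex_vec.subspace (ortho S)"
    by (simp add: complex_vec.subspace_def ortho_def cinner_add_left cinner_scaleC_left)
  moreover have "ortho S = (\<Inter>y\<in>S. (\<lambda>x. cinner x y) -` {0})"
    by (auto simp: ortho_def)
  moreover have "closed ((\<lambda>x. cinner x y) -` {0})" for y :: 'a
    by (intro closed_vimage linear_continuous_on bounded_linear_cinner_left) auto
  ultimately show ?thesis
    by (auto simp: closed_csubspace_def)
qed

lemma ortho_iff_inner:
  assumes "complex_vec.subspace M"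
  shows "x \<in> ortho M \<longleftrightarrow> (\<forall>y\<in>M. inner x y = 0)"
proof
  assume "\<forall>y\<in>M. inner x y = 0"
  then show "x \<in> ortho M"
    using complex_vec.subspace_scale[OF assms]
    by (auto simp: ortho_def cinner_eq_inner complex_eq_iff)
qed (auto simp: ortho_def inner_eq_Re_cinner)

text \<open>By the parallelogram law a sequence in \<open>M\<close> whose distance to \<open>x\<close> tends to the infimum is a Cauchy
  sequence, because midpoints stay in \<open>M\<close>. Completeness replaces the compactness that is available
  in finite dimension.\<close>

lemma closest_vector_exists:
  fixes M :: "'a::complex_hilbert_space set"
  assumes "closed_csubspace M"
  shows "\<exists>y\<in>M. \<forall>z\<in>M. norm (x - y) \<le> norm (x - z)"
proof -
  have sub: "complex_vec.subspace M" and cl: "closed M"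
    using assms by (auto simp: closed_csubspace_def)
  have ne: "0 \<in> M" using sub complex_vec.subspace_0 by blast
  define d where "d = (INF z\<in>M. norm (x - z))"
  have bdd: "bdd_below ((\<lambda>z. norm (x - z)) ` M)"
    by (rule bdd_belowI[where m = 0]) auto
  have d_le: "d \<le> norm (x - z)" if "z \<in> M" for z
    unfolding d_def using bdd that by (rule cINF_lower)
  have d0: "0 \<le> d"
    unfolding d_def using ne by (intro cINF_greatest) auto
  have "\<exists>z\<in>M. norm (x - z) < d + inverse (real (Suc n))" for n
  proof -
    have "d < d + inverse (real (Suc n))" by simp
    then show ?thesis
      unfolding d_def using cINF_less_iff[OF _ bdd] ne by blast
  qed
  then obtain u where u: "\<And>n. u n \<in> M" "\<And>n. norm (x - u n) < d + inverse (real (Suc n))"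
    by metis
  have para: "(norm (a - b))\<^sup>2 \<le> 2 * (norm (x - a))\<^sup>2 + 2 * (norm (x - b))\<^sup>2 - 4 * d\<^sup>2"
    if "a \<in> M" "b \<in> M" for a b
  proof -
    define c where "c = (1/2) *\<^sub>R (a + b)"
    have "c \<in> M"
      unfolding c_def using that sub by (simp add: csubspace_scaleR complex_vec.subspace_add)
    then have "d\<^sup>2 \<le> (norm (x - c))\<^sup>2"
      using d_le d0 power_mono by blast
    moreover have "(norm (a - b))\<^sup>2 + 4 * (norm (x - c))\<^sup>2 = 2 * (norm (x - a))\<^sup>2 + 2 * (norm (x - b))\<^sup>2"
    proof -
      have para: "(norm (v - u))\<^sup>2 + 4 * (norm ((1/2) *\<^sub>R (u + v)))\<^sup>2 = 2 * (norm u)\<^sup>2 + 2 * (norm v)\<^sup>2"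
        for u v :: 'a
        unfolding power2_norm_eq_inner
        by (simp add: inner_add_left inner_add_right inner_diff_left inner_diff_right inner_commute
            add_divide_distrib)
      have eqs: "a - b = (x - b) - (x - a)" "x - c = (1/2) *\<^sub>R ((x - a) + (x - b))"
        unfolding c_def by (simp_all add: scaleR_add_right scaleR_diff_right flip: scaleR_left.add)
      show ?thesis
        unfolding eqs by (rule para)
    qed
    ultimately show ?thesis by linarith
  qed
  have lim_sq: "(\<lambda>n. (d + inverse (real (Suc n)))\<^sup>2 - d\<^sup>2) \<longlonglongrightarrow> (d + 0)\<^sup>2 - d\<^sup>2"
    by (intro tendsto_intros LIMSEQ_inverse_real_of_nat)
  have "Cauchy u"
  proof (rule CauchyI)
    fix e :: real assume e: "e > 0"
    then have "e\<^sup>2 / 4 > 0" by simp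
    then obtain N where N: "\<And>n. n \<ge> N \<Longrightarrow> (d + inverse (real (Suc n)))\<^sup>2 - d\<^sup>2 < e\<^sup>2 / 4"
      using order_tendstoD(2)[OF lim_sq, of "e\<^sup>2 / 4"] unfolding eventually_sequentially by auto
    have near: "(norm (x - u n))\<^sup>2 - d\<^sup>2 < e\<^sup>2 / 4" if "n \<ge> N" for n
    proof -
      have "(norm (x - u n))\<^sup>2 \<le> (d + inverse (real (Suc n)))\<^sup>2"
        using u(2)[of n] by (intro power_mono) auto
      then show ?thesis using N[OF that] by linarith
    qed
    show "\<exists>N. \<forall>m\<ge>N. \<forall>n\<ge>N. norm (u m - u n) < e"
    proof (intro exI allI impI)
      fix m n assume "m \<ge> N" "n \<ge> N"
      then have "(norm (u m - u n))\<^sup>2 < e\<^sup>2"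
        using para[OF u(1) u(1), of m n] near[of m] near[of n] by linarith
      then show "norm (u m - u n) < e"
        using e power_less_imp_less_base by fastforce
    qed
  qed
  then obtain y where y: "u \<longlonglongrightarrow> y"
    using Cauchy_convergent convergent_def by blast
  have "y \<in> M" using cl y u(1) closed_sequentially by blast
  moreover have "norm (x - y) \<le> d"
  proof (rule LIMSEQ_le)
    show "(\<lambda>n. norm (x - u n)) \<longlonglongrightarrow> norm (x - y)" by (intro tendsto_intros y)
    show "(\<lambda>n. d + inverse (real (Suc n))) \<longlonglongrightarrow> d"
      using tendsto_add[OF tendsto_const LIMSEQ_inverse_real_of_nat, of d] by simp
    show "\<exists>N. \<forall>n\<ge>N. norm (x - u n) \<le> d + inverse (real (Suc n))"
      using u(2) less_imp_le by blast
  qed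
  ultimately show ?thesis
    using d_le order_trans by blast
qed

text \<open>The first-order condition of the two minimization problems below, for the distance to a subspace
  and for the \<open>W\<close>-distance to \<open>R(A)\<close>.\<close>

lemma quadratic_nonneg_imp_linear_zero:
  fixes a b :: real
  assumes "\<And>t. 0 \<le> t * (2 * a) + t\<^sup>2 * b"
  shows "a = 0"
proof (rule ccontr)
  assume a: "a \<noteq> 0"
  \<comment> \<open>For small \<open>t\<close> of sign opposite to \<open>a\<close> the linear term dominates; this one is small enough.\<close>
  define t where "t = - a / (\<bar>b\<bar> + 1)"
  have 1: "\<bar>b\<bar> + 1 > 0" by linarith
  have "t * (2 * a) + t\<^sup>2 * b = (a\<^sup>2 / (\<bar>b\<bar> + 1)) * (b / (\<bar>b\<bar> + 1) - 2)"
  proof -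
    have "t * (\<bar>b\<bar> + 1) = - a" using 1 by (simp add: t_def)
    then have a: "a = - (t * (\<bar>b\<bar> + 1))" by simp
    show ?thesis using 1 unfolding a by (simp add: divide_simps) algebra
  qed
  moreover have "b / (\<bar>b\<bar> + 1) \<le> 1"
    using 1 by (simp add: divide_simps)
  moreover have "a\<^sup>2 / (\<bar>b\<bar> + 1) > 0" using a 1 by simp
  ultimately have "t * (2 * a) + t\<^sup>2 * b < 0"
    by (simp only: mult_pos_neg)
  then show False using assms[of t] by linarith
qed

lemma orthogonal_decomposition:
  fixes M :: "'a::complex_hilbert_space set"
  assumes M: "closed_csubspace M"
  shows "\<exists>y\<in>M. x - y \<in> ortho M"
proof -
  have sub: "complex_vec.subspace M" using M by (auto simp: closed_csubspace_def)
  obtain y where y: "y \<in> M" and min: "\<And>z. z \<in> M \<Longrightarrow> norm (x - y) \<le> norm (x - z)"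
    using closest_vector_exists[OF M] by blast
  have "inner (x - y) z = 0" if z: "z \<in> M" for z
  proof -
    have "0 \<le> t * (2 * (- inner (x - y) z)) + t\<^sup>2 * inner z z" for t
    proof -
      have "y + t *\<^sub>R z \<in> M"
        using sub y z by (simp add: csubspace_scaleR complex_vec.subspace_add)
      then have "(norm (x - y))\<^sup>2 \<le> (norm (x - (y + t *\<^sub>R z)))\<^sup>2"
        using min by (simp add: power_mono)
      also have "(norm (x - (y + t *\<^sub>R z)))\<^sup>2 =
          (norm (x - y))\<^sup>2 + (t * (2 * (- inner (x - y) z)) + t\<^sup>2 * inner z z)"
        unfolding power2_norm_eq_inner
        by (simp add: diff_diff_eq[symmetric] inner_diff_left[of "x - y"] inner_diff_right[of _ "x - y"]
            inner_commute[of z "x - y"] power2_eq_square right_diff_distrib del: diff_diff_eq)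
      finally show ?thesis by linarith
    qed
    then have "- inner (x - y) z = 0"
      by (rule quadratic_nonneg_imp_linear_zero)
    then show ?thesis by simp
  qed
  then show ?thesis using y ortho_iff_inner[OF sub] by blast
qed

lemma bounded_ops_scaleC: "T \<in> bounded_ops \<Longrightarrow> blinfun_apply T (c *\<^sub>C x) = c *\<^sub>C blinfun_apply T x"
  by (simp add: bounded_ops_def)

lemma bounded_ops_id [simp]: "id_blinfun \<in> bounded_ops"
  by (simp add: bounded_ops_def)

lemma bounded_ops_zero [simp]: "0 \<in> bounded_ops"
  by (simp add: bounded_ops_def)

lemma bounded_ops_compose [simp]:
  "S \<in> bounded_ops \<Longrightarrow> T \<in> bounded_ops \<Longrightarrow> S o\<^sub>L T \<in> bounded_ops"
  by (simp add: bounded_ops_def)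

lemma bounded_ops_add [simp]:
  "S \<in> bounded_ops \<Longrightarrow> T \<in> bounded_ops \<Longrightarrow> S + T \<in> bounded_ops"
  by (simp add: bounded_ops_def blinfun.add_left scaleC_add_right)

lemma bounded_ops_diff [simp]:
  "S \<in> bounded_ops \<Longrightarrow> T \<in> bounded_ops \<Longrightarrow> S - T \<in> bounded_ops"
  by (simp add: bounded_ops_def blinfun.diff_left complex_vec.scale_right_diff_distrib)

lemma bounded_ops_scaleR [simp]: "T \<in> bounded_ops \<Longrightarrow> r *\<^sub>R T \<in> bounded_ops"
  by (simp add: bounded_ops_def blinfun.scaleR_left scaleR_scaleC scaleC_scaleC mult.commute)

lemma csubspace_range:
  "T \<in> bounded_ops \<Longrightarrow> complex_vec.subspace (range (blinfun_apply T))"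
  unfolding complex_vec.subspace_def
  by (metis (no_types, lifting) blinfun.add_right blinfun.zero_right bounded_ops_scaleC rangeE rangeI)

lemma closed_csubspace_nullspace:
  assumes "T \<in> bounded_ops"
  shows "closed_csubspace (nullspace T)"
proof -
  have "complex_vec.subspace (nullspace T)"
    using bounded_ops_scaleC[OF assms]
    by (simp add: complex_vec.subspace_def nullspace_def blinfun.add_right)
  moreover have "nullspace T = blinfun_apply T -` {0}"
    by (auto simp: nullspace_def)
  moreover have "closed (blinfun_apply T -` {0})"
    by (intro closed_vimage linear_continuous_on blinfun.bounded_linear_right) auto
  ultimately show ?thesis by (simp add: closed_csubspace_def)
qed

lemma closed_csubspace_Int:
  "closed_csubspace M \<Longrightarrow> closed_csubspace N \<Longrightarrow> closed_csubspace (M \<inter> N)"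
  by (auto simp: closed_csubspace_def complex_vec.subspace_inter)

text \<open>An orthogonal complement is closed, and so is the double complement that contains \<open>S\<close>.\<close>

lemma ortho_closure:
  fixes S :: "'a::complex_hilbert_space set"
  shows "ortho (closure S) = ortho S"
proof
  show "ortho (closure S) \<subseteq> ortho S" using closure_subset by (auto simp: ortho_def)
  have "S \<subseteq> ortho (ortho S)"
    unfolding ortho_def by clarsimp (metis cinner_commute complex_cnj_zero)
  then have "closure S \<subseteq> ortho (ortho S)"
    using closed_csubspace_ortho by (intro closure_minimal) (auto simp: closed_csubspace_def)
  then have "cinner y x = 0" if "x \<in> ortho S" "y \<in> closure S" for x y
    using that unfolding ortho_def[of "ortho S"] by blast
  then show "ortho S \<subseteq> ortho (closure S)"
    unfolding ortho_def[of "closure S"] by clarsimp (metis cinner_commute complex_cnj_zero)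
qed

lemma csubspace_closure:
  fixes S :: "'a::complex_hilbert_space set"
  assumes "complex_vec.subspace S"
  shows "closed_csubspace (closure S)"
proof -
  have "x + y \<in> closure S" if xy: "x \<in> closure S" "y \<in> closure S" for x y
  proof -
    obtain f g where f: "\<And>n. f n \<in> S" "f \<longlonglongrightarrow> x" and g: "\<And>n. g n \<in> S" "g \<longlonglongrightarrow> y"
      using xy by (meson closure_sequential)
    have "\<forall>n. f n + g n \<in> S" using f g assms complex_vec.subspace_add by blast
    moreover have "(\<lambda>n. f n + g n) \<longlonglongrightarrow> x + y" by (intro tendsto_intros f g)
    ultimately show ?thesis unfolding closure_sequential by (intro exI[of _ "\<lambda>n. f n + g n"]) simp
  qed
  moreover have "c *\<^sub>C x \<in> closure S" if x: "x \<in> closure S" for c x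
  proof -
    obtain f where f: "\<And>n. f n \<in> S" "f \<longlonglongrightarrow> x"
      using x by (meson closure_sequential)
    have "\<forall>n. c *\<^sub>C f n \<in> S" using f assms complex_vec.subspace_scale by blast
    moreover have "(\<lambda>n. c *\<^sub>C f n) \<longlonglongrightarrow> c *\<^sub>C x"
      by (intro bounded_linear.tendsto[OF bounded_linear_scaleC] f)
    ultimately show ?thesis unfolding closure_sequential by (intro exI[of _ "\<lambda>n. c *\<^sub>C f n"]) simp
  qed
  moreover have "0 \<in> closure S"
    using assms complex_vec.subspace_0 closure_subset by blast
  ultimately show ?thesis
    by (auto simp: closed_csubspace_def complex_vec.subspace_def)
qed

lemma csubspace_image:
  "T \<in> bounded_ops \<Longrightarrow> complex_vec.subspace S \<Longrightarrow> complex_vec.subspace (blinfun_apply T ` S)"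
  unfolding complex_vec.subspace_def
  by (auto simp: image_iff) (metis blinfun.zero_right, metis blinfun.add_right, metis bounded_ops_scaleC)

lemma bounded_op_exists:
  fixes f :: "'a::complex_hilbert_space \<Rightarrow> 'a"
  assumes "\<And>x y. f (x + y) = f x + f y" "\<And>c x. f (c *\<^sub>C x) = c *\<^sub>C f x"
    "\<And>x. norm (f x) \<le> K * norm x"
  shows "\<exists>T\<in>bounded_ops. blinfun_apply T = f"
proof -
  have "bounded_linear f"
    using assms by (intro bounded_linear_intro[where K = K]) (simp_all add: scaleR_scaleC mult.commute)
  then have "blinfun_apply (Blinfun f) = f"
    by (rule bounded_linear_Blinfun_apply)
  then show ?thesis
    using assms(2) by (intro bexI[of _ "Blinfun f"]) (simp_all add: bounded_ops_def)
qed

text \<open>Meaningful when \<open>M\<close> is a closed complex subspace.\<close>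

definition orth_proj :: "'a::complex_hilbert_space set \<Rightarrow> ('a \<Rightarrow>\<^sub>L 'a)"
  where "orth_proj M = (SOME P. P \<in> bounded_ops \<and> (\<forall>x. P x \<in> M \<and> x - P x \<in> ortho M))"

lemma ortho_Int_zero: "x \<in> M \<Longrightarrow> x \<in> ortho M \<Longrightarrow> (x::'a::complex_hilbert_space) = 0"
  using cinner_self[of x] by (auto simp: ortho_def)

lemma orth_proj_exists:
  fixes M :: "'a::complex_hilbert_space set"
  assumes M: "closed_csubspace M"
  shows "\<exists>P. P \<in> bounded_ops \<and> (\<forall>x. P x \<in> M \<and> x - P x \<in> ortho M)"
proof -
  have sub: "complex_vec.subspace M" and subo: "complex_vec.subspace (ortho M)"
    using M closed_csubspace_ortho[of M] by (auto simp: closed_csubspace_def)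
  obtain p where p: "\<And>x. p x \<in> M" "\<And>x. x - p x \<in> ortho M"
    using orthogonal_decomposition[OF M] by metis
  have uniq: "p x = y" if "y \<in> M" "x - y \<in> ortho M" for x y
  proof -
    have "(x - y) - (x - p x) \<in> ortho M"
      using complex_vec.subspace_diff[OF subo] that p by blast
    then have "p x - y \<in> ortho M" by simp
    moreover have "p x - y \<in> M"
      using complex_vec.subspace_diff[OF sub] that p by blast
    ultimately show ?thesis using ortho_Int_zero by force
  qed
  have "\<exists>T\<in>bounded_ops. blinfun_apply T = p"
  proof (rule bounded_op_exists[where K = 1])
    fix x y :: 'a and c
    show "p (x + y) = p x + p y"
    proof (rule uniq)
      show "p x + p y \<in> M" using p sub complex_vec.subspace_add by blast
      have "x + y - (p x + p y) = (x - p x) + (y - p y)" by simp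
      then show "x + y - (p x + p y) \<in> ortho M"
        using p(2) subo complex_vec.subspace_add by metis
    qed
    show "p (c *\<^sub>C x) = c *\<^sub>C p x"
    proof (rule uniq)
      show "c *\<^sub>C p x \<in> M" using p sub complex_vec.subspace_scale by blast
      show "c *\<^sub>C x - c *\<^sub>C p x \<in> ortho M"
        using p(2) subo complex_vec.subspace_scale
        by (metis complex_vec.scale_right_diff_distrib)
    qed
    have "inner (x - p x) (p x) = 0"
      using p ortho_iff_inner[OF sub] by blast
    then have "(norm (p x))\<^sup>2 + (norm (x - p x))\<^sup>2 = (norm x)\<^sup>2"
      unfolding power2_norm_eq_inner by (simp add: inner_diff_left inner_diff_right inner_commute)
    then have "(norm (p x))\<^sup>2 \<le> (norm x)\<^sup>2"
      by (metis le_add_same_cancel1 zero_le_power2)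
    then show "norm (p x) \<le> 1 * norm x" using power2_le_imp_le by force
  qed
  then show ?thesis using p by metis
qed

context
  fixes M :: "'a::complex_hilbert_space set"
  assumes M: "closed_csubspace M"
begin

lemma orth_proj_bounded: "orth_proj M \<in> bounded_ops"
  and orth_proj_mem: "orth_proj M x \<in> M"
  and orth_proj_compl: "x - orth_proj M x \<in> ortho M"
  using someI_ex[OF orth_proj_exists[OF M]] unfolding orth_proj_def[symmetric] by auto

lemma orth_proj_unique: "y \<in> M \<Longrightarrow> x - y \<in> ortho M \<Longrightarrow> orth_proj M x = y"
proof -
  assume y: "y \<in> M" "x - y \<in> ortho M"
  have "(x - y) - (x - orth_proj M x) \<in> ortho M"
    using y orth_proj_compl closed_csubspace_ortho complex_vec.subspace_diff
    unfolding closed_csubspace_def by blast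
  moreover have "orth_proj M x - y \<in> M"
    using y orth_proj_mem M complex_vec.subspace_diff unfolding closed_csubspace_def by blast
  ultimately show ?thesis using ortho_Int_zero[of "orth_proj M x - y"] by simp
qed

lemma orth_proj_fixes: "x \<in> M \<Longrightarrow> orth_proj M x = x"
  by (rule orth_proj_unique) (auto simp: ortho_def)

lemma ortho_orth: "x \<in> ortho M \<Longrightarrow> y \<in> M \<Longrightarrow> inner x y = 0"
  using M ortho_iff_inner closed_csubspace_def by blast

lemma orth_proj_inner: "inner (orth_proj M x) (orth_proj M y) = inner (orth_proj M x) y"
  using ortho_orth[OF orth_proj_compl orth_proj_mem, of y x]
  by (simp add: inner_diff_right inner_diff_left inner_commute)

lemma orth_proj_symmetric: "inner (orth_proj M x) y = inner x (orth_proj M y)"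
  by (metis inner_commute orth_proj_inner)

lemma ortho_ortho: "ortho (ortho M) = M"
proof
  show "M \<subseteq> ortho (ortho M)"
    unfolding ortho_def by clarsimp (metis cinner_commute complex_cnj_zero)
  show "ortho (ortho M) \<subseteq> M"
  proof
    fix x assume x: "x \<in> ortho (ortho M)"
    have "orth_proj M x \<in> ortho (ortho M)"
      using orth_proj_mem \<open>M \<subseteq> ortho (ortho M)\<close> by blast
    then have "x - orth_proj M x \<in> ortho (ortho M)"
      using x closed_csubspace_ortho complex_vec.subspace_diff unfolding closed_csubspace_def by blast
    then have "x - orth_proj M x = 0"
      using orth_proj_compl ortho_Int_zero by blast
    then show "x \<in> M" using orth_proj_mem[of x] by simp
  qed
qed

end

section \<open>Adjoints and positivity\<close>

text \<open>A vector orthogonal to the kernel of \<open>f\<close> represents \<open>f\<close> up to a scalar, since the kernel has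
  codimension at most one.\<close>

lemma riesz_representation:
  fixes f :: "'a::complex_hilbert_space \<Rightarrow> complex"
  assumes f: "bounded_linear f" and lin: "\<And>c x. f (c *\<^sub>C x) = c * f x"
  shows "\<exists>z. \<forall>x. f x = cinner x z"
proof -
  interpret f: bounded_linear f by (rule f)
  define N where "N = f -` {0}"
  have "closed N"
    unfolding N_def by (intro closed_vimage linear_continuous_on f) auto
  moreover have "complex_vec.subspace N"
    by (simp add: complex_vec.subspace_def N_def f.add f.zero lin)
  ultimately have N: "closed_csubspace N" by (simp add: closed_csubspace_def)
  show ?thesis
  proof (cases "N = UNIV")
    case True
    then show ?thesis by (intro exI[of _ 0]) (auto simp: N_def)
  next
    case False
    then obtain x where "x \<notin> N" by blast
    define v where "v = x - orth_proj N x"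
    have v: "v \<in> ortho N" unfolding v_def by (rule orth_proj_compl[OF N])
    have fv: "f v \<noteq> 0"
      using \<open>x \<notin> N\<close> orth_proj_mem[OF N, of x] by (simp add: v_def N_def f.diff)
    then have "v \<noteq> 0" using f.zero by auto
    define z where "z = cnj (f v / cinner v v) *\<^sub>C v"
    have vv: "cinner v v \<noteq> 0" using \<open>v \<noteq> 0\<close> by (simp add: cinner_self)
    have "f y = cinner y z" for y
    proof -
      have "f v *\<^sub>C y - f y *\<^sub>C v \<in> N"
        by (simp add: N_def f.diff lin)
      then have "cinner v (f v *\<^sub>C y - f y *\<^sub>C v) = 0"
        using v by (simp add: ortho_def)
      then have "cinner (f v *\<^sub>C y - f y *\<^sub>C v) v = 0"
        by (metis cinner_commute complex_cnj_zero)
      then have "f v * cinner y v = f y * cinner v v"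
        by (simp add: cinner_diff_left cinner_scaleC_left)
      then show ?thesis
        using vv by (simp add: z_def cinner_scaleC_right field_simps)
    qed
    then show ?thesis by blast
  qed
qed

lemma adjoint_exists:
  fixes T :: "'a::complex_hilbert_space \<Rightarrow>\<^sub>L 'a"
  assumes T: "T \<in> bounded_ops"
  shows "\<exists>T'\<in>bounded_ops. \<forall>x y. cinner (T x) y = cinner x (T' y)"
proof -
  have "\<exists>z. \<forall>x. cinner (T x) y = cinner x z" for y
  proof (rule riesz_representation)
    show "bounded_linear (\<lambda>x. cinner (T x) y)"
      by (rule bounded_linear_compose[OF bounded_linear_cinner_left blinfun.bounded_linear_right])
  qed (simp add: bounded_ops_scaleC[OF T] cinner_scaleC_left)
  then obtain g where g: "\<And>x y. cinner (T x) y = cinner x (g y)" by metis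
  have eqI: "u = v" if "\<And>x. cinner x u = cinner x v" for u v :: 'a
  proof -
    have "cinner (u - v) (u - v) = 0" using that by (simp add: cinner_diff_right)
    then show ?thesis by (simp add: cinner_self)
  qed
  have "\<exists>T'\<in>bounded_ops. blinfun_apply T' = g"
  proof (rule bounded_op_exists[where K = "norm T"])
    fix x y :: 'a and c
    show "g (x + y) = g x + g y"
      by (rule eqI) (simp add: cinner_add_right g[symmetric])
    show "g (c *\<^sub>C x) = c *\<^sub>C g x"
      by (rule eqI) (simp add: cinner_scaleC_right g[symmetric])
    have "(norm (g x))\<^sup>2 = inner (T (g x)) x"
      by (simp add: power2_norm_eq_inner inner_eq_Re_cinner g)
    also have "\<dots> \<le> norm (T (g x)) * norm x"
      by (rule norm_cauchy_schwarz)
    also have "\<dots> \<le> (norm T * norm (g x)) * norm x"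
      by (intro mult_right_mono norm_blinfun) auto
    finally have "norm (g x) * norm (g x) \<le> norm (g x) * (norm T * norm x)"
      by (simp add: power2_eq_square algebra_simps)
    then show "norm (g x) \<le> norm T * norm x"
      by (cases "g x = 0") auto
  qed
  then show ?thesis using g by auto
qed

lemma inner_eq_imp_cinner_eq:
  fixes S T :: "'a::complex_hilbert_space \<Rightarrow>\<^sub>L 'a"
  assumes "T \<in> bounded_ops" "\<And>x y. inner (S x) y = inner x (T y)"
  shows "cinner (S x) y = cinner x (T y)"
  using assms by (simp add: cinner_eq_inner bounded_ops_scaleC[symmetric])

lemma blinfun_eq_by_inner:
  fixes S T :: "'a::complex_hilbert_space \<Rightarrow>\<^sub>L 'a"
  assumes "\<And>x y. inner x (S y) = inner x (T y)"
  shows "S = T"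
proof (rule blinfun_eqI)
  fix y
  have "inner (S y - T y) (S y - T y) = 0"
    using assms by (simp add: inner_diff_right)
  then show "S y = T y" by simp
qed

lemma adj_eqI:
  assumes "T' \<in> bounded_ops" "\<And>x y. inner (blinfun_apply T x) y = inner x (blinfun_apply T' y)"
  shows "adj T = T'"
  unfolding adj_def
proof (rule the_equality)
  show "T' \<in> bounded_ops \<and> (\<forall>x y. cinner (T x) y = cinner x (T' y))"
    using assms inner_eq_imp_cinner_eq by blast
  fix S assume "S \<in> bounded_ops \<and> (\<forall>x y. cinner (T x) y = cinner x (S y))"
  then have "inner x (S y) = inner x (T' y)" for x y
    using assms(2) by (metis inner_eq_Re_cinner)
  then show "S = T'" by (rule blinfun_eq_by_inner)
qed

text \<open>The description that defines the adjoint, in terms of the real inner product.\<close>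

lemma
  assumes "T \<in> bounded_ops"
  shows adj_bounded [simp]: "adj T \<in> bounded_ops"
    and adj_inner: "inner (blinfun_apply T x) y = inner x (blinfun_apply (adj T) y)"
proof -
  obtain T' where T': "T' \<in> bounded_ops" "\<And>x y. cinner (T x) y = cinner x (T' y)"
    using adjoint_exists[OF assms] by blast
  then have i: "inner (T x) y = inner x (T' y)" for x y
    by (simp add: inner_eq_Re_cinner)
  then have "adj T = T'" using T' by (intro adj_eqI)
  then show "adj T \<in> bounded_ops" "inner (T x) y = inner x (adj T y)" using T' i by auto
qed

lemma adj_inner_right: "T \<in> bounded_ops \<Longrightarrow> inner x (blinfun_apply T y) = inner (blinfun_apply (adj T) x) y"
  by (metis adj_inner inner_commute)

lemma adj_compose:
  "S \<in> bounded_ops \<Longrightarrow> T \<in> bounded_ops \<Longrightarrow> adj (S o\<^sub>L T) = adj T o\<^sub>L adj S"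
  by (rule adj_eqI) (simp_all add: adj_inner)

lemma adj_adj [simp]: "T \<in> bounded_ops \<Longrightarrow> adj (adj T) = T"
  by (rule adj_eqI) (simp_all add: adj_inner_right)

text \<open>Polarization over the complex numbers: a complex-linear operator with real quadratic form is
  symmetric. The form at \<open>\<i>x + y\<close> gives the real part of the asymmetry.\<close>

lemma cinner_nonneg_imp_symmetric:
  fixes T :: "'a::complex_hilbert_space \<Rightarrow>\<^sub>L 'a"
  assumes T: "T \<in> bounded_ops" and real: "\<And>x. cinner (T x) x \<in> \<real>"
  shows "inner (T x) y = inner x (T y)"
proof -
  have im: "Im (cinner (T u) u) = 0" for u
    using real[of u] by (simp add: complex_is_Real_iff)
  have skew: "inner (T u) (\<i> *\<^sub>C u) = 0" for u
    using im[of u] by (simp add: cinner_eq_inner)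
  have "inner (T (\<i> *\<^sub>C x + y)) (\<i> *\<^sub>C (\<i> *\<^sub>C x + y)) = 0"
    by (rule skew)
  moreover have "\<i> *\<^sub>C \<i> *\<^sub>C x = - x"
    by (simp add: scaleC_scaleC)
  moreover have "inner (\<i> *\<^sub>C T x) (\<i> *\<^sub>C y) = inner (T x) y"
    by (simp add: inner_scaleC_left scaleC_scaleC scaleC_one)
  moreover have "inner (T (\<i> *\<^sub>C x)) (\<i> *\<^sub>C \<i> *\<^sub>C x) = 0" "inner (T y) (\<i> *\<^sub>C y) = 0"
    by (rule skew)+
  ultimately have "inner (T x) y - inner (T y) x = 0"
    by (simp add: blinfun.add_right scaleC_add_right inner_add_left inner_add_right inner_diff_right
        bounded_ops_scaleC[OF T])
  then show ?thesis by (simp add: inner_commute)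
qed

text \<open>Positivity in terms of the real inner product. Symmetry has to be stated here, since
  nonnegativity of the real part of \<open>\<langle>Tx, x\<rangle>\<close> does not imply it.\<close>

lemma pos_ops_iff:
  "T \<in> pos_ops \<longleftrightarrow> T \<in> bounded_ops \<and> (\<forall>x y. inner (blinfun_apply T x) y = inner x (blinfun_apply T y))
    \<and> (\<forall>x. 0 \<le> inner (blinfun_apply T x) x)" (is "_ \<longleftrightarrow> ?R")
proof
  assume T: "T \<in> pos_ops"
  then have b: "T \<in> bounded_ops" and p: "\<And>x. cinner (T x) x \<in> \<real>\<^sub>\<ge>\<^sub>0"
    by (auto simp: pos_ops_def)
  have "0 \<le> inner (T x) x" for x
    using p[of x] by (simp add: inner_eq_Re_cinner complex_nonneg_Reals_iff)
  moreover have "inner (T x) y = inner x (T y)" for x y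
    using p by (intro cinner_nonneg_imp_symmetric[OF b]) (simp add: complex_nonneg_Reals_iff complex_is_Real_iff)
  ultimately show ?R using b by blast
next
  assume R: ?R
  then have "cinner (T x) x = cnj (cinner (T x) x)" for x
    by (metis cinner_commute inner_eq_imp_cinner_eq)
  then have "Im (cinner (T x) x) = 0" for x
    by (metis cnj.sel(2) equal_neg_zero)
  then show "T \<in> pos_ops"
    using R by (auto simp: pos_ops_def complex_nonneg_Reals_iff inner_eq_Re_cinner)
qed

text \<open>By complex linearity, symmetry for the real inner product is symmetry for the complex one.\<close>

definition self_adjoint :: "('a::complex_hilbert_space \<Rightarrow>\<^sub>L 'a) \<Rightarrow> bool"
  where "self_adjoint T \<longleftrightarrow> T \<in> bounded_ops \<and> (\<forall>x y. inner (T x) y = inner x (T y))"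

lemma pos_ops_iff_self_adjoint: "T \<in> pos_ops \<longleftrightarrow> self_adjoint T \<and> (\<forall>x. 0 \<le> inner (blinfun_apply T x) x)"
  by (simp add: pos_ops_iff self_adjoint_def)

lemma pos_ops_bounded: "T \<in> pos_ops \<Longrightarrow> T \<in> bounded_ops"
  and pos_ops_sym: "T \<in> pos_ops \<Longrightarrow> inner (blinfun_apply T x) y = inner x (blinfun_apply T y)"
  and pos_ops_nonneg: "T \<in> pos_ops \<Longrightarrow> 0 \<le> inner (blinfun_apply T x) x"
  and pos_ops_self_adjoint: "T \<in> pos_ops \<Longrightarrow> self_adjoint T"
  by (auto simp: pos_ops_iff self_adjoint_def)

lemma self_adjoint_adj: "self_adjoint T \<longleftrightarrow> T \<in> bounded_ops \<and> adj T = T"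
  by (metis adj_bounded adj_eqI adj_inner self_adjoint_def)

lemma self_adjoint_diff: "self_adjoint S \<Longrightarrow> self_adjoint T \<Longrightarrow> self_adjoint (S - T)"
  by (simp add: self_adjoint_def blinfun.diff_left inner_diff_left inner_diff_right)

lemma self_adjoint_zero_by_form:
  assumes "self_adjoint T" "\<And>x. inner (blinfun_apply T x) x = 0"
  shows "T = 0"
proof (rule blinfun_eqI)
  fix x
  have "inner (T (x + T x)) (x + T x) = 0" by (rule assms(2))
  then have "2 * inner (T x) (T x) = 0"
    using assms by (simp add: self_adjoint_def blinfun.add_right inner_add_left inner_add_right)
  then show "blinfun_apply T x = blinfun_apply 0 x" by simp
qed

lemma op_le_iff:
  assumes "self_adjoint S" "self_adjoint T"
  shows "op_le S T \<longleftrightarrow> (\<forall>x. inner (blinfun_apply S x) x \<le> inner (blinfun_apply T x) x)"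
  using self_adjoint_diff[OF assms(2,1)]
  by (simp add: op_le_def pos_ops_iff_self_adjoint blinfun.diff_left inner_diff_left)

lemma op_le_antisym:
  assumes "self_adjoint S" "self_adjoint T" "op_le S T" "op_le T S"
  shows "S = T"
proof -
  have "S - T = 0"
  proof (rule self_adjoint_zero_by_form)
    show "self_adjoint (S - T)" using assms self_adjoint_diff by blast
    show "inner ((S - T) x) x = 0" for x
      using assms(3,4) unfolding op_le_iff[OF assms(1,2)] op_le_iff[OF assms(2,1)]
      by (simp add: blinfun.diff_left inner_diff_left order_antisym)
  qed
  then show ?thesis by simp
qed

section \<open>Positive operators and their square roots\<close>

text \<open>The Cauchy-Schwarz inequality for the semi-inner product \<open>\<langle>Tx, y\<rangle>\<close>.\<close>

lemma pos_ops_Cauchy_Schwarz: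
  assumes T: "T \<in> pos_ops"
  shows "(inner (blinfun_apply T x) y)\<^sup>2 \<le> inner (T x) x * inner (T y) y"
proof -
  have expand: "inner (T (x + t *\<^sub>R y)) (x + t *\<^sub>R y) =
      inner (T x) x + 2 * t * inner (T x) y + t\<^sup>2 * inner (T y) y" for t
    using pos_ops_sym[OF T, of y x]
    by (simp add: blinfun.add_right blinfun.scaleR_right inner_add_left inner_add_right
        inner_commute[of y "T x"] power2_eq_square distrib_left)
  have pos: "0 \<le> inner (T x) x + 2 * t * inner (T x) y + t\<^sup>2 * inner (T y) y" for t
    using pos_ops_nonneg[OF T, of "x + t *\<^sub>R y"] unfolding expand .
  show ?thesis
  proof (cases "inner (T y) y = 0")
    case True
    have "inner (T x) y = 0"
    proof (rule ccontr)
      assume n: "inner (T x) y \<noteq> 0"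
      show False
        using pos[of "- (inner (T x) x + 1) / (2 * inner (T x) y)"] n True
        by (simp add: divide_simps)
    qed
    then show ?thesis using True by simp
  next
    case False
    then have b: "inner (T y) y > 0" using pos_ops_nonneg[OF T, of y] by linarith
    define c where "c = inner (T x) y / inner (T y) y"
    have c: "inner (T x) y = c * inner (T y) y" using b by (simp add: c_def)
    have "0 \<le> inner (T x) x - c * (c * inner (T y) y)"
      using pos[of "- c"] unfolding c by (simp add: power2_eq_square algebra_simps)
    then have "0 \<le> (inner (T x) x - c * (c * inner (T y) y)) * inner (T y) y"
      using b by simp
    then show ?thesis unfolding c by (simp add: power2_eq_square algebra_simps)
  qed
qed

text \<open>The Cauchy-Schwarz inequality for \<open>\<langle>Tx, y\<rangle>\<close> at \<open>y = Tx\<close>. It turns bounds on the quadratic form into bounds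
  on the operator.\<close>

lemma pos_ops_norm_square_le:
  assumes T: "T \<in> pos_ops" and K: "\<And>x. inner (blinfun_apply T x) x \<le> K * (norm x)\<^sup>2"
  shows "(norm (blinfun_apply T x))\<^sup>2 \<le> K * inner (T x) x"
proof (cases "T x = 0")
  case False
  have "(norm (T x))\<^sup>2 * (norm (T x))\<^sup>2 = (inner (T x) (T x))\<^sup>2"
    by (simp only: power2_norm_eq_inner power2_eq_square[of "inner _ _"])
  also have "\<dots> \<le> inner (T x) x * inner (T (T x)) (T x)"
    by (rule pos_ops_Cauchy_Schwarz[OF T])
  also have "\<dots> \<le> inner (T x) x * (K * (norm (T x))\<^sup>2)"
    by (intro mult_left_mono K pos_ops_nonneg[OF T])
  finally have "(norm (T x))\<^sup>2 * (norm (T x))\<^sup>2 \<le> (norm (T x))\<^sup>2 * (K * inner (T x) x)"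
    by (simp add: algebra_simps)
  moreover have "0 < (norm (T x))\<^sup>2" using False by simp
  ultimately show ?thesis by (rule mult_left_le_imp_le)
qed simp

lemma pos_ops_scaleR:
  assumes "T \<in> pos_ops" "0 \<le> r"
  shows "r *\<^sub>R T \<in> pos_ops"
  unfolding pos_ops_iff
proof (intro conjI allI)
  show "0 \<le> inner ((r *\<^sub>R T) x) x" for x
    using assms pos_ops_nonneg[of T x] by (simp only: blinfun.scaleR_left inner_scaleR_left) simp
qed (use assms in \<open>auto simp: blinfun.scaleR_left pos_ops_bounded pos_ops_sym\<close>)

lemma form_le_norm: "inner (blinfun_apply T x) x \<le> norm T * (norm (x::'a::real_inner))\<^sup>2"
proof -
  have "inner (T x) x \<le> norm (T x) * norm x" by (rule norm_cauchy_schwarz)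
  also have "\<dots> \<le> (norm T * norm x) * norm x" by (intro mult_right_mono norm_blinfun) simp
  finally show ?thesis by (simp add: power2_eq_square)
qed

lemma form_swap_minus:
  "inner (blinfun_apply W (a - b)) (c - d) = inner (blinfun_apply W (b - a)) (d - (c::'a::real_inner))"
  by (simp add: blinfun.diff_right inner_diff_left inner_diff_right)

lemma pos_ops_zero_iff: "T \<in> pos_ops \<Longrightarrow> inner (blinfun_apply T x) x = 0 \<Longrightarrow> T x = 0"
  using pos_ops_norm_square_le[of T "norm T" x] form_le_norm[of T] by simp

lemma pos_ops_congruence:
  assumes "W \<in> pos_ops" "Y \<in> bounded_ops"
  shows "adj Y o\<^sub>L W o\<^sub>L Y \<in> pos_ops"
proof -
  have i: "inner ((adj Y o\<^sub>L W o\<^sub>L Y) x) y = inner (W (Y x)) (Y y)" for x y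
    using assms by (simp add: adj_inner_right)
  have "inner x ((adj Y o\<^sub>L W o\<^sub>L Y) y) = inner (W (Y x)) (Y y)" for x y
    using i[of y x] assms by (metis inner_commute pos_ops_sym)
  then show ?thesis
    using assms i pos_ops_nonneg[OF assms(1)] by (simp only: pos_ops_iff) (simp add: pos_ops_bounded)
qed

lemma congruence_form:
  "Y \<in> bounded_ops \<Longrightarrow> inner ((adj Y o\<^sub>L W o\<^sub>L Y) x) y = inner (blinfun_apply W (Y x)) (Y y)"
  by (simp add: adj_inner_right)

lemma id_pos [simp]: "id_blinfun \<in> pos_ops"
  by (simp add: pos_ops_iff)

text \<open>The square root is operator monotone: \<open>C\<^sup>2 \<le> D\<^sup>2\<close> implies \<open>C \<le> D\<close>. If \<open>v\<close> were an eigenvector of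
  \<open>D - C\<close> to a least eigenvalue \<open>m < 0\<close>, then
  \<open>0 \<le> \<parallel>Dv\<parallel>\<^sup>2 - \<parallel>Cv\<parallel>\<^sup>2 = \<langle>(D - C)v, (D + C)v\<rangle> = m \<langle>v, (D + C)v\<rangle> \<le> -m\<^sup>2 \<parallel>v\<parallel>\<^sup>2\<close>, a contradiction. The infimum
  \<open>m\<close> of the quadratic form need not be attained, but it has approximate eigenvectors, for which the
  estimate holds up to an error that tends to zero.\<close>

lemma pos_ops_form_mono:
  assumes C: "C \<in> pos_ops" and D: "D \<in> pos_ops"
    and le: "\<And>x. norm (blinfun_apply C x) \<le> norm (blinfun_apply D x)"
  shows "inner (blinfun_apply C v) v \<le> inner (blinfun_apply D v) v"
proof (rule ccontr)
  assume neg: "\<not> ?thesis"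
  define A where "A = D - C"
  define q where "q x = inner (A x) x" for x
  define m where "m = (INF x\<in>sphere 0 1. q x)"
  have qv: "q v < 0" using neg by (simp add: q_def A_def blinfun.diff_left inner_diff_left)
  then have "v \<noteq> 0" by (auto simp: q_def)
  have q_scale: "q (r *\<^sub>R x) = r\<^sup>2 * q x" for r x
    by (simp add: q_def blinfun.scaleR_right power2_eq_square)
  have q_ge: "- norm A \<le> q x" if "norm x = 1" for x
    using form_le_norm[of "- A" x] that by (simp add: q_def blinfun.minus_left)
  then have bdd: "bdd_below (q ` sphere 0 1)"
    by (intro bdd_belowI2[where m = "- norm A"]) auto
  have m_le: "m \<le> q x" if "norm x = 1" for x
    unfolding m_def using bdd that by (intro cINF_lower) auto
  have m_form: "m * (norm x)\<^sup>2 \<le> q x" for x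
  proof (cases "x = 0")
    case False
    have "x = norm x *\<^sub>R (x /\<^sub>R norm x)" using False by simp
    then have "q x = (norm x)\<^sup>2 * q (x /\<^sub>R norm x)" by (metis q_scale)
    moreover have "m \<le> q (x /\<^sub>R norm x)" using False by (intro m_le) simp
    ultimately show ?thesis by (simp add: mult.commute[of m] mult_left_mono)
  qed (simp add: q_def)
  have v1: "norm (v /\<^sub>R norm v) = 1" using \<open>v \<noteq> 0\<close> by simp
  have "q (v /\<^sub>R norm v) < 0"
    using qv \<open>v \<noteq> 0\<close> unfolding q_scale by (simp add: mult_pos_neg)
  then have m0: "m < 0" using m_le[OF v1] by linarith
  \<comment> \<open>\<open>T\<close> is positive, so it is small in norm where its quadratic form is small: this makes almost
    minimizers of \<open>q\<close> approximate eigenvectors of \<open>A\<close>.\<close>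
  define T where "T = A - m *\<^sub>R id_blinfun"
  have T_apply: "T x = A x - m *\<^sub>R x" for x
    by (simp add: T_def blinfun.diff_left blinfun.scaleR_left)
  have T: "T \<in> pos_ops"
  proof -
    have "T \<in> bounded_ops"
      using C D by (simp add: T_def A_def pos_ops_bounded)
    moreover have "inner (T x) y = inner x (T y)" for x y
      using pos_ops_sym[OF C, of x y] pos_ops_sym[OF D, of x y]
      by (simp add: T_apply A_def blinfun.diff_left inner_diff_left inner_diff_right)
    moreover have "0 \<le> inner (T x) x" for x
      using m_form[of x] by (simp add: T_apply inner_diff_left q_def power2_norm_eq_inner)
    ultimately show ?thesis by (simp add: pos_ops_iff)
  qed
  define L where "L = norm (D + C)"
  have key: "m * (m + e) \<le> sqrt (norm T * e) * L" if "e > 0" for e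
  proof -
    obtain x where x: "norm x = 1" "q x < m + e"
    proof -
      have "v /\<^sub>R norm v \<in> sphere 0 1" using v1 by simp
      then have ne: "sphere (0::'a) 1 \<noteq> {}" by blast
      have "\<exists>x\<in>sphere 0 1. q x < m + e"
        using cINF_less_iff[OF ne bdd, of "m + e"] \<open>e > 0\<close> by (simp add: m_def)
      then show thesis using that by auto
    qed
    have Tx: "norm (T x) \<le> sqrt (norm T * e)"
    proof (rule real_le_rsqrt)
      have "(norm (T x))\<^sup>2 \<le> norm T * inner (T x) x"
        by (rule pos_ops_norm_square_le[OF T form_le_norm])
      also have "inner (T x) x \<le> e"
        using x by (simp add: T_apply inner_diff_left q_def[symmetric] dot_square_norm)
      finally show "(norm (T x))\<^sup>2 \<le> norm T * e" by (simp add: mult_left_mono)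
    qed
    have "0 \<le> (norm (D x))\<^sup>2 - (norm (C x))\<^sup>2"
      using le[of x] by simp
    also have "\<dots> = inner (A x) ((D + C) x)"
      by (simp add: A_def power2_norm_eq_inner blinfun.diff_left blinfun.add_left inner_diff_left
          inner_add_right inner_commute[of "C x" "D x"])
    also have "\<dots> = m * inner x ((D + C) x) + inner (T x) ((D + C) x)"
      by (simp add: T_apply inner_diff_left)
    also have "inner (T x) ((D + C) x) \<le> norm (T x) * norm ((D + C) x)"
      by (rule norm_cauchy_schwarz)
    also have "\<dots> \<le> sqrt (norm T * e) * L"
      unfolding L_def using norm_blinfun[of "D + C" x] x Tx \<open>e > 0\<close> by (intro mult_mono) auto
    finally have "- (m * inner x ((D + C) x)) \<le> sqrt (norm T * e) * L" by simp
    moreover have "- (m + e) \<le> inner x ((D + C) x)"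
    proof -
      have "inner x ((D + C) x) + q x = 2 * inner (D x) x"
        by (simp add: q_def A_def blinfun.diff_left blinfun.add_left inner_diff_left inner_add_right
            inner_commute[of x "C x"] inner_commute[of x "D x"])
      then show ?thesis using x pos_ops_nonneg[OF D, of x] by linarith
    qed
    then have "- m * - (m + e) \<le> - m * inner x ((D + C) x)"
      using m0 by (intro mult_left_mono) auto
    ultimately show ?thesis by (simp add: algebra_simps)
  qed
  have "m * (m + 0) \<le> sqrt (norm T * 0) * L"
  proof (rule LIMSEQ_le)
    show "(\<lambda>n. m * (m + inverse (real (Suc n)))) \<longlonglongrightarrow> m * (m + 0)"
      by (intro tendsto_intros LIMSEQ_inverse_real_of_nat)
    show "(\<lambda>n. sqrt (norm T * inverse (real (Suc n))) * L) \<longlonglongrightarrow> sqrt (norm T * 0) * L"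
      by (intro tendsto_intros LIMSEQ_inverse_real_of_nat)
  qed (use key in auto)
  then have "m * m \<le> 0" by simp
  then show False using m0 by (simp add: mult_le_0_iff)
qed

text \<open>This makes spaces of operators complete.\<close>

instance complex_hilbert_space \<subseteq> banach ..

text \<open>For \<open>0 \<le> W \<le> I\<close> put \<open>A = I - W\<close>. A root \<open>I - Z\<close> of \<open>W\<close> amounts to a fixed point \<open>Z = (A + Z\<^sup>2)/2\<close>, and
  the iteration from \<open>0\<close> converges in norm: since \<open>\<parallel>A\<parallel> \<le> 1\<close>, its steps are dominated by those of the scalar
  iteration \<open>y \<mapsto> (1 + y\<^sup>2)/2\<close>, which increases and stays below \<open>1\<close>. Positivity of the root comes from
  \<open>\<parallel>Z\<parallel> \<le> 1\<close>.\<close>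

lemma pos_root_exists_contraction:
  fixes W :: "'a::complex_hilbert_space \<Rightarrow>\<^sub>L 'a"
  assumes W: "W \<in> pos_ops" and W1: "\<And>x. inner (W x) x \<le> (norm x)\<^sup>2"
  shows "\<exists>R\<in>pos_ops. R o\<^sub>L R = W"
proof -
  define A where "A = id_blinfun - W"
  have A: "A \<in> pos_ops"
    using W W1 by (simp add: A_def pos_ops_iff blinfun.diff_left inner_diff_left inner_diff_right
        power2_norm_eq_inner)
  have "norm A \<le> 1"
  proof (rule norm_blinfun_bound)
    fix x
    have le: "inner (A y) y \<le> 1 * (norm y)\<^sup>2" for y
      using pos_ops_nonneg[OF W, of y]
      by (simp add: A_def blinfun.diff_left inner_diff_left power2_norm_eq_inner)
    have "(norm (A x))\<^sup>2 \<le> (norm x)\<^sup>2"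
      using pos_ops_norm_square_le[OF A le, of x] le[of x] by linarith
    then show "norm (A x) \<le> 1 * norm x" using power2_le_imp_le[of "norm (A x)" "norm x"] by simp
  qed simp
  define Y where "Y = rec_nat 0 (\<lambda>_ T. (1/2) *\<^sub>R (A + (T o\<^sub>L T)))"
  have Y0: "Y 0 = 0" and YS: "\<And>n. Y (Suc n) = (1/2) *\<^sub>R (A + (Y n o\<^sub>L Y n))"
    by (simp_all add: Y_def)
  define y :: "nat \<Rightarrow> real" where "y = rec_nat 0 (\<lambda>_ t. (1/2) * (1 + t\<^sup>2))"
  have y0: "y 0 = 0" and yS: "\<And>n. y (Suc n) = (1/2) * (1 + (y n)\<^sup>2)"
    by (simp_all add: y_def)
  have y_bounds: "0 \<le> y n \<and> y n \<le> 1" for n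
    by (induction n) (auto simp: y0 yS power_le_one)
  have Y_self_adjoint: "self_adjoint (Y n)" for n
  proof (induction n)
    case (Suc n)
    then show ?case
      using A by (simp add: YS self_adjoint_def pos_ops_iff blinfun.scaleR_left blinfun.add_left
          inner_add_left inner_add_right)
  qed (simp add: Y0 self_adjoint_def)
  have Y_norm: "norm (Y n) \<le> y n" for n
  proof (induction n)
    case (Suc n)
    have "norm (A + (Y n o\<^sub>L Y n)) \<le> norm A + norm (Y n) * norm (Y n)"
      by (rule order_trans[OF norm_triangle_ineq]) (simp add: norm_blinfun_compose)
    also have "\<dots> \<le> 1 + y n * y n"
      using Suc \<open>norm A \<le> 1\<close> y_bounds by (intro add_mono mult_mono) auto
    finally show ?case by (simp add: YS yS power2_eq_square)
  qed (simp add: Y0 y0)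
  have step: "norm (Y (Suc n) - Y n) \<le> y (Suc n) - y n" for n
  proof (induction n)
    case 0
    then show ?case using \<open>norm A \<le> 1\<close> by (simp add: Y0 y0 YS yS)
  next
    case (Suc n)
    let ?d = "Y (Suc n) - Y n"
    have "Y (Suc (Suc n)) - Y (Suc n) = (1/2) *\<^sub>R ((?d o\<^sub>L Y (Suc n)) + (Y n o\<^sub>L ?d))"
      unfolding YS[of "Suc n"] YS[of n, THEN arg_cong, of "\<lambda>u. _ - u"]
      by (rule blinfun_eqI) (simp add: blinfun.bilinear_simps scaleR_diff_right[symmetric])
    then have "norm (Y (Suc (Suc n)) - Y (Suc n))
        \<le> (1/2) * (norm ?d * norm (Y (Suc n)) + norm (Y n) * norm ?d)"
      using norm_triangle_ineq[of "?d o\<^sub>L Y (Suc n)" "Y n o\<^sub>L ?d"]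
        norm_blinfun_compose[of ?d "Y (Suc n)"] norm_blinfun_compose[of "Y n" ?d] by simp
    also have "\<dots> \<le> (1/2) * ((y (Suc n) - y n) * y (Suc n) + y n * (y (Suc n) - y n))"
      using Suc Y_norm[of n] Y_norm[of "Suc n"] y_bounds[of n] y_bounds[of "Suc n"]
        order_trans[OF norm_ge_zero Suc]
      by (intro mult_left_mono add_mono mult_mono) auto
    also have "\<dots> = y (Suc (Suc n)) - y (Suc n)"
      by (simp add: yS[of "Suc n"] yS[of n, THEN arg_cong, of "\<lambda>u. _ - u"] power2_eq_square algebra_simps)
    finally show ?case .
  qed
  have dist: "norm (Y (m + k) - Y m) \<le> y (m + k) - y m" for m k
  proof (induction k)
    case (Suc k)
    then show ?case
      using step[of "m + k"] norm_triangle_ineq[of "Y (Suc (m + k)) - Y (m + k)" "Y (m + k) - Y m"]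
      by simp
  qed simp
  have "incseq y"
    using order_trans[OF norm_ge_zero step] by (intro incseq_SucI) simp
  then have "convergent y"
    using y_bounds incseq_convergent[of y 1] unfolding convergent_def by blast
  then have "Cauchy y" by (rule convergent_Cauchy)
  have "Cauchy Y"
  proof (rule CauchyI')
    fix e :: real assume "e > 0"
    then obtain N where N: "\<And>m n. m \<ge> N \<Longrightarrow> n \<ge> N \<Longrightarrow> norm (y m - y n) < e"
      using CauchyD[OF \<open>Cauchy y\<close>] by blast
    show "\<exists>N. \<forall>m\<ge>N. \<forall>n>m. dist (Y m) (Y n) < e"
    proof (intro exI allI impI)
      fix m n assume mn: "m \<ge> N" "n > m"
      then obtain k where k: "n = m + k" using less_imp_add_positive by blast
      have "norm (y n - y m) < e" using N mn by auto
      then show "dist (Y m) (Y n) < e"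
        using dist[of m k] by (simp add: k dist_norm norm_minus_commute)
    qed
  qed
  then obtain Z where Z: "Y \<longlonglongrightarrow> Z" using Cauchy_convergent convergent_def by blast
  have Z_apply: "(\<lambda>n. Y n x) \<longlonglongrightarrow> Z x" for x
    by (intro tendsto_intros Z)
  have ZA: "Z = (1/2) *\<^sub>R (A + (Z o\<^sub>L Z))"
  proof (rule LIMSEQ_unique)
    show "(\<lambda>n. Y (Suc n)) \<longlonglongrightarrow> Z" using Z by (simp add: LIMSEQ_Suc)
    show "(\<lambda>n. Y (Suc n)) \<longlonglongrightarrow> (1/2) *\<^sub>R (A + (Z o\<^sub>L Z))"
      unfolding YS by (intro tendsto_intros bounded_bilinear.tendsto[OF bounded_bilinear_blinfun_compose] Z)
  qed
  have Z_norm: "norm Z \<le> 1"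
    by (rule LIMSEQ_le_const2[OF tendsto_norm[OF Z]]) (use Y_norm y_bounds order_trans in blast)
  have Z_bounded: "Z \<in> bounded_ops"
    unfolding bounded_ops_def
  proof clarify
    fix c x
    have "(\<lambda>n. Y n (c *\<^sub>C x)) \<longlonglongrightarrow> c *\<^sub>C Z x"
      using bounded_linear.tendsto[OF bounded_linear_scaleC Z_apply] Y_self_adjoint
      by (simp add: bounded_ops_scaleC self_adjoint_def)
    then show "Z (c *\<^sub>C x) = c *\<^sub>C Z x" using Z_apply LIMSEQ_unique by blast
  qed
  have Z_sym: "inner (Z u) v = inner u (Z v)" for u v
  proof (rule LIMSEQ_unique)
    show "(\<lambda>n. inner (Y n u) v) \<longlonglongrightarrow> inner (Z u) v"
      by (intro tendsto_intros Z_apply)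
    have "inner (Y n u) v = inner u (Y n v)" for n
      using Y_self_adjoint by (simp add: self_adjoint_def)
    then show "(\<lambda>n. inner (Y n u) v) \<longlonglongrightarrow> inner u (Z v)"
      by (simp add: tendsto_intros Z_apply)
  qed
  have "id_blinfun - Z \<in> pos_ops"
  proof -
    have "inner (Z x) x \<le> inner x x" for x
    proof -
      have "norm Z * (norm x)\<^sup>2 \<le> 1 * (norm x)\<^sup>2" using Z_norm by (intro mult_right_mono) auto
      then show ?thesis using form_le_norm[of Z x] by (simp add: power2_norm_eq_inner)
    qed
    then show ?thesis
      using Z_bounded Z_sym
      by (simp add: pos_ops_iff blinfun.diff_left inner_diff_left inner_diff_right)
  qed
  moreover have "(id_blinfun - Z) o\<^sub>L (id_blinfun - Z) = W"
  proof (rule blinfun_eqI)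
    fix x
    have "Z x = (1/2) *\<^sub>R (A x + Z (Z x))"
      using arg_cong[OF ZA, of "\<lambda>T. blinfun_apply T x"]
      by (simp add: blinfun.scaleR_left blinfun.add_left)
    then have "Z x + Z x = A x + Z (Z x)"
      by (metis scaleR_half_double scaleR_add_right)
    then show "((id_blinfun - Z) o\<^sub>L (id_blinfun - Z)) x = W x"
      by (simp add: A_def blinfun.diff_left blinfun.diff_right algebra_simps)
  qed
  ultimately show ?thesis by blast
qed

lemma pos_root_exists:
  fixes W :: "'a::complex_hilbert_space \<Rightarrow>\<^sub>L 'a"
  assumes W: "W \<in> pos_ops"
  shows "\<exists>R\<in>pos_ops. R o\<^sub>L R = W"
proof -
  define c where "c = norm W + 1"
  have c: "c > 0" by (simp add: c_def add_nonneg_pos)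
  have "\<exists>R\<in>pos_ops. R o\<^sub>L R = (1/c) *\<^sub>R W"
  proof (rule pos_root_exists_contraction)
    show "(1/c) *\<^sub>R W \<in> pos_ops"
      using W c by (intro pos_ops_scaleR) auto
    fix x
    have "inner (W x) x \<le> c * (norm x)\<^sup>2"
      using form_le_norm[of W x] by (rule order_trans) (simp add: c_def distrib_right)
    then show "inner (((1/c) *\<^sub>R W) x) x \<le> (norm x)\<^sup>2"
      using c by (simp add: blinfun.scaleR_left field_simps)
  qed
  then obtain R where R: "R \<in> pos_ops" "R o\<^sub>L R = (1/c) *\<^sub>R W" by blast
  have "sqrt c *\<^sub>R R \<in> pos_ops"
    using R c by (intro pos_ops_scaleR) auto
  moreover have "(sqrt c *\<^sub>R R) o\<^sub>L (sqrt c *\<^sub>R R) = W"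
  proof (rule blinfun_eqI)
    fix x
    have "R (R x) = (1/c) *\<^sub>R W x"
      using arg_cong[OF R(2), of "\<lambda>T. blinfun_apply T x"] by (simp add: blinfun.scaleR_left)
    then show "((sqrt c *\<^sub>R R) o\<^sub>L (sqrt c *\<^sub>R R)) x = W x"
      using c by (simp add: blinfun.scaleR_left blinfun.scaleR_right)
  qed
  ultimately show ?thesis by blast
qed

lemma pos_root_norm:
  "R \<in> pos_ops \<Longrightarrow> (norm (blinfun_apply R x))\<^sup>2 = inner ((R o\<^sub>L R) x) x"
  by (simp add: power2_norm_eq_inner pos_ops_sym)

lemma pos_root_unique:
  assumes "R \<in> pos_ops" "S \<in> pos_ops" "R o\<^sub>L R = S o\<^sub>L S"
  shows "R = S"
proof -
  have n: "norm (R x) = norm (S x)" for x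
    using pos_root_norm[OF assms(1), of x] pos_root_norm[OF assms(2), of x] assms(3)
    by (metis norm_ge_zero power2_eq_imp_eq)
  have "op_le R S" "op_le S R"
    using pos_ops_form_mono[of R S] pos_ops_form_mono[of S R] n assms
    by (auto simp: op_le_iff pos_ops_self_adjoint)
  then show ?thesis using op_le_antisym assms pos_ops_self_adjoint by blast
qed

lemma op_sqrt_unique: "R \<in> pos_ops \<Longrightarrow> R o\<^sub>L R = W \<Longrightarrow> op_sqrt W = R"
  unfolding op_sqrt_def using pos_root_unique by (intro the_equality) auto

lemma
  assumes "W \<in> pos_ops"
  shows op_sqrt_pos: "op_sqrt W \<in> pos_ops"
    and op_sqrt_square: "op_sqrt W o\<^sub>L op_sqrt W = W"
    and op_sqrt_norm: "(norm (op_sqrt W x))\<^sup>2 = inner (W x) x"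
proof -
  obtain R where R: "R \<in> pos_ops" "R o\<^sub>L R = W" using pos_root_exists[OF assms] by blast
  then have "op_sqrt W = R" by (rule op_sqrt_unique)
  then show "op_sqrt W \<in> pos_ops" "op_sqrt W o\<^sub>L op_sqrt W = W"
    "(norm (op_sqrt W x))\<^sup>2 = inner (W x) x"
    using R pos_root_norm[OF R(1)] by auto
qed

text \<open>The last part is what characterizes the modulus: it has the same norms as \<open>T\<close>.\<close>

lemma
  assumes "T \<in> bounded_ops"
  shows gram_pos: "adj T o\<^sub>L T \<in> pos_ops"
    and op_abs_pos: "op_abs T \<in> pos_ops"
    and op_abs_norm: "norm (op_abs T x) = norm (blinfun_apply T x)"
proof -
  have "adj T o\<^sub>L T = adj T o\<^sub>L id_blinfun o\<^sub>L T" by (simp add: blinfun_eqI)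
  then show g: "adj T o\<^sub>L T \<in> pos_ops"
    using pos_ops_congruence[OF id_pos assms] by simp
  then show "op_abs T \<in> pos_ops" unfolding op_abs_def by (rule op_sqrt_pos)
  have "(norm (op_abs T x))\<^sup>2 = (norm (T x))\<^sup>2"
    unfolding op_abs_def op_sqrt_norm[OF g] using assms by (simp add: adj_inner_right power2_norm_eq_inner)
  then show "norm (op_abs T x) = norm (T x)" by simp
qed

lemma op_abs_of_pos: "R \<in> pos_ops \<Longrightarrow> op_abs R = R"
  unfolding op_abs_def
  by (intro op_sqrt_unique) (auto simp: self_adjoint_adj dest: pos_ops_self_adjoint)

section \<open>Shorted operators\<close>

lemma shorted_candidate_vanishes:
  assumes Y: "Y \<in> shorted_candidates W S" and s: "s \<in> S"
  shows "blinfun_apply Y s = 0"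
proof -
  have "Y \<in> pos_ops" using Y by (simp add: shorted_candidates_def op_le_def)
  moreover have "cinner (Y (Y s)) s = 0"
    using Y s by (auto simp: shorted_candidates_def ortho_def)
  ultimately have "inner (Y s) (Y s) = 0"
    by (simp add: pos_ops_sym[of Y "Y s" s, symmetric]) (simp add: inner_eq_Re_cinner)
  then show ?thesis by simp
qed

lemma shorted_candidate_pos: "Y \<in> shorted_candidates W S \<Longrightarrow> Y \<in> pos_ops"
  by (simp add: shorted_candidates_def op_le_def)

text \<open>The extremal property behind all lower bounds: a candidate does not notice a shift by \<open>s\<close> in \<open>S\<close>, so
  its form is at most the least squared \<open>W\<close>-distance from \<open>x\<close> to \<open>S\<close>.\<close>

lemma shorted_candidate_form_le:
  assumes W: "W \<in> pos_ops" and Y: "Y \<in> shorted_candidates W S" and s: "s \<in> S"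
  shows "inner (blinfun_apply Y x) x \<le> inner (blinfun_apply W (x - s)) (x - s)"
proof -
  have Yp: "Y \<in> pos_ops" using Y by (rule shorted_candidate_pos)
  have "Y s = 0" by (rule shorted_candidate_vanishes[OF Y s])
  then have "inner (Y x) x = inner (Y (x - s)) (x - s)"
    by (simp add: blinfun.diff_right inner_diff_right pos_ops_sym[OF Yp])
  also have "\<dots> \<le> inner (W (x - s)) (x - s)"
    using Y W Yp op_le_iff pos_ops_self_adjoint unfolding shorted_candidates_def by blast
  finally show ?thesis .
qed

lemma shorted_eqI:
  assumes X: "X \<in> shorted_candidates W S" and max: "\<And>Y. Y \<in> shorted_candidates W S \<Longrightarrow> op_le Y X"
  shows "shorted W S = X"
  unfolding shorted_def
proof (rule the_equality)
  fix Y assume "Y \<in> shorted_candidates W S \<and> (\<forall>Z\<in>shorted_candidates W S. op_le Z Y)"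
  then show "Y = X"
    using X max op_le_antisym pos_ops_self_adjoint shorted_candidate_pos by metis
qed (use assms in auto)

text \<open>The shorted operator is \<open>R(I - P)R\<close>, where \<open>R\<close> is the square root of \<open>W\<close> and \<open>P\<close> projects onto the
  closure of \<open>R(S)\<close>. Its form at \<open>x\<close> is the squared distance from \<open>Rx\<close> to \<open>R(S)\<close>, which is the infimum of
  \<open>\<langle>W(x - s), x - s\<rangle>\<close> over \<open>s\<close> in \<open>S\<close> and so bounds every candidate.\<close>

lemma shorted_exists:
  fixes W :: "'a::complex_hilbert_space \<Rightarrow>\<^sub>L 'a"
  assumes W: "W \<in> pos_ops" and S: "complex_vec.subspace S"
  shows "\<exists>X\<in>shorted_candidates W S. \<forall>Y\<in>shorted_candidates W S. op_le Y X"
proof -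
  define R where "R = op_sqrt W"
  have R: "R \<in> pos_ops" "R o\<^sub>L R = W"
    using op_sqrt_pos[OF W] op_sqrt_square[OF W] by (auto simp: R_def)
  have Rb: "R \<in> bounded_ops" using R pos_ops_bounded by blast
  define K where "K = closure (R ` S)"
  have K: "closed_csubspace K"
    unfolding K_def by (intro csubspace_closure csubspace_image Rb S)
  define P where "P = id_blinfun - orth_proj K"
  have Pb: "P \<in> bounded_ops" unfolding P_def using orth_proj_bounded[OF K] by simp
  have P_apply: "P x = x - orth_proj K x" for x by (simp add: P_def blinfun.diff_left)
  have P_ortho: "P x \<in> ortho K" for x
    unfolding P_apply by (rule orth_proj_compl[OF K])
  have P_inner: "inner (P x) y = inner (P x) (P y)" for x y
    using ortho_orth[OF K P_ortho orth_proj_mem[OF K], of x y]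
    by (simp add: P_apply[of y] inner_diff_right)
  have P_norm: "(norm (P x))\<^sup>2 + (norm (orth_proj K x))\<^sup>2 = (norm x)\<^sup>2" for x
    using P_inner[of x x] orth_proj_inner[OF K, of x x]
    by (simp add: power2_norm_eq_inner P_apply inner_diff_left)
  define X where "X = R o\<^sub>L P o\<^sub>L R"
  have X_inner: "inner (X x) y = inner (P (R x)) (P (R y))" for x y
    using P_inner[of "R x" "R y"] by (simp add: X_def pos_ops_sym[OF R(1)])
  have X: "X \<in> pos_ops"
    unfolding pos_ops_iff
  proof (intro conjI allI)
    show "X \<in> bounded_ops" using Rb Pb by (simp add: X_def)
    show "inner (X x) y = inner x (X y)" for x y
      using X_inner[of x y] X_inner[of y x] by (metis inner_commute)
    show "0 \<le> inner (X x) x" for x by (simp add: X_inner)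
  qed
  have XS: "range X \<subseteq> ortho S"
  proof clarify
    fix x
    have "inner (X x) s = 0" if s: "s \<in> S" for s
    proof -
      have "R s \<in> K" unfolding K_def using s by (intro subsetD[OF closure_subset] imageI)
      then have "P (R s) = 0" using orth_proj_fixes[OF K] by (simp add: P_apply)
      then show ?thesis by (simp add: X_inner)
    qed
    then show "X x \<in> ortho S" using ortho_iff_inner[OF S] by blast
  qed
  have XW: "op_le X W"
  proof -
    have "inner (X x) x \<le> inner (W x) x" for x
    proof -
      have "inner (X x) x = (norm (P (R x)))\<^sup>2" by (simp add: X_inner power2_norm_eq_inner)
      also have "\<dots> \<le> (norm (R x))\<^sup>2" using P_norm[of "R x"] by (metis le_add_same_cancel1 zero_le_power2)
      also have "\<dots> = inner (W x) x" using pos_root_norm[OF R(1)] R(2) by simp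
      finally show ?thesis .
    qed
    then show ?thesis using X W by (simp add: op_le_iff pos_ops_self_adjoint)
  qed
  have cand: "X \<in> shorted_candidates W S"
    using X XS XW by (simp add: shorted_candidates_def op_le_def pos_ops_bounded)
  have "op_le Y X" if Y: "Y \<in> shorted_candidates W S" for Y
  proof -
    have "inner (Y x) x \<le> inner (X x) x" for x
    proof -
      have "orth_proj K (R x) \<in> closure (R ` S)"
        using orth_proj_mem[OF K] unfolding K_def by blast
      then obtain f where f: "\<And>n. f n \<in> R ` S" "f \<longlonglongrightarrow> orth_proj K (R x)"
        by (meson closure_sequential)
      have le: "inner (Y x) x \<le> (norm (R x - f n))\<^sup>2" for n
      proof -
        obtain s where s: "s \<in> S" "f n = R s" using f(1)[of n] by blast
        have "inner (Y x) x \<le> inner (W (x - s)) (x - s)"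
          by (rule shorted_candidate_form_le[OF W Y s(1)])
        also have "\<dots> = (norm (R (x - s)))\<^sup>2" using pos_root_norm[OF R(1), of "x - s"] R(2) by simp
        finally show ?thesis by (simp add: s blinfun.diff_right)
      qed
      have "inner (Y x) x \<le> (norm (R x - orth_proj K (R x)))\<^sup>2"
      proof (rule LIMSEQ_le_const)
        show "(\<lambda>n. (norm (R x - f n))\<^sup>2) \<longlonglongrightarrow> (norm (R x - orth_proj K (R x)))\<^sup>2"
          by (intro tendsto_intros f(2))
      qed (use le in blast)
      then show ?thesis by (simp add: X_inner P_apply[symmetric] power2_norm_eq_inner)
    qed
    then show ?thesis
      using Y X by (simp add: op_le_iff pos_ops_self_adjoint shorted_candidate_pos)
  qed
  then show ?thesis using cand by blast
qed

lemma shorted_candidate: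
  "W \<in> pos_ops \<Longrightarrow> complex_vec.subspace S \<Longrightarrow> shorted W S \<in> shorted_candidates W S"
  using shorted_exists shorted_eqI by metis

section \<open>Operators with closed range\<close>

text \<open>The uniform boundedness principle for the functionals \<open>\<langle>\<cdot>, w\<rangle>\<close>, by the Baire category theorem: some set
  on which they are all bounded by \<open>n\<close> contains a ball.\<close>

lemma weakly_bounded_imp_bounded:
  fixes \<Omega> :: "'a::complex_hilbert_space set"
  assumes "\<And>y. \<exists>K. \<forall>w\<in>\<Omega>. \<bar>inner y w\<bar> \<le> K"
  shows "\<exists>K. \<forall>w\<in>\<Omega>. norm w \<le> K"
proof -
  define T where "T n = {y. \<forall>w\<in>\<Omega>. \<bar>inner y w\<bar> \<le> real n}" for n
  have T_closed: "closed (T n)" for n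
  proof -
    have "T n = (\<Inter>w\<in>\<Omega>. {y. \<bar>inner y w\<bar> \<le> real n})" by (auto simp: T_def)
    then show ?thesis by (auto intro!: closed_INT closed_Collect_le continuous_intros)
  qed
  have "\<exists>n. y \<in> T n" for y
  proof -
    obtain K where K: "\<forall>w\<in>\<Omega>. \<bar>inner y w\<bar> \<le> K" using assms by blast
    obtain n where "K \<le> real n" using real_arch_simple by blast
    then show ?thesis using K by (intro exI[of _ n]) (auto simp: T_def)
  qed
  then have cover: "\<Union>(range T) = UNIV" by blast
  have "\<exists>n. interior (T n) \<noteq> {}"
  proof (rule ccontr)
    assume "\<nexists>n. interior (T n) \<noteq> {}"
    then have "interior (\<Union>(range T)) = {}"
      using Met_TC.metric_Baire_category_alt[of "range T"] T_closed complete_UNIV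
      by (auto simp: mcomplete_iff_complete)
    then show False using cover by simp
  qed
  then obtain n y where "y \<in> interior (T n)" by blast
  then obtain e where e: "e > 0" "cball y e \<subseteq> T n"
    by (meson interior_subset mem_interior_cball)
  have "norm w \<le> 2 * real n / e" if w: "w \<in> \<Omega>" for w
  proof (cases "w = 0")
    case False
    define z where "z = (e / norm w) *\<^sub>R w"
    have "norm z = e" using e False by (simp add: z_def)
    then have "y + z \<in> T n" "y \<in> T n" using e by (auto simp: dist_norm subset_iff)
    then have "\<bar>inner (y + z) w\<bar> \<le> real n" "\<bar>inner y w\<bar> \<le> real n"
      using w by (auto simp: T_def)
    then have "inner z w \<le> 2 * real n" by (simp add: inner_add_left)
    moreover have "inner z w = e * norm w"
      using False by (simp add: z_def dot_square_norm power2_eq_square)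
    ultimately show ?thesis using e by (simp add: field_simps)
  qed (use e in simp)
  then show ?thesis by blast
qed

lemma ortho_range:
  fixes T :: "'a::complex_hilbert_space \<Rightarrow>\<^sub>L 'a"
  assumes T: "T \<in> bounded_ops"
  shows "ortho (range T) = nullspace (adj T)"
proof -
  have "(\<forall>y. inner x (T y) = 0) \<longleftrightarrow> adj T x = 0" for x
    by (metis adj_inner_right[OF T] inner_eq_zero_iff inner_zero_left)
  then show ?thesis
    by (auto simp: ortho_iff_inner[OF csubspace_range[OF T]] nullspace_def)
qed

text \<open>On the complete space \<open>R(B)\<close> the functionals \<open>\<langle>\<cdot>, w\<rangle>\<close> with \<open>\<parallel>B\<^sup>*w\<parallel> \<le> 1\<close> are pointwise bounded, since
  \<open>\<langle>Bx, w\<rangle> = \<langle>x, B\<^sup>*w\<rangle>\<close>. Uniform boundedness takes the place of the open mapping theorem.\<close>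

lemma closed_range_adjoint_bounded_below:
  fixes B :: "'a::complex_hilbert_space \<Rightarrow>\<^sub>L 'a"
  assumes B: "B \<in> bounded_ops" and cl: "closed (range B)"
  shows "\<exists>K\<ge>0. \<forall>w\<in>range B. norm w \<le> K * norm (adj B w)"
proof -
  have M: "closed_csubspace (range B)"
    using cl csubspace_range[OF B] by (simp add: closed_csubspace_def)
  define \<Omega> where "\<Omega> = {w \<in> range B. norm (adj B w) \<le> 1}"
  have "\<exists>K. \<forall>w\<in>\<Omega>. norm w \<le> K"
  proof (rule weakly_bounded_imp_bounded)
    fix y
    obtain x where x: "orth_proj (range B) y = B x"
      using orth_proj_mem[OF M, of y] by blast
    have "\<bar>inner y w\<bar> \<le> norm x" if w: "w \<in> \<Omega>" for w
    proof -
      have "inner y w = inner (B x) w"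
        using w orth_proj_fixes[OF M, of w] orth_proj_symmetric[OF M, of y w] x
        by (simp add: \<Omega>_def)
      also have "\<dots> = inner x (adj B w)" by (rule adj_inner[OF B])
      finally have "\<bar>inner y w\<bar> \<le> norm x * norm (adj B w)"
        by (simp add: Cauchy_Schwarz_ineq2)
      also have "\<dots> \<le> norm x * 1" using w by (intro mult_left_mono) (auto simp: \<Omega>_def)
      finally show ?thesis by simp
    qed
    then show "\<exists>K. \<forall>w\<in>\<Omega>. \<bar>inner y w\<bar> \<le> K" by blast
  qed
  then obtain K where K: "\<And>w. w \<in> \<Omega> \<Longrightarrow> norm w \<le> K" by blast
  have "0 \<in> \<Omega>" using csubspace_range[OF B] by (simp add: \<Omega>_def complex_vec.subspace_0)
  then have "K \<ge> 0" using K by fastforce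
  moreover have "norm w \<le> K * norm (adj B w)" if w: "w \<in> range B" for w
  proof (cases "adj B w = 0")
    case True
    then have "w \<in> ortho (range B)" by (simp add: ortho_range[OF B] nullspace_def)
    then have "w = 0" by (rule ortho_Int_zero[OF w])
    then show ?thesis by simp
  next
    case False
    have "w /\<^sub>R norm (adj B w) \<in> \<Omega>"
      using w False csubspace_scaleR[OF csubspace_range[OF B]]
      by (simp add: \<Omega>_def blinfun.scaleR_right)
    from K[OF this] show ?thesis using False by (simp add: field_simps)
  qed
  ultimately show ?thesis by blast
qed

text \<open>For \<open>u\<close> in \<open>R(B)\<close> the bound for the adjoint gives \<open>\<parallel>B\<^sup>*u\<parallel>\<^sup>2 = \<langle>BB\<^sup>*u, u\<rangle> \<le> \<parallel>BB\<^sup>*u\<parallel> K \<parallel>B\<^sup>*u\<parallel>\<close>, which is the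
  claim for vectors of \<open>R(B\<^sup>*)\<close>. These are dense in the orthogonal complement of \<open>N(B)\<close>.\<close>

lemma closed_range_bounded_below:
  fixes B :: "'a::complex_hilbert_space \<Rightarrow>\<^sub>L 'a"
  assumes B: "B \<in> bounded_ops" and cl: "closed (range B)"
  shows "\<exists>K. \<forall>x\<in>ortho (nullspace B). norm x \<le> K * norm (B x)"
proof -
  obtain K where K: "K \<ge> 0" "\<And>w. w \<in> range B \<Longrightarrow> norm w \<le> K * norm (adj B w)"
    using closed_range_adjoint_bounded_below[OF assms] by blast
  have M: "closed_csubspace (range B)"
    using cl csubspace_range[OF B] by (simp add: closed_csubspace_def)
  define L where "L = {x. norm x \<le> K * norm (B x)}"
  have "adj B w \<in> L" for w
  proof -
    define u where "u = orth_proj (range B) w"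
    have u: "u \<in> range B" unfolding u_def by (rule orth_proj_mem[OF M])
    have "w - u \<in> nullspace (adj B)"
      unfolding u_def using orth_proj_compl[OF M] by (simp add: ortho_range[OF B])
    then have e: "adj B w = adj B u" by (simp add: nullspace_def blinfun.diff_right)
    have "(norm (adj B u))\<^sup>2 = inner (B (adj B u)) u"
      by (simp add: power2_norm_eq_inner adj_inner[OF B])
    also have "\<dots> \<le> norm (B (adj B u)) * norm u" by (rule norm_cauchy_schwarz)
    also have "\<dots> \<le> norm (B (adj B u)) * (K * norm (adj B u))"
      by (intro mult_left_mono K u) auto
    finally have "norm (adj B u) * norm (adj B u) \<le> norm (adj B u) * (K * norm (B (adj B u)))"
      by (simp add: power2_eq_square algebra_simps)
    then have "norm (adj B u) \<le> K * norm (B (adj B u))"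
      using K(1) by (cases "adj B u = 0") auto
    then show ?thesis by (simp add: L_def e)
  qed
  moreover have "closed L"
    unfolding L_def by (intro closed_Collect_le continuous_intros)
  ultimately have sub: "closure (range (adj B)) \<subseteq> L"
    by (intro closure_minimal) auto
  have "ortho (nullspace B) = ortho (ortho (closure (range (adj B))))"
    using ortho_range[of "adj B"] B by (simp add: ortho_closure)
  also have "\<dots> = closure (range (adj B))"
    by (intro ortho_ortho csubspace_closure csubspace_range adj_bounded B)
  finally show ?thesis using sub by (auto simp: L_def)
qed

text \<open>\<open>G\<close> projects onto \<open>R(B)\<close> and then inverts \<open>B\<close> there with values orthogonal to \<open>N(B)\<close>; that is the
  Moore-Penrose inverse.\<close>

lemma generalized_inverse:
  fixes B :: "'a::complex_hilbert_space \<Rightarrow>\<^sub>L 'a"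
  assumes B: "B \<in> bounded_ops" and cl: "closed (range B)"
  shows "\<exists>G\<in>bounded_ops. \<forall>x. B (G (B x)) = B x"
proof -
  obtain K where K: "\<And>x. x \<in> ortho (nullspace B) \<Longrightarrow> norm x \<le> K * norm (B x)"
    using closed_range_bounded_below[OF assms] by blast
  have M: "closed_csubspace (range B)"
    using cl csubspace_range[OF B] by (simp add: closed_csubspace_def)
  have N: "closed_csubspace (nullspace B)" by (rule closed_csubspace_nullspace[OF B])
  have subN: "complex_vec.subspace (ortho (nullspace B))"
    using closed_csubspace_ortho by (auto simp: closed_csubspace_def)
  let ?P = "orth_proj (range B)"
  have "\<exists>x\<in>ortho (nullspace B). B x = ?P y" for y
  proof -
    obtain x where x: "?P y = B x" using orth_proj_mem[OF M, of y] by blast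
    have "B (orth_proj (nullspace B) x) = 0"
      using orth_proj_mem[OF N, of x] by (simp add: nullspace_def)
    then have "B (x - orth_proj (nullspace B) x) = ?P y"
      by (simp add: x blinfun.diff_right)
    then show ?thesis using orth_proj_compl[OF N] by blast
  qed
  then obtain g where g: "\<And>y. g y \<in> ortho (nullspace B)" "\<And>y. B (g y) = ?P y" by metis
  have uniq: "g y = x" if x: "x \<in> ortho (nullspace B)" "B x = ?P y" for x y
  proof -
    have "g y - x \<in> ortho (nullspace B)" using g x subN complex_vec.subspace_diff by blast
    moreover have "g y - x \<in> nullspace B" using g x by (simp add: nullspace_def blinfun.diff_right)
    ultimately show ?thesis using ortho_Int_zero[of "g y - x"] by simp
  qed
  have Pb: "?P \<in> bounded_ops" by (rule orth_proj_bounded[OF M])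
  have "\<exists>G\<in>bounded_ops. blinfun_apply G = g"
  proof (rule bounded_op_exists[where K = "\<bar>K\<bar> * norm ?P"])
    fix x y :: 'a and c
    show "g (x + y) = g x + g y"
      using g by (intro uniq complex_vec.subspace_add[OF subN]) (auto simp: blinfun.add_right)
    show "g (c *\<^sub>C x) = c *\<^sub>C g x"
      using g by (intro uniq complex_vec.subspace_scale[OF subN])
        (auto simp: bounded_ops_scaleC[OF B] bounded_ops_scaleC[OF Pb])
    have "norm (g x) \<le> K * norm (?P x)" using K[OF g(1)] g(2) by metis
    also have "\<dots> \<le> \<bar>K\<bar> * (norm ?P * norm x)"
      by (intro mult_mono norm_blinfun) auto
    finally show "norm (g x) \<le> \<bar>K\<bar> * norm ?P * norm x" by (simp add: mult.assoc)
  qed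
  then obtain G where "G \<in> bounded_ops" "blinfun_apply G = g" by blast
  moreover have "B (g (B x)) = B x" for x using g(2) orth_proj_fixes[OF M] by simp
  ultimately show ?thesis by metis
qed

text \<open>With generalized inverses \<open>G\<close> of \<open>A\<close> and \<open>F\<close> of \<open>B\<close> the middle factor \<open>GTF\<close> works: \<open>AG\<close> fixes \<open>R(A)\<close>, and
  \<open>FB\<close> changes a vector only by an element of \<open>N(B)\<close>.\<close>

lemma factorization_exists:
  fixes A B T :: "'a::complex_hilbert_space \<Rightarrow>\<^sub>L 'a"
  assumes A: "A \<in> bounded_ops" "closed (range A)" and B: "B \<in> bounded_ops" "closed (range B)"
    and T: "T \<in> bounded_ops" "range T \<subseteq> range A" "nullspace B \<subseteq> nullspace T"
  shows "\<exists>X\<in>bounded_ops. A o\<^sub>L X o\<^sub>L B = T"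
proof -
  obtain G where G: "G \<in> bounded_ops" "\<And>x. A (G (A x)) = A x" using generalized_inverse[OF A] by blast
  obtain F where F: "F \<in> bounded_ops" "\<And>x. B (F (B x)) = B x" using generalized_inverse[OF B] by blast
  have "A o\<^sub>L (G o\<^sub>L T o\<^sub>L F) o\<^sub>L B = T"
  proof (rule blinfun_eqI)
    fix x
    have "F (B x) - x \<in> nullspace B" by (simp add: nullspace_def blinfun.diff_right F(2))
    then have "T (F (B x) - x) = 0" using T(3) by (auto simp: nullspace_def)
    then have "T (F (B x)) = T x" by (simp add: blinfun.diff_right)
    moreover obtain z where "T x = A z" using T(2) by blast
    ultimately show "(A o\<^sub>L (G o\<^sub>L T o\<^sub>L F) o\<^sub>L B) x = T x" by (simp add: G(2))
  qed
  then show ?thesis using G F T by (intro bexI[of _ "G o\<^sub>L T o\<^sub>L F"]) auto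
qed

section \<open>Compatibility and attainment of the shorted operator\<close>

lemma adj_residual_form:
  assumes "A \<in> bounded_ops" "B \<in> bounded_ops" "X \<in> bounded_ops"
  shows "inner ((adj (residual A B X) o\<^sub>L W o\<^sub>L residual A B X) x) y =
    inner (W (A (X (B x)) - x)) (A (X (B y)) - y)"
  using assms by (subst congruence_form) (simp_all add: residual_def blinfun.diff_left)

lemma compatible_projection_symmetric:
  assumes "W \<in> pos_ops" "Q \<in> bounded_ops" "W o\<^sub>L Q = adj Q o\<^sub>L W"
  shows "inner (W (Q x)) y = inner (W x) (Q y)"
proof -
  have "W (Q x) = adj Q (W x)"
    using arg_cong[OF assms(3), of "\<lambda>T. blinfun_apply T x"] by simp
  then show ?thesis using adj_inner_right[OF assms(2), of "W x" y] by simp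
qed

lemma compatible_projection_range_ortho:
  assumes W: "W \<in> pos_ops" and Q: "Q \<in> bounded_ops" "Q o\<^sub>L Q = Q"
    and WQ: "W o\<^sub>L Q = adj Q o\<^sub>L W"
  shows "inner (W (x - Q x)) (Q y) = 0"
proof -
  have "Q (Q y) = Q y"
    using arg_cong[OF Q(2), of "\<lambda>T. blinfun_apply T y"] by simp
  then show ?thesis
    using compatible_projection_symmetric[OF W Q(1) WQ, of x "Q y"]
    by (simp add: blinfun.diff_right inner_diff_left)
qed

text \<open>\<open>R(I - Q)\<close> is \<open>W\<close>-orthogonal to \<open>R(Q) = S\<close>, so \<open>Qx\<close> is a point of \<open>S\<close> of least \<open>W\<close>-distance from \<open>x\<close>, and
  \<open>W(I - Q)\<close> is the form of that distance.\<close>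

lemma shorted_of_compatible:
  assumes W: "W \<in> pos_ops" and Q: "Q \<in> bounded_ops" "Q o\<^sub>L Q = Q" "range Q = S"
    and WQ: "W o\<^sub>L Q = adj Q o\<^sub>L W"
  shows "shorted W S = W o\<^sub>L (id_blinfun - Q)"
proof (rule shorted_eqI)
  define X where "X = W o\<^sub>L (id_blinfun - Q)"
  have S: "complex_vec.subspace S" using csubspace_range[OF Q(1)] Q(3) by simp
  have ortho: "inner (W (x - Q x)) (Q y) = 0" for x y
    by (rule compatible_projection_range_ortho[OF W Q(1,2) WQ])
  have X_apply: "X x = W (x - Q x)" for x
    by (simp add: X_def blinfun.diff_left)
  have X_form: "inner (X x) y = inner (W (x - Q x)) (y - Q y)" for x y
    by (simp add: X_apply inner_diff_right ortho)
  have X: "X \<in> pos_ops"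
    unfolding pos_ops_iff
  proof (intro conjI allI)
    show "X \<in> bounded_ops" using W Q by (simp add: X_def pos_ops_bounded)
    show "inner (X x) y = inner x (X y)" for x y
      using X_form[of x y] X_form[of y x] pos_ops_sym[OF W, of "x - Q x" "y - Q y"]
      by (metis inner_commute)
    show "0 \<le> inner (X x) x" for x using X_form pos_ops_nonneg[OF W] by simp
  qed
  have "inner (X x) x \<le> inner (W x) x" for x
  proof -
    have "inner (W x) x = inner (X x) x + inner (W (Q x)) x"
      by (simp add: X_apply blinfun.diff_right inner_diff_left)
    also have "inner (W (Q x)) x = inner (W (Q x)) (Q x)"
      using ortho[of x x] compatible_projection_symmetric[OF W Q(1) WQ, of x x]
      by (simp add: blinfun.diff_right inner_diff_left)
    finally show ?thesis using pos_ops_nonneg[OF W, of "Q x"] by linarith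
  qed
  then have XW: "op_le X W" using X W by (simp add: op_le_iff pos_ops_self_adjoint)
  have "X x \<in> ortho S" for x
    unfolding X_apply ortho_iff_inner[OF S] using ortho Q(3) by auto
  then have "range X \<subseteq> ortho S" by blast
  then show "X \<in> shorted_candidates W S"
    using X XW by (simp add: shorted_candidates_def op_le_def pos_ops_bounded)
  fix Y assume Y: "Y \<in> shorted_candidates W S"
  have "inner (Y x) x \<le> inner (X x) x" for x
    unfolding X_form using Q(3) by (intro shorted_candidate_form_le[OF W Y]) blast
  then show "op_le Y X"
    using X Y by (simp add: op_le_iff pos_ops_self_adjoint shorted_candidate_pos)
qed

lemma closed_csubspace_common_kernel:
  assumes "A \<in> bounded_ops" "closed (range A)" "W \<in> bounded_ops"
  shows "closed_csubspace (range (blinfun_apply A) \<inter> nullspace W)"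
  using assms by (intro closed_csubspace_Int closed_csubspace_nullspace)
    (simp_all add: closed_csubspace_def csubspace_range)

text \<open>If \<open>x\<close> is in \<open>N(B)\<close>, then \<open>Wx\<close> is orthogonal to \<open>R(Q)\<close>, hence \<open>WQx = 0\<close> and \<open>Qx\<close> lies in \<open>R(A) \<inter> N(W)\<close>.
  Removing from \<open>Q\<close> the component in this subspace produces an operator that vanishes on \<open>N(B)\<close>, and \<open>W\<close>
  cannot tell it from \<open>Q\<close>.\<close>

lemma compatible_imp_attained:
  fixes A B W :: "'a::complex_hilbert_space \<Rightarrow>\<^sub>L 'a"
  assumes A: "A \<in> bounded_ops" "closed (range A)" and B: "B \<in> bounded_ops" "closed (range B)"
    and W: "W \<in> pos_ops" and NB: "nullspace B = ortho_weighted W (range A)"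
    and comp: "compatible W (range A)"
  shows "shorted W (range A) \<in> residual_forms W A B"
proof -
  obtain Q where Q: "Q \<in> bounded_ops" "Q o\<^sub>L Q = Q" "range Q = range A" "W o\<^sub>L Q = adj Q o\<^sub>L W"
    using comp unfolding compatible_def by blast
  define N where "N = range A \<inter> nullspace W"
  have N: "closed_csubspace N"
    unfolding N_def using A pos_ops_bounded[OF W] by (rule closed_csubspace_common_kernel)
  let ?P = "orth_proj N"
  define T where "T = Q - (?P o\<^sub>L Q)"
  have T_apply: "T x = Q x - ?P (Q x)" for x by (simp add: T_def blinfun.diff_left)
  have Pb: "?P \<in> bounded_ops" by (rule orth_proj_bounded[OF N])
  have sub: "complex_vec.subspace (range A)" by (rule csubspace_range[OF A(1)])
  have "\<exists>X\<in>bounded_ops. A o\<^sub>L X o\<^sub>L B = T"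
  proof (rule factorization_exists[OF A B])
    show "T \<in> bounded_ops" using Q Pb by (simp add: T_def)
    show "range T \<subseteq> range A"
    proof clarify
      fix x
      have "Q x \<in> range A" using Q(3) by blast
      moreover have "?P (Q x) \<in> range A" using orth_proj_mem[OF N] by (auto simp: N_def)
      ultimately show "T x \<in> range A"
        unfolding T_apply by (rule complex_vec.subspace_diff[OF sub])
    qed
    show "nullspace B \<subseteq> nullspace T"
    proof
      fix x assume "x \<in> nullspace B"
      then have Wx: "W x \<in> ortho (range A)" by (simp add: NB ortho_weighted_def ortho_def)
      have Qr: "Q y \<in> range A" for y using Q(3) by blast
      have "inner (W (Q x)) (W (Q x)) = inner (W x) (Q (W (Q x)))"
        by (rule compatible_projection_symmetric[OF W Q(1,4)])
      also have "\<dots> = 0" using Wx Qr ortho_iff_inner[OF sub] by blast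
      finally have "Q x \<in> N" using Qr by (simp add: N_def nullspace_def)
      then show "x \<in> nullspace T" by (simp add: nullspace_def T_apply orth_proj_fixes[OF N])
    qed
  qed
  then obtain X where X: "X \<in> bounded_ops" "A o\<^sub>L X o\<^sub>L B = T" by blast
  have AXB: "A (X (B x)) = T x" for x
    using arg_cong[OF X(2), of "\<lambda>T. blinfun_apply T x"] by simp
  have WT: "W (T x - x) = W (Q x - x)" for x
    using orth_proj_mem[OF N, of "Q x"] by (simp add: T_apply blinfun.diff_right N_def nullspace_def)
  have "shorted W (range A) = adj (residual A B X) o\<^sub>L W o\<^sub>L residual A B X"
  proof (rule blinfun_eq_by_inner)
    fix x y
    have "inner ((adj (residual A B X) o\<^sub>L W o\<^sub>L residual A B X) y) x = inner (W (T y - y)) (T x - x)"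
      using adj_residual_form[OF A(1) B(1) X(1)] AXB by simp
    also have "\<dots> = inner (Q y - y) (W (T x - x))"
      by (simp only: WT pos_ops_sym[OF W])
    also have "\<dots> = inner (W (y - Q y)) (x - Q x)"
      unfolding WT pos_ops_sym[OF W, symmetric] by (rule form_swap_minus)
    also have "\<dots> = inner (W (y - Q y)) x"
      using compatible_projection_range_ortho[OF W Q(1,2,4)] by (simp add: inner_diff_right)
    also have "W (y - Q y) = shorted W (range A) y"
      by (simp add: shorted_of_compatible[OF W Q] blinfun.diff_left)
    finally show "inner x (shorted W (range A) y)
        = inner x ((adj (residual A B X) o\<^sub>L W o\<^sub>L residual A B X) y)"
      by (metis inner_commute)
  qed
  then show ?thesis using X(1) unfolding residual_forms_def by blast
qed

lemma shorted_form_le_residual: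
  assumes A: "A \<in> bounded_ops" and B: "B \<in> bounded_ops" and W: "W \<in> pos_ops" and X: "X \<in> bounded_ops"
  shows "inner (shorted W (range (blinfun_apply A)) x) x
    \<le> inner ((adj (residual A B X) o\<^sub>L W o\<^sub>L residual A B X) x) x"
proof -
  have "inner (shorted W (range A) x) x
      \<le> inner (W (x - A (X (B x)))) (x - A (X (B x)))"
    by (intro shorted_candidate_form_le[OF W shorted_candidate[OF W csubspace_range[OF A]]]) simp
  also have "\<dots> = inner (W (A (X (B x)) - x)) (A (X (B x)) - x)"
    by (rule form_swap_minus)
  finally show ?thesis using adj_residual_form[OF A B X] by simp
qed

text \<open>Attainment says that \<open>Tx\<close> is a point of \<open>R(A)\<close> of least \<open>W\<close>-distance from \<open>x\<close>, hence \<open>W(x - Tx)\<close> is orthogonal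
  to \<open>R(A)\<close>. For \<open>s\<close> in \<open>R(A)\<close> the vector \<open>s - Ts\<close> is in \<open>R(A)\<close> itself, so its \<open>W\<close>-norm is zero and it lies
  in \<open>N = R(A) \<inter> N(W)\<close>. With \<open>P\<close> the orthogonal projection onto \<open>N\<close>, the operator \<open>Q = P + (I - P)T\<close>
  therefore fixes \<open>R(A)\<close>, while \<open>WQ = WT\<close> keeps the normal equation.\<close>

lemma attained_imp_compatible:
  fixes A B W :: "'a::complex_hilbert_space \<Rightarrow>\<^sub>L 'a"
  assumes A: "A \<in> bounded_ops" "closed (range A)" and B: "B \<in> bounded_ops" and W: "W \<in> pos_ops"
    and att: "shorted W (range A) \<in> residual_forms W A B"
  shows "compatible W (range A)"
proof -
  obtain X where X: "X \<in> bounded_ops"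
    and C: "shorted W (range A) = adj (residual A B X) o\<^sub>L W o\<^sub>L residual A B X"
    using att unfolding residual_forms_def by blast
  define T where "T = A o\<^sub>L X o\<^sub>L B"
  have Tb: "T \<in> bounded_ops" using A B X by (simp add: T_def)
  have Tr: "T x \<in> range A" for x by (simp add: T_def)
  have sub: "complex_vec.subspace (range A)" by (rule csubspace_range[OF A(1)])
  have cand: "shorted W (range A) \<in> shorted_candidates W (range A)"
    by (rule shorted_candidate[OF W sub])
  have C_form: "inner (shorted W (range A) x) x = inner (W (x - T x)) (x - T x)" for x
    unfolding C adj_residual_form[OF A(1) B X] form_swap_minus[of W x] by (simp add: T_def)
  have normal: "inner (W (x - T x)) s = 0" if s: "s \<in> range A" for x s
  proof (rule quadratic_nonneg_imp_linear_zero)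
    fix t :: real
    define u where "u = x - T x"
    have "T x - t *\<^sub>R s \<in> range A"
      by (intro complex_vec.subspace_diff[OF sub] Tr csubspace_scaleR[OF sub] s)
    from shorted_candidate_form_le[OF W cand this, of x]
    have "inner (W u) u \<le> inner (W (u + t *\<^sub>R s)) (u + t *\<^sub>R s)"
      by (simp add: C_form u_def algebra_simps)
    also have "\<dots> = inner (W u) u + (t * (2 * inner (W u) s) + t\<^sup>2 * inner (W s) s)"
      using pos_ops_sym[OF W, of s u]
      by (simp add: blinfun.add_right blinfun.scaleR_right inner_add_left inner_add_right
          inner_commute[of s "W u"] power2_eq_square distrib_left)
    finally show "0 \<le> t * (2 * inner (W (x - T x)) s) + t\<^sup>2 * inner (W s) s"
      by (simp add: u_def)
  qed
  define N where "N = range A \<inter> nullspace W"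
  have N: "closed_csubspace N"
    unfolding N_def using A pos_ops_bounded[OF W] by (rule closed_csubspace_common_kernel)
  let ?P = "orth_proj N"
  define Q where "Q = ?P + T - (?P o\<^sub>L T)"
  have Q_apply: "Q x = ?P x + T x - ?P (T x)" for x
    by (simp add: Q_def blinfun.diff_left blinfun.add_left)
  have Qb: "Q \<in> bounded_ops" using Tb orth_proj_bounded[OF N] by (simp add: Q_def)
  have P_range: "?P x \<in> range A" and WP: "W (?P x) = 0" for x
    using orth_proj_mem[OF N, of x] by (auto simp: N_def nullspace_def)
  have Q_range: "Q x \<in> range A" for x
    unfolding Q_apply
    by (intro complex_vec.subspace_diff[OF sub] complex_vec.subspace_add[OF sub] Tr P_range)
  have Q_fix: "Q s = s" if s: "s \<in> range A" for s
  proof -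
    have d: "s - T s \<in> range A" by (intro complex_vec.subspace_diff[OF sub] Tr s)
    then have "W (s - T s) = 0" using pos_ops_zero_iff[OF W] normal by blast
    then have "s - T s \<in> N" using d by (simp add: N_def nullspace_def)
    then have "?P (s - T s) = s - T s" by (rule orth_proj_fixes[OF N])
    then show ?thesis by (simp add: Q_apply blinfun.diff_right algebra_simps)
  qed
  have WQ: "W (Q x) = W (T x)" for x
    by (simp add: Q_apply blinfun.diff_right blinfun.add_right WP)
  have half: "inner (W (Q x)) y = inner (W (Q x)) (Q y)" for x y
  proof -
    have "inner (W (Q x)) (y - Q y) = inner (Q x) (W (y - T y))"
      by (subst pos_ops_sym[OF W]) (simp add: blinfun.diff_right WQ)
    also have "\<dots> = 0" using normal[OF Q_range] by (metis inner_commute)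
    finally show ?thesis by (simp add: inner_diff_right)
  qed
  show ?thesis
    unfolding compatible_def
  proof (intro bexI conjI)
    show "Q \<in> bounded_ops" by (rule Qb)
    show "Q o\<^sub>L Q = Q" by (rule blinfun_eqI) (simp add: Q_fix Q_range)
    show "range Q = range A"
    proof
      show "range Q \<subseteq> range A" using Q_range by blast
      show "range A \<subseteq> range Q" using Q_fix by (metis image_subset_iff rangeI)
    qed
    show "W o\<^sub>L Q = adj Q o\<^sub>L W"
    proof (rule blinfun_eq_by_inner)
      fix x y
      have "inner x (W (Q y)) = inner (W (Q y)) (Q x)"
        using half[of y x] by (simp add: inner_commute)
      also have "\<dots> = inner (W (Q x)) (Q y)" by (metis pos_ops_sym[OF W] inner_commute)
      also have "\<dots> = inner (W (Q x)) y" by (rule half[symmetric])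
      also have "\<dots> = inner x ((adj Q o\<^sub>L W) y)"
        by (simp add: pos_ops_sym[OF W] adj_inner[OF Qb])
      finally show "inner x ((W o\<^sub>L Q) y) = inner x ((adj Q o\<^sub>L W) y)" by simp
    qed
  qed
qed

text \<open>The complementary projection \<open>E = I - Q\<close> maps into the \<open>W\<close>-orthogonal complement of \<open>R(A)\<close>, which is
  \<open>N(B)\<close>. So \<open>AXB\<close> vanishes on \<open>R(E)\<close>, and \<open>WE\<close> is orthogonal to \<open>R(AXB)\<close>: of the four terms of \<open>DE\<close> only
  \<open>WE = W(I - Q)\<close> is left, and taking adjoints gives \<open>E\<^sup>* D = W(I - Q)\<close>.\<close>

lemma compatible_imp_minus_le:
  fixes A B W :: "'a::complex_hilbert_space \<Rightarrow>\<^sub>L 'a"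
  assumes A: "A \<in> bounded_ops" and B: "B \<in> bounded_ops"
    and W: "W \<in> pos_ops" and NB: "nullspace B = ortho_weighted W (range A)"
    and comp: "compatible W (range A)" and D: "D \<in> residual_forms W A B"
  shows "minus_le (shorted W (range A)) D"
proof -
  obtain Q where Q: "Q \<in> bounded_ops" "Q o\<^sub>L Q = Q" "range Q = range A" "W o\<^sub>L Q = adj Q o\<^sub>L W"
    using comp unfolding compatible_def by blast
  obtain X where X: "X \<in> bounded_ops" and D_eq: "D = adj (residual A B X) o\<^sub>L W o\<^sub>L residual A B X"
    using D unfolding residual_forms_def by blast
  define E where "E = id_blinfun - Q"
  have E_apply: "E x = x - Q x" for x by (simp add: E_def blinfun.diff_left)
  have Eb: "E \<in> bounded_ops" using Q by (simp add: E_def)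
  have QQ: "Q (Q x) = Q x" for x
    using arg_cong[OF Q(2), of "\<lambda>T. blinfun_apply T x"] by simp
  have EE: "E o\<^sub>L E = E" by (rule blinfun_eqI) (simp add: E_apply blinfun.diff_right QQ)
  have sub: "complex_vec.subspace (range A)" by (rule csubspace_range[OF A])
  have ortho: "inner (W (E x)) s = 0" if s: "s \<in> range A" for x s
  proof -
    obtain y where "s = Q y" using s Q(3) by blast
    then show ?thesis
      using compatible_projection_range_ortho[OF W Q(1,2,4)] by (simp add: E_apply)
  qed
  have BE: "B (E x) = 0" for x
  proof -
    have "W (E x) \<in> ortho (range A)" using ortho ortho_iff_inner[OF sub] by blast
    then have "E x \<in> nullspace B" by (simp add: NB ortho_weighted_def ortho_def)
    then show ?thesis by (simp add: nullspace_def)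
  qed
  have C: "shorted W (range A) = W o\<^sub>L E"
    unfolding E_def by (rule shorted_of_compatible[OF W Q])
  have C_pos: "shorted W (range A) \<in> pos_ops"
    by (rule shorted_candidate_pos[OF shorted_candidate[OF W sub]])
  have D_pos: "D \<in> pos_ops"
    unfolding D_eq using A B X W by (intro pos_ops_congruence) (simp_all add: residual_def)
  have factor: "shorted W (range A) = adj E o\<^sub>L D"
  proof (rule blinfun_eq_by_inner)
    fix x y
    have "inner ((adj E o\<^sub>L D) y) x = inner (D y) (E x)"
      using adj_inner_right[OF Eb, of "D y" x] by simp
    also have "\<dots> = inner (W (A (X (B y)) - y)) (- E x)"
      unfolding D_eq adj_residual_form[OF A B X] BE by simp
    also have "\<dots> = inner y (W (E x)) - inner (A (X (B y))) (W (E x))"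
      by (simp add: pos_ops_sym[OF W] inner_diff_left)
    also have "\<dots> = inner y (W (E x))"
      using ortho[of "A (X (B y))" x] by (simp add: inner_commute)
    also have "\<dots> = inner (shorted W (range A) y) x"
      using pos_ops_sym[OF C_pos, of y x] by (simp add: C)
    finally show "inner x (shorted W (range A) y) = inner x ((adj E o\<^sub>L D) y)"
      by (simp add: inner_commute)
  qed
  have "adj E \<in> oblique_projections"
    using Eb adj_compose[OF Eb Eb] EE by (simp add: oblique_projections_def)
  moreover have "adj (shorted W (range A)) = adj E o\<^sub>L adj D"
    using C_pos D_pos factor pos_ops_self_adjoint self_adjoint_adj by metis
  ultimately show ?thesis unfolding minus_le_def using factor by blast
qed

section \<open>Eigenvectors of compact positive operators\<close>

lemma compact_op_subsequence:
  fixes T :: "'a::complex_hilbert_space \<Rightarrow>\<^sub>L 'a"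
  assumes T: "compact_op T" and x: "\<And>n::nat. norm (x n) \<le> K"
  shows "\<exists>l (r :: nat \<Rightarrow> nat). strict_mono r \<and> (\<lambda>n. T (x (r n))) \<longlonglongrightarrow> l"
proof -
  define c where "c = \<bar>K\<bar> + 1"
  have c: "c > 0" by (simp add: c_def add_nonneg_pos)
  have "norm (x n) \<le> c" for n using x[of n] by (simp add: c_def)
  then have "(1/c) *\<^sub>R x n \<in> cball 0 1" for n using c by (simp add: field_simps)
  then have "T ((1/c) *\<^sub>R x n) \<in> closure (T ` cball 0 1)" for n
    by (intro subsetD[OF closure_subset] imageI)
  then obtain l r where r: "strict_mono r" "((\<lambda>n. T ((1/c) *\<^sub>R x n)) \<circ> r) \<longlonglongrightarrow> l"
    using T unfolding compact_op_def compact_eq_seq_compact_metric seq_compact_def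
    by (metis (no_types, lifting))
  have "(\<lambda>n. c *\<^sub>R T ((1/c) *\<^sub>R x (r n))) \<longlonglongrightarrow> c *\<^sub>R l"
    using r(2) by (intro tendsto_intros) (simp add: o_def)
  then have "(\<lambda>n. T (x (r n))) \<longlonglongrightarrow> c *\<^sub>R l"
    using c by (simp add: blinfun.scaleR_right)
  then show ?thesis using r(1) by blast
qed

text \<open>\<open>S\<close> maps sequences that \<open>TY\<close> makes convergent to Cauchy sequences. All compactness statements about
  moduli and square roots follow from this, since these are known only through the norms of their values.\<close>

lemma compact_op_dominated:
  fixes S T Y :: "'a::complex_hilbert_space \<Rightarrow>\<^sub>L 'a"
  assumes T: "compact_op T" and le: "\<And>x. norm (S x) \<le> norm (T (Y x))"
  shows "compact_op S"
  unfolding compact_op_def compact_eq_seq_compact_metric seq_compact_def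
proof (intro allI impI)
  fix y :: "nat \<Rightarrow> 'a" assume y: "\<forall>n. y n \<in> closure (S ` cball 0 1)"
  have "\<exists>x\<in>cball 0 1. dist (S x) (y n) < inverse (real (Suc n))" for n
    using y closure_approachable[of "y n" "S ` cball 0 1"] by auto
  then obtain x where x: "\<And>n. norm (x n) \<le> 1" "\<And>n. dist (S (x n)) (y n) < inverse (real (Suc n))"
    by (metis mem_cball_0)
  have "norm (Y (x n)) \<le> norm Y" for n
    using order_trans[OF norm_blinfun mult_left_le, of "x n" Y] x(1)[of n] by simp
  from compact_op_subsequence[where x = "\<lambda>n. Y (x n)", OF T this] obtain l r
    where r: "strict_mono r" "(\<lambda>n. T (Y (x (r n)))) \<longlonglongrightarrow> l" by blast
  have "Cauchy (\<lambda>n. S (x (r n)))"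
  proof (rule CauchyI)
    fix e :: real assume "e > 0"
    then obtain N where N: "\<forall>m\<ge>N. \<forall>n\<ge>N. norm (T (Y (x (r m))) - T (Y (x (r n)))) < e"
      using CauchyD[OF LIMSEQ_imp_Cauchy[OF r(2)]] by blast
    have "norm (S (x (r m)) - S (x (r n))) \<le> norm (T (Y (x (r m))) - T (Y (x (r n))))" for m n
      using le[of "x (r m) - x (r n)"] by (simp add: blinfun.diff_right)
    then show "\<exists>N. \<forall>m\<ge>N. \<forall>n\<ge>N. norm (S (x (r m)) - S (x (r n))) < e"
      using N le_less_trans by blast
  qed
  then obtain z where z: "(\<lambda>n. S (x (r n))) \<longlonglongrightarrow> z"
    using Cauchy_convergent convergent_def by blast
  have "(\<lambda>n. norm (S (x (r n)) - y (r n))) \<longlonglongrightarrow> 0"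
  proof (rule tendsto_sandwich[where f = "\<lambda>_. 0" and h = "\<lambda>n. inverse (real (Suc (r n)))"])
    show "(\<lambda>n. inverse (real (Suc (r n)))) \<longlonglongrightarrow> 0"
      using LIMSEQ_subseq_LIMSEQ[OF LIMSEQ_inverse_real_of_nat r(1)] by (simp add: o_def)
    show "\<forall>\<^sub>F n in sequentially. norm (S (x (r n)) - y (r n)) \<le> inverse (real (Suc (r n)))"
      using x(2) by (intro always_eventually allI less_imp_le) (simp only: dist_norm)
  qed auto
  then have "(\<lambda>n. S (x (r n)) - y (r n)) \<longlonglongrightarrow> 0" by (simp only: tendsto_norm_zero_iff)
  from tendsto_diff[OF z this] have yz: "(\<lambda>n. y (r n)) \<longlonglongrightarrow> z" by simp
  then have "z \<in> closure (S ` cball 0 1)"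
    using y closed_sequentially[OF closed_closure] by metis
  then show "\<exists>l\<in>closure (S ` cball 0 1). \<exists>r. strict_mono r \<and> (y \<circ> r) \<longlonglongrightarrow> l"
    using yz r(1) by (auto simp: o_def)
qed

text \<open>\<open>w = Rz - sz\<close> satisfies \<open>Rw = -sw\<close>, and a positive operator has no negative eigenvalue.\<close>

lemma pos_ops_eigenvector_of_square:
  assumes R: "R \<in> pos_ops" and s: "s > 0" and sq: "blinfun_apply R (R z) = s\<^sup>2 *\<^sub>R z"
  shows "R z = s *\<^sub>R z"
proof -
  define w where "w = R z - s *\<^sub>R z"
  have "R w = - (s *\<^sub>R w)"
    by (simp add: w_def blinfun.diff_right blinfun.scaleR_right sq scaleR_diff_right power2_eq_square)
  then have "0 \<le> - (s * (norm w)\<^sup>2)"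
    using pos_ops_nonneg[OF R, of w] by (simp add: power2_norm_eq_inner)
  then have "w = 0" using s by (simp add: mult_le_0_iff)
  then show ?thesis by (simp add: w_def)
qed

text \<open>Let \<open>r\<close> be the norm of \<open>R\<close> on \<open>M\<close>, which exceeds \<open>e\<close> by the assumption on \<open>x\<close>. A maximizing sequence in
  the unit ball satisfies \<open>R\<^sup>2u - r\<^sup>2u \<rightarrow> 0\<close>; by compactness a subsequence of \<open>Ru\<close>, and with it \<open>u\<close>, converges, and
  the limit is an eigenvector of \<open>R\<^sup>2\<close> to the eigenvalue \<open>r\<^sup>2\<close>.\<close>

lemma compact_pos_eigenvector_exists:
  fixes R :: "'a::complex_hilbert_space \<Rightarrow>\<^sub>L 'a"
  assumes R: "R \<in> pos_ops" "compact_op R" and M: "closed_csubspace M"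
    and inv: "\<And>x. x \<in> M \<Longrightarrow> R x \<in> M" and e: "e \<ge> 0" and x: "x \<in> M" "e * (norm x)\<^sup>2 < inner (R x) x"
  shows "\<exists>s>e. \<exists>v\<in>M. v \<noteq> 0 \<and> R v = s *\<^sub>R v"
proof -
  have sub: "complex_vec.subspace M" and cl: "closed M" using M by (auto simp: closed_csubspace_def)
  define r where "r = (SUP y\<in>M \<inter> cball 0 1. norm (R y))"
  have bdd: "bdd_above ((\<lambda>y. norm (R y)) ` (M \<inter> cball 0 1))"
  proof (rule bdd_aboveI2)
    fix y assume "y \<in> M \<inter> cball 0 1"
    then show "norm (R y) \<le> norm R"
      using order_trans[OF norm_blinfun mult_left_le, of y R] by simp
  qed
  have le_r: "norm (R y) \<le> r" if "y \<in> M" "norm y \<le> 1" for y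
    unfolding r_def using that bdd by (intro cSUP_upper) auto
  have r_bound: "norm (R y) \<le> r * norm y" if "y \<in> M" for y
  proof (cases "y = 0")
    case False
    have "norm (R (y /\<^sub>R norm y)) \<le> r"
      using that False by (intro le_r csubspace_scaleR[OF sub]) auto
    then show ?thesis using False by (simp add: blinfun.scaleR_right field_simps)
  qed simp
  have "x \<noteq> 0" using x(2) by auto
  have "e * (norm x)\<^sup>2 < norm (R x) * norm x"
    using x(2) norm_cauchy_schwarz[of "R x" x] by linarith
  also have "\<dots> \<le> (r * norm x) * norm x" by (intro mult_right_mono r_bound x) simp
  finally have "e * (norm x)\<^sup>2 < r * (norm x)\<^sup>2" by (simp add: power2_eq_square)
  then have re: "r > e" using \<open>x \<noteq> 0\<close> by simp
  then have r0: "r > 0" using e by simp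
  have "\<exists>y\<in>M \<inter> cball 0 1. r - inverse (real (Suc n)) < norm (R y)" for n
  proof -
    have "r - inverse (real (Suc n)) < r" by simp
    moreover have "M \<inter> cball 0 1 \<noteq> {}"
      using complex_vec.subspace_0[OF sub] by (auto intro!: exI[of _ 0])
    ultimately show ?thesis unfolding r_def using less_cSUP_iff[OF _ bdd] by blast
  qed
  then obtain u where u: "\<And>n. u n \<in> M" "\<And>n. norm (u n) \<le> 1"
      "\<And>n. r - inverse (real (Suc n)) < norm (R (u n))"
    by (metis IntD1 IntD2 mem_cball_0)
  obtain y f where f: "strict_mono f" "(\<lambda>n. R (u (f n))) \<longlonglongrightarrow> y"
    using compact_op_subsequence[where x = u, OF R(2) u(2)] by blast
  have norm_lim: "(\<lambda>n. norm (R (u (f n)))) \<longlonglongrightarrow> r"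
  proof (rule tendsto_sandwich[where h = "\<lambda>_. r"])
    have "(\<lambda>n. inverse (real (Suc (f n)))) \<longlonglongrightarrow> 0"
      using LIMSEQ_subseq_LIMSEQ[OF LIMSEQ_inverse_real_of_nat f(1)] by (simp add: o_def)
    then show "(\<lambda>n. r - inverse (real (Suc (f n)))) \<longlonglongrightarrow> r"
      using tendsto_diff[OF tendsto_const] by fastforce
    show "\<forall>\<^sub>F n in sequentially. r - inverse (real (Suc (f n))) \<le> norm (R (u (f n)))"
      using u(3) by (intro always_eventually allI less_imp_le)
    show "\<forall>\<^sub>F n in sequentially. norm (R (u (f n))) \<le> r"
      by (intro always_eventually allI le_r u)
  qed simp
  define d where "d n = R (R (u (f n))) - r\<^sup>2 *\<^sub>R u (f n)" for n
  have d_le: "(norm (d n))\<^sup>2 \<le> r\<^sup>2 * (r\<^sup>2 - (norm (R (u (f n))))\<^sup>2)" for n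
  proof -
    let ?x = "u (f n)"
    have "(norm (d n))\<^sup>2 = (norm (R (R ?x)))\<^sup>2 - 2 * r\<^sup>2 * (norm (R ?x))\<^sup>2 + r\<^sup>2 * r\<^sup>2 * (norm ?x)\<^sup>2"
      using pos_ops_sym[OF R(1), of "R ?x" ?x]
      by (simp add: d_def power2_norm_eq_inner inner_diff_left inner_diff_right
          inner_commute[of ?x "R (R ?x)"])
        (simp add: right_diff_distrib power4_eq_xxxx power2_eq_square)
    moreover have "(norm (R (R ?x)))\<^sup>2 \<le> r\<^sup>2 * (norm (R ?x))\<^sup>2"
      using power_mono[OF r_bound[OF inv[OF u(1)]], of _ 2] by (simp add: power_mult_distrib)
    moreover have "r\<^sup>2 * r\<^sup>2 * (norm ?x)\<^sup>2 \<le> r\<^sup>2 * r\<^sup>2 * 1"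
      using u(2) by (intro mult_left_mono) (auto simp: power_le_one)
    ultimately show ?thesis by (simp add: right_diff_distrib)
  qed
  have "(\<lambda>n. (norm (d n))\<^sup>2) \<longlonglongrightarrow> 0"
  proof (rule tendsto_sandwich[where f = "\<lambda>_. 0"])
    have "(\<lambda>n. r\<^sup>2 * (r\<^sup>2 - (norm (R (u (f n))))\<^sup>2)) \<longlonglongrightarrow> r\<^sup>2 * (r\<^sup>2 - r\<^sup>2)"
      by (intro tendsto_intros norm_lim)
    then show "(\<lambda>n. r\<^sup>2 * (r\<^sup>2 - (norm (R (u (f n))))\<^sup>2)) \<longlonglongrightarrow> 0" by simp
  qed (use d_le in auto)
  then have "(\<lambda>n. sqrt ((norm (d n))\<^sup>2)) \<longlonglongrightarrow> sqrt 0" by (rule tendsto_real_sqrt)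
  then have d0: "d \<longlonglongrightarrow> 0" by (simp add: tendsto_norm_zero_iff)
  define z where "z = (1 / r\<^sup>2) *\<^sub>R R y"
  have "(\<lambda>n. (1 / r\<^sup>2) *\<^sub>R (R (R (u (f n))) - d n)) \<longlonglongrightarrow> (1 / r\<^sup>2) *\<^sub>R (R y - 0)"
    by (intro tendsto_intros f(2) d0)
  then have uz: "(\<lambda>n. u (f n)) \<longlonglongrightarrow> z" using r0 by (simp add: d_def z_def)
  have zM: "z \<in> M" using closed_sequentially[OF cl _ uz] u(1) by blast
  have "(\<lambda>n. R (u (f n))) \<longlonglongrightarrow> R z" by (intro tendsto_intros uz)
  then have y: "y = R z" using f(2) LIMSEQ_unique by blast
  have "norm y = r" using LIMSEQ_unique[OF tendsto_norm[OF f(2)] norm_lim] .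
  then have "z \<noteq> 0" using y r0 by auto
  moreover have "R (R z) = r\<^sup>2 *\<^sub>R z" using r0 unfolding y[symmetric] by (simp add: z_def)
  then have "R z = r *\<^sub>R z" by (rule pos_ops_eigenvector_of_square[OF R(1) r0])
  ultimately show ?thesis using re zM by blast
qed

definition orthonormal :: "'a::complex_hilbert_space set \<Rightarrow> bool"
  where "orthonormal Z \<longleftrightarrow> (\<forall>e\<in>Z. norm e = 1) \<and> (\<forall>e\<in>Z. \<forall>f\<in>Z. e \<noteq> f \<longrightarrow> cinner e f = 0)"

lemma orthonormal_subset: "orthonormal Z \<Longrightarrow> F \<subseteq> Z \<Longrightarrow> orthonormal F"
  by (auto simp: orthonormal_def)

lemma orthonormal_insert:
  assumes "orthonormal Z" "norm v = 1" "\<And>e. e \<in> Z \<Longrightarrow> cinner v e = 0"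
  shows "orthonormal (insert v Z)"
proof -
  have "cinner e v = 0" if "e \<in> Z" for e
    using assms(3)[OF that] by (metis cinner_commute complex_cnj_zero)
  then show ?thesis using assms by (auto simp: orthonormal_def)
qed

text \<open>For finite orthonormal \<open>F\<close> this is the orthogonal projection of \<open>x\<close> onto the span of \<open>F\<close>.\<close>

definition coordinate_sum :: "'a::complex_hilbert_space set \<Rightarrow> 'a \<Rightarrow> 'a"
  where "coordinate_sum F x = (\<Sum>f\<in>F. cinner x f *\<^sub>C f)"

lemma cinner_orthonormal_sum:
  assumes "orthonormal F" "finite F" "g \<in> F"
  shows "cinner (\<Sum>f\<in>F. u f *\<^sub>C f) g = u g"
proof -
  have "cinner (\<Sum>f\<in>F. u f *\<^sub>C f) g = (\<Sum>f\<in>F. if f = g then u g else 0)"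
    unfolding cinner_sum_left cinner_scaleC_left
    using assms by (intro sum.cong) (auto simp: orthonormal_def cinner_self)
  then show ?thesis using assms by simp
qed

lemma coordinate_sum_compl:
  assumes "orthonormal F" "finite F" "g \<in> F"
  shows "cinner (x - coordinate_sum F x) g = 0"
  using cinner_orthonormal_sum[OF assms] by (simp add: coordinate_sum_def cinner_diff_left)

lemma inner_coordinate_sum:
  "inner (coordinate_sum F x) y = (\<Sum>f\<in>F. Re (cinner x f * cnj (cinner y f)))"
  unfolding coordinate_sum_def inner_eq_Re_cinner cinner_sum_left cinner_scaleC_left Re_sum
  by (intro sum.cong refl) (metis cinner_commute)

lemma Re_mult_cnj_self: "Re (z * cnj z) = (cmod z)\<^sup>2"
  by (simp only: complex_norm_square[symmetric] Re_complex_of_real)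

lemma pythagoras_coordinate_sum:
  assumes F: "orthonormal F" "finite F"
  shows "(norm x)\<^sup>2 = (\<Sum>f\<in>F. (cmod (cinner x f))\<^sup>2) + (norm (x - coordinate_sum F x))\<^sup>2"
proof -
  let ?y = "coordinate_sum F x"
  have "inner ?y (x - ?y) = 0"
    using coordinate_sum_compl[OF F] by (simp add: inner_coordinate_sum)
  then have "(norm x)\<^sup>2 = inner ?y x + (norm (x - ?y))\<^sup>2"
    by (simp add: power2_norm_eq_inner inner_diff_left inner_diff_right inner_commute)
  then show ?thesis by (simp only: inner_coordinate_sum Re_mult_cnj_self)
qed

lemma bessel_inequality:
  assumes "orthonormal F" "finite F"
  shows "(\<Sum>f\<in>F. (cmod (cinner x f))\<^sup>2) \<le> (norm x)\<^sup>2"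
  using pythagoras_coordinate_sum[OF assms, of x] by (metis le_add_same_cancel1 zero_le_power2)

lemma orthonormal_independent:
  assumes "orthonormal F" "finite F"
  shows "\<not> complex_vec.dependent F"
proof
  assume "complex_vec.dependent F"
  then obtain u v where uv: "v \<in> F" "u v \<noteq> 0" "(\<Sum>f\<in>F. u f *\<^sub>C f) = 0"
    using complex_vec.dependent_finite[OF assms(2)] by auto
  then show False using cinner_orthonormal_sum[OF assms uv(1), of u] by simp
qed

text \<open>The eigenvalue of a unit eigenvector \<open>e\<close> is \<open>\<langle>Re, e\<rangle>\<close>, so the vectors alone record the eigenvalues as well.\<close>

definition eigensystem :: "('a::complex_hilbert_space \<Rightarrow>\<^sub>L 'a) \<Rightarrow> 'a set \<Rightarrow> bool"
  where "eigensystem R Z \<longleftrightarrow> orthonormal Z \<and> (\<forall>e\<in>Z. 0 < inner (R e) e \<and> R e = inner (R e) e *\<^sub>R e)"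

definition maximal_eigensystem :: "('a::complex_hilbert_space \<Rightarrow>\<^sub>L 'a) \<Rightarrow> 'a set \<Rightarrow> bool"
  where "maximal_eigensystem R Z \<longleftrightarrow> eigensystem R Z \<and> (\<forall>Z'. eigensystem R Z' \<longrightarrow> Z \<subseteq> Z' \<longrightarrow> Z' = Z)"

lemma maximal_eigensystem_exists: "\<exists>Z. maximal_eigensystem R Z"
proof -
  have "\<exists>Z\<in>Collect (eigensystem R). \<forall>X\<in>Collect (eigensystem R). Z \<subseteq> X \<longrightarrow> X = Z"
  proof (rule subset_Zorn_nonempty)
    have "eigensystem R {}" by (simp add: eigensystem_def orthonormal_def)
    then show "Collect (eigensystem R) \<noteq> {}" by blast
    fix \<C> assume C: "subset.chain (Collect (eigensystem R)) \<C>"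
    have "cinner e f = 0" if ef: "e \<in> \<Union>\<C>" "f \<in> \<Union>\<C>" "e \<noteq> f" for e f
    proof -
      obtain E F where EF: "E \<in> \<C>" "F \<in> \<C>" "e \<in> E" "f \<in> F" using ef by blast
      then have "E \<subseteq> F \<or> F \<subseteq> E" using C by (auto simp: subset_chain_def)
      then have "\<exists>G\<in>\<C>. e \<in> G \<and> f \<in> G" using EF by blast
      then show ?thesis using C ef(3) by (auto simp: subset_chain_def eigensystem_def orthonormal_def)
    qed
    then show "\<Union>\<C> \<in> Collect (eigensystem R)"
      using C by (auto simp: subset_chain_def eigensystem_def orthonormal_def)
  qed
  then show ?thesis by (auto simp: maximal_eigensystem_def)
qed

lemma eigenvectors_orthogonal:
  assumes R: "R \<in> pos_ops" and x: "blinfun_apply R x = s *\<^sub>R x" and y: "blinfun_apply R y = t *\<^sub>R y"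
    and "s \<noteq> t"
  shows "cinner x y = 0"
proof -
  have "cinner (R x) y = cinner x (R y)"
    using R by (intro inner_eq_imp_cinner_eq pos_ops_bounded pos_ops_sym)
  then have "complex_of_real s * cinner x y = complex_of_real t * cinner x y"
    unfolding x y by (simp add: scaleR_scaleC cinner_scaleC_left cinner_scaleC_right)
  then show ?thesis using \<open>s \<noteq> t\<close> by simp
qed

text \<open>The images of infinitely many orthonormal eigenvectors would stay at mutual distance at least \<open>d\<close>.\<close>

lemma eigensystem_finite_above:
  fixes R :: "'a::complex_hilbert_space \<Rightarrow>\<^sub>L 'a"
  assumes R: "compact_op R" and Z: "eigensystem R Z" and d: "d > 0"
  shows "finite {e \<in> Z. d \<le> inner (R e) e}"
proof (rule ccontr)
  assume inf: "infinite {e \<in> Z. d \<le> inner (R e) e}"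
  obtain f :: "nat \<Rightarrow> 'a" where f: "inj f" "range f \<subseteq> {e \<in> Z. d \<le> inner (R e) e}"
    using infinite_countable_subset[OF inf] by blast
  have fZ: "f n \<in> Z" "d \<le> inner (R (f n)) (f n)" for n using f(2) by auto
  have f1: "norm (f n) = 1" for n using fZ Z by (auto simp: eigensystem_def orthonormal_def)
  obtain l r where r: "strict_mono r" "(\<lambda>n. R (f (r n))) \<longlonglongrightarrow> l"
    using compact_op_subsequence[OF R, of f 1] f1 by auto
  obtain N where N: "\<forall>m\<ge>N. \<forall>n\<ge>N. norm (R (f (r m)) - R (f (r n))) < d"
    using CauchyD[OF LIMSEQ_imp_Cauchy[OF r(2)] d] by blast
  let ?e = "f (r N)" and ?g = "f (r (Suc N))"
  define s where "s = inner (R ?e) ?e"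
  define t where "t = inner (R ?g) ?g"
  have "r N \<noteq> r (Suc N)" using r(1) by (metis n_not_Suc_n strict_mono_eq)
  then have "?e \<noteq> ?g" using f(1) by (simp add: inj_eq)
  then have "cinner ?e ?g = 0" using Z fZ by (auto simp: eigensystem_def orthonormal_def)
  then have o: "inner ?e ?g = 0" by (simp add: inner_eq_Re_cinner)
  have eqs: "R ?e = s *\<^sub>R ?e" "R ?g = t *\<^sub>R ?g"
    using Z fZ unfolding eigensystem_def s_def t_def by blast+
  have "inner ?e ?e = 1" "inner ?g ?g = 1" using f1 by (simp_all add: dot_square_norm)
  then have "(norm (R ?e - R ?g))\<^sup>2 = s\<^sup>2 + t\<^sup>2"
    unfolding eqs power2_norm_eq_inner
    using o by (simp add: inner_diff_left inner_diff_right inner_commute[of ?g ?e] power2_eq_square)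
  moreover have "d\<^sup>2 \<le> s\<^sup>2" using fZ d by (intro power_mono) (auto simp: s_def)
  ultimately have "d\<^sup>2 \<le> (norm (R ?e - R ?g))\<^sup>2" by (simp add: add_increasing2)
  then have "d \<le> norm (R ?e - R ?g)" by (rule power2_le_imp_le) simp
  moreover have "norm (R ?e - R ?g) < d" using N by simp
  ultimately show False by simp
qed

text \<open>An eigenvector is orthogonal to those of other eigenvalues. One that is also orthogonal to the members of
  \<open>Z\<close> with its own eigenvalue could be normalized and added to \<open>Z\<close>.\<close>

lemma maximal_eigensystem_complete:
  assumes R: "R \<in> pos_ops" and Z: "maximal_eigensystem R Z"
    and v: "blinfun_apply R v = s *\<^sub>R v" "s > 0"
    and ortho: "\<And>e. e \<in> Z \<Longrightarrow> inner (blinfun_apply R e) e = s \<Longrightarrow> cinner v e = 0"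
  shows "v = 0"
proof (rule ccontr)
  assume "v \<noteq> 0"
  define w where "w = v /\<^sub>R norm v"
  have w1: "norm w = 1" using \<open>v \<noteq> 0\<close> by (simp add: w_def)
  have Rw: "R w = s *\<^sub>R w" by (simp add: w_def blinfun.scaleR_right v(1))
  have eZ: "eigensystem R Z" using Z by (simp add: maximal_eigensystem_def)
  have w_ortho: "cinner w e = 0" if e: "e \<in> Z" for e
  proof (cases "inner (R e) e = s")
    case True
    then show ?thesis using ortho[OF e] by (simp add: w_def scaleR_scaleC cinner_scaleC_left)
  next
    case False
    moreover have "R e = inner (R e) e *\<^sub>R e" using eZ e unfolding eigensystem_def by blast
    ultimately show ?thesis using eigenvectors_orthogonal[OF R Rw, of e "inner (R e) e"] by metis
  qed
  have "inner (R w) w = s" using w1 by (simp add: Rw dot_square_norm)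
  then have "eigensystem R (insert w Z)"
    using eZ Rw v(2) orthonormal_insert[of Z w] w1 w_ortho by (auto simp: eigensystem_def)
  then have "w \<in> Z" using Z unfolding maximal_eigensystem_def by blast
  then have "cinner w w = 0" by (rule w_ortho)
  then show False using w1 by (simp add: cinner_self)
qed

text \<open>By maximality the members of \<open>Z\<close> with eigenvalue \<open>s\<close> span its eigenspace, so they form a basis.\<close>

lemma singular_multiplicity_eq_card:
  assumes R: "R \<in> pos_ops" "compact_op R" and Z: "maximal_eigensystem R Z" and s: "s > 0"
  shows "finite {e \<in> Z. inner (blinfun_apply R e) e = s}"
    and "singular_multiplicity R s = card {e \<in> Z. inner (blinfun_apply R e) e = s}"
proof -
  define F where "F = {e \<in> Z. inner (R e) e = s}"
  have eZ: "eigensystem R Z" using Z by (simp add: maximal_eigensystem_def)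
  have fin: "finite F"
    by (rule finite_subset[OF _ eigensystem_finite_above[OF R(2) eZ s]]) (auto simp: F_def)
  then show "finite {e \<in> Z. inner (R e) e = s}" by (simp add: F_def)
  have on: "orthonormal F"
    using eZ orthonormal_subset[of Z F] by (auto simp: eigensystem_def F_def)
  have RF: "R e = s *\<^sub>R e" if "e \<in> F" for e
    using that eZ unfolding F_def eigensystem_def by fastforce
  have RE: "R (coordinate_sum F x) = s *\<^sub>R coordinate_sum F x" for x
    unfolding coordinate_sum_def blinfun.sum_right scaleR_sum_right
    by (intro sum.cong refl)
      (simp add: bounded_ops_scaleC[OF pos_ops_bounded[OF R(1)]] RF scaleR_scaleC scaleC_scaleC mult.commute)
  have "singular_multiplicity R s = complex_vec.dim {x. R x = s *\<^sub>R x}"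
    by (simp add: singular_multiplicity_def op_abs_of_pos[OF R(1)] scaleR_scaleC)
  also have "\<dots> = card F"
  proof (rule complex_vec.dim_unique)
    show "F \<subseteq> {x. R x = s *\<^sub>R x}" using RF by auto
    show "complex_vec.independent F" by (rule orthonormal_independent[OF on fin])
    show "{x. R x = s *\<^sub>R x} \<subseteq> complex_vec.span F"
    proof clarify
      fix x assume x: "R x = s *\<^sub>R x"
      have "x - coordinate_sum F x = 0"
      proof (rule maximal_eigensystem_complete[OF R(1) Z _ s])
        show "R (x - coordinate_sum F x) = s *\<^sub>R (x - coordinate_sum F x)"
          by (simp add: blinfun.diff_right x RE scaleR_diff_right)
      qed (use coordinate_sum_compl[OF on fin] in \<open>auto simp: F_def\<close>)
      moreover have "coordinate_sum F x \<in> complex_vec.span F"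
        unfolding coordinate_sum_def
        by (intro complex_vec.span_sum complex_vec.span_scale complex_vec.span_base)
      ultimately show "x \<in> complex_vec.span F" by simp
    qed
  qed simp
  finally show "singular_multiplicity R s = card {e \<in> Z. inner (R e) e = s}" by (simp add: F_def)
qed

section \<open>Sums of powers of singular values\<close>

text \<open>Lists each singular value with its multiplicity by eigenvectors. It is the source of orthonormal
  families that approach the full sum.\<close>

lemma finite_singular_sum:
  assumes R: "R \<in> pos_ops" "compact_op R" and Z: "maximal_eigensystem R Z"
    and F: "finite F" "F \<subseteq> {0<..}"
  shows "finite {e \<in> Z. inner (blinfun_apply R e) e \<in> F}"
    and "(\<Sum>s\<in>F. real (singular_multiplicity R s) * s powr p) =
      (\<Sum>e\<in>{e \<in> Z. inner (blinfun_apply R e) e \<in> F}. inner (R e) e powr p)"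
proof -
  define E where "E s = {e \<in> Z. inner (R e) e = s}" for s
  have fin: "finite (E s)" and card: "singular_multiplicity R s = card (E s)" if "s \<in> F" for s
    unfolding E_def using that F(2) singular_multiplicity_eq_card[OF R Z, of s] by auto
  have U: "{e \<in> Z. inner (R e) e \<in> F} = (\<Union>s\<in>F. E s)" by (auto simp: E_def)
  then show "finite {e \<in> Z. inner (R e) e \<in> F}" using fin F by simp
  have "(\<Sum>e\<in>(\<Union>s\<in>F. E s). inner (R e) e powr p) = (\<Sum>s\<in>F. \<Sum>e\<in>E s. inner (R e) e powr p)"
    using F fin by (intro sum.UNION_disjoint) (auto simp: E_def)
  also have "\<dots> = (\<Sum>s\<in>F. real (singular_multiplicity R s) * s powr p)"
    by (intro sum.cong refl) (simp add: card, simp add: E_def)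
  finally show "(\<Sum>s\<in>F. real (singular_multiplicity R s) * s powr p) =
      (\<Sum>e\<in>{e \<in> Z. inner (R e) e \<in> F}. inner (R e) e powr p)"
    by (simp add: U)
qed

text \<open>The vectors orthogonal to all members of \<open>Z\<close> with eigenvalue at least \<open>d\<close> form an invariant subspace. If
  the form exceeded \<open>d\<close> on it, it would contain an eigenvector to an eigenvalue greater than \<open>d\<close>, against
  the maximality of \<open>Z\<close>.\<close>

lemma form_le_off_large_eigenvectors:
  assumes R: "R \<in> pos_ops" "compact_op R" and Z: "maximal_eigensystem R Z" and d: "d \<ge> 0"
    and z: "\<And>e. e \<in> Z \<Longrightarrow> d \<le> inner (blinfun_apply R e) e \<Longrightarrow> cinner z e = 0"
  shows "inner (blinfun_apply R z) z \<le> d * (norm z)\<^sup>2"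
proof (rule ccontr)
  assume neg: "\<not> ?thesis"
  define F where "F = {e \<in> Z. d \<le> inner (R e) e}"
  have RF: "R e = inner (R e) e *\<^sub>R e" if "e \<in> Z" for e
    using Z that unfolding maximal_eigensystem_def eigensystem_def by blast
  have "\<exists>s>d. \<exists>v\<in>ortho F. v \<noteq> 0 \<and> R v = s *\<^sub>R v"
  proof (rule compact_pos_eigenvector_exists[OF R closed_csubspace_ortho _ d])
    show "z \<in> ortho F" using z by (auto simp: ortho_def F_def)
    show "d * (norm z)\<^sup>2 < inner (R z) z" using neg by simp
    fix x assume x: "x \<in> ortho F"
    have "cinner (R x) e = 0" if e: "e \<in> F" for e
    proof -
      have "cinner (R x) e = cinner x (R e)"
        using R by (intro inner_eq_imp_cinner_eq pos_ops_bounded pos_ops_sym)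
      also have "\<dots> = cinner x (inner (R e) e *\<^sub>R e)" using RF e by (simp add: F_def)
      also have "\<dots> = 0" using x e by (simp add: scaleR_scaleC cinner_scaleC_right ortho_def)
      finally show ?thesis .
    qed
    then show "R x \<in> ortho F" by (simp add: ortho_def)
  qed
  then obtain s v where v: "s > d" "v \<in> ortho F" "v \<noteq> 0" "R v = s *\<^sub>R v" by blast
  have "v = 0"
    by (rule maximal_eigensystem_complete[OF R(1) Z v(4)])
      (use v d in \<open>auto simp: ortho_def F_def\<close>)
  then show False using v by simp
qed

text \<open>The form at \<open>g\<close> is at most an average of the eigenvalues \<open>\<ge> d\<close>, with weights \<open>|\<langle>g, e\<rangle>|\<^sup>2\<close>, and of \<open>d\<close>, with the
  remaining weight. Jensen's inequality for \<open>t \<mapsto> t\<^sup>p\<close> applies; this is where \<open>p \<ge> 1\<close> is needed. Cutting off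
  at \<open>d > 0\<close> keeps the sum finite.\<close>

lemma form_powr_le:
  assumes R: "R \<in> pos_ops" "compact_op R" and Z: "maximal_eigensystem R Z" and d: "d > 0" and p: "p \<ge> 1"
    and F: "F = {e \<in> Z. d \<le> inner (blinfun_apply R e) e}" and g: "norm g = 1"
  shows "inner (R g) g powr p \<le> (\<Sum>e\<in>F. inner (R e) e powr p * (cmod (cinner g e))\<^sup>2) + d powr p"
proof -
  define ev where "ev e = inner (R e) e" for e
  define c where "c e = (cmod (cinner g e))\<^sup>2" for e
  have eZ: "eigensystem R Z" using Z by (simp add: maximal_eigensystem_def)
  have fin: "finite F" unfolding F by (rule eigensystem_finite_above[OF R(2) eZ d])
  have on: "orthonormal F" using eZ orthonormal_subset[of Z F] by (auto simp: eigensystem_def F)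
  have RF: "R e = ev e *\<^sub>R e" if "e \<in> F" for e
    using that eZ unfolding F eigensystem_def ev_def by blast
  have ev_pos: "ev e > 0" if "e \<in> F" for e using that d by (simp add: F ev_def)
  define y where "y = coordinate_sum F g"
  define z where "z = g - y"
  have z_ortho: "cinner z e = 0" if "e \<in> F" for e
    unfolding z_def y_def by (rule coordinate_sum_compl[OF on fin that])
  have z_norm: "(norm z)\<^sup>2 = 1 - (\<Sum>e\<in>F. c e)"
    using pythagoras_coordinate_sum[OF on fin, of g] g by (simp add: c_def z_def y_def)
  have Ry: "inner (R y) x = (\<Sum>e\<in>F. ev e * Re (cinner g e * cnj (cinner x e)))" for x
  proof -
    have "R y = (\<Sum>e\<in>F. ev e *\<^sub>R (cinner g e *\<^sub>C e))"
      unfolding y_def coordinate_sum_def blinfun.sum_right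
      by (intro sum.cong refl)
        (simp add: bounded_ops_scaleC[OF pos_ops_bounded[OF R(1)]] RF scaleR_scaleC scaleC_scaleC mult.commute)
    then have "inner (R y) x = (\<Sum>e\<in>F. ev e * Re (cinner g e * cinner e x))"
      by (simp only: inner_sum_left inner_scaleR_left) (simp only: inner_eq_Re_cinner cinner_scaleC_left)
    also have "\<dots> = (\<Sum>e\<in>F. ev e * Re (cinner g e * cnj (cinner x e)))"
      by (intro sum.cong refl) (metis cinner_commute)
    finally show ?thesis .
  qed
  have "inner (R g) g = inner (R y) y + 2 * inner (R y) z + inner (R z) z"
    using pos_ops_sym[OF R(1), of z y]
    by (simp add: z_def blinfun.diff_right inner_diff_left inner_diff_right inner_commute)
  also have "inner (R y) z = 0" using z_ortho by (simp add: Ry)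
  also have "inner (R y) y = (\<Sum>e\<in>F. ev e * c e)"
  proof -
    have "cinner y e = cinner g e" if "e \<in> F" for e
      using z_ortho[OF that] by (simp add: z_def cinner_diff_left)
    then show ?thesis unfolding Ry c_def by (intro sum.cong refl) (simp only: Re_mult_cnj_self)
  qed
  also have "inner (R z) z \<le> d * (norm z)\<^sup>2"
    using z_ortho d by (intro form_le_off_large_eigenvectors[OF R Z]) (auto simp: F)
  finally have le: "inner (R g) g \<le> (\<Sum>e\<in>F. c e * ev e) + (norm z)\<^sup>2 * d"
    by (simp add: mult.commute)
  \<comment> \<open>\<open>F\<close> consists of unit vectors, so \<open>0\<close> is free to serve as the index of the remaining weight.\<close>
  have "0 \<notin> F" using on by (auto simp: orthonormal_def)
  define a where "a e = (if e = 0 then (norm z)\<^sup>2 else c e)" for e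
  define b where "b e = (if e = 0 then d else ev e)" for e
  have a_sum: "(\<Sum>e\<in>insert 0 F. a e * h e) = (norm z)\<^sup>2 * h 0 + (\<Sum>e\<in>F. c e * h e)" for h :: "'a \<Rightarrow> real"
  proof -
    have "(\<Sum>e\<in>F. a e * h e) = (\<Sum>e\<in>F. c e * h e)"
      using \<open>0 \<notin> F\<close> by (intro sum.cong) (auto simp: a_def)
    then show ?thesis using fin \<open>0 \<notin> F\<close> by (simp add: a_def)
  qed
  have b_sum: "(\<Sum>e\<in>F. c e * k (b e)) = (\<Sum>e\<in>F. c e * k (ev e))" for k :: "real \<Rightarrow> real"
    using \<open>0 \<notin> F\<close> by (intro sum.cong) (auto simp: b_def)
  have "inner (R g) g powr p \<le> (\<Sum>e\<in>insert 0 F. a e *\<^sub>R b e) powr p"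
    using le p pos_ops_nonneg[OF R(1), of g] a_sum[of b] b_sum[of "\<lambda>x. x"]
    by (intro powr_mono2) (simp_all add: b_def add.commute)
  also have "\<dots> \<le> (\<Sum>e\<in>insert 0 F. a e * (b e powr p))"
  proof (rule convex_on_sum)
    show "convex_on {0<..} (\<lambda>x::real. x powr p)" by (rule powr_convex[OF p])
    show "sum a (insert 0 F) = 1" using a_sum[of "\<lambda>_. 1"] z_norm by simp
    show "b e \<in> {0<..}" if "e \<in> insert 0 F" for e using that ev_pos d by (auto simp: b_def)
  qed (use fin in \<open>auto simp: a_def c_def\<close>)
  also have "\<dots> = (norm z)\<^sup>2 * d powr p + (\<Sum>e\<in>F. c e * ev e powr p)"
    using a_sum[of "\<lambda>e. b e powr p"] b_sum[of "\<lambda>x. x powr p"] by (simp add: b_def)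
  also have "(norm z)\<^sup>2 * d powr p \<le> 1 * d powr p"
    using z_norm by (intro mult_right_mono) (auto simp: c_def sum_nonneg)
  finally show ?thesis by (simp add: ev_def c_def mult.commute)
qed

abbreviation singular_summable :: "real \<Rightarrow> ('a::complex_hilbert_space \<Rightarrow>\<^sub>L 'a) \<Rightarrow> bool"
  where "singular_summable p T \<equiv> (\<lambda>s. real (singular_multiplicity T s) * s powr p) summable_on {0<..}"

text \<open>The \<open>p\<close>-th power of the Schatten norm.\<close>

definition singular_sum :: "real \<Rightarrow> ('a::complex_hilbert_space \<Rightarrow>\<^sub>L 'a) \<Rightarrow> real"
  where "singular_sum p T = (\<Sum>\<^sub>\<infinity>s\<in>{0<..}. real (singular_multiplicity T s) * s powr p)"

text \<open>Sum the bound for single vectors over \<open>G\<close>. By Bessel's inequality each eigenvector receives total weight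
  at most one, and the terms \<open>d\<^sup>p\<close> vanish as \<open>d \<rightarrow> 0\<close>.\<close>

lemma orthonormal_form_sum_le:
  assumes R: "R \<in> pos_ops" "compact_op R" and p: "p \<ge> 1" and summ: "singular_summable p R"
    and G: "finite G" "orthonormal G"
  shows "(\<Sum>g\<in>G. inner (blinfun_apply R g) g powr p) \<le> singular_sum p R"
proof (rule field_le_epsilon)
  fix \<epsilon> :: real assume "\<epsilon> > 0"
  define n where "n = real (card G) + 1"
  have n: "n > 0" by (simp add: n_def add_nonneg_pos)
  \<comment> \<open>Chosen so that the errors \<open>d\<^sup>p\<close> of all members of \<open>G\<close> together stay below \<open>\<epsilon>\<close>.\<close>
  define d where "d = (\<epsilon> / n) powr (1 / p)"
  have d: "d > 0" using \<open>\<epsilon> > 0\<close> n by (simp add: d_def)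
  have dp: "d powr p = \<epsilon> / n" using \<open>\<epsilon> > 0\<close> n p by (simp add: d_def powr_powr)
  obtain Z where Z: "maximal_eigensystem R Z" using maximal_eigensystem_exists by blast
  have eZ: "eigensystem R Z" using Z by (simp add: maximal_eigensystem_def)
  define F where "F = {e \<in> Z. d \<le> inner (R e) e}"
  have fin: "finite F" unfolding F_def by (rule eigensystem_finite_above[OF R(2) eZ d])
  have G1: "norm g = 1" if "g \<in> G" for g using G that by (simp add: orthonormal_def)
  have F1: "norm e = 1" if "e \<in> F" for e using eZ that by (simp add: eigensystem_def orthonormal_def F_def)
  have "(\<Sum>g\<in>G. inner (R g) g powr p)
      \<le> (\<Sum>g\<in>G. (\<Sum>e\<in>F. inner (R e) e powr p * (cmod (cinner g e))\<^sup>2) + d powr p)"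
    by (intro sum_mono form_powr_le[OF R Z d p F_def] G1)
  also have "\<dots> = (\<Sum>g\<in>G. \<Sum>e\<in>F. inner (R e) e powr p * (cmod (cinner g e))\<^sup>2) + real (card G) * d powr p"
    by (simp add: sum.distrib)
  also have "(\<Sum>g\<in>G. \<Sum>e\<in>F. inner (R e) e powr p * (cmod (cinner g e))\<^sup>2)
      = (\<Sum>e\<in>F. inner (R e) e powr p * (\<Sum>g\<in>G. (cmod (cinner e g))\<^sup>2))"
  proof -
    have "cmod (cinner g e) = cmod (cinner e g)" for g e :: 'a
      by (metis cinner_commute complex_mod_cnj)
    then show ?thesis by (subst sum.swap) (simp add: sum_distrib_left)
  qed
  also have "\<dots> \<le> (\<Sum>e\<in>F. inner (R e) e powr p * 1)"
  proof (intro sum_mono mult_left_mono)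
    fix e assume "e \<in> F"
    then show "(\<Sum>g\<in>G. (cmod (cinner e g))\<^sup>2) \<le> 1"
      using bessel_inequality[OF G(2,1), of e] F1 by simp
  qed simp
  also have "(\<Sum>e\<in>F. inner (R e) e powr p * 1) \<le> singular_sum p R"
  proof -
    define S where "S = (\<lambda>e. inner (R e) e) ` F"
    have S: "finite S" "S \<subseteq> {0<..}" using fin d by (auto simp: S_def F_def)
    have "(\<Sum>e\<in>F. inner (R e) e powr p * 1) \<le> (\<Sum>e\<in>{e \<in> Z. inner (R e) e \<in> S}. inner (R e) e powr p)"
      using finite_singular_sum(1)[OF R Z S]
      by simp (intro sum_mono2, auto simp: S_def F_def)
    also have "\<dots> = (\<Sum>s\<in>S. real (singular_multiplicity R s) * s powr p)"
      by (rule finite_singular_sum(2)[OF R Z S, symmetric])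
    also have "\<dots> \<le> singular_sum p R"
      unfolding singular_sum_def by (intro finite_sum_le_infsum summ S) auto
    finally show ?thesis .
  qed
  also have "real (card G) * d powr p \<le> \<epsilon>"
    unfolding dp using \<open>\<epsilon> > 0\<close> n by (simp add: n_def field_simps)
  finally show "(\<Sum>g\<in>G. inner (R g) g powr p) \<le> singular_sum p R + \<epsilon>" by simp
qed

lemma singular_summableI:
  assumes "\<And>F. finite F \<Longrightarrow> F \<subseteq> {0<..} \<Longrightarrow> (\<Sum>s\<in>F. real (singular_multiplicity T s) * s powr p) \<le> b"
  shows "singular_summable p T"
  by (rule nonneg_bdd_above_summable_on) (use assms in \<open>auto intro!: bdd_aboveI2[where M = b]\<close>)

text \<open>Evaluate the form of \<open>D\<close> at the eigenvectors of \<open>C\<close>.\<close>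

lemma singular_sum_mono:
  assumes C: "C \<in> pos_ops" "compact_op C" and D: "D \<in> pos_ops" "compact_op D"
    and p: "p \<ge> 1" and summ: "singular_summable p D"
    and le: "\<And>x. inner (blinfun_apply C x) x \<le> inner (blinfun_apply D x) x"
  shows "singular_summable p C" and "singular_sum p C \<le> singular_sum p D"
proof -
  obtain Z where Z: "maximal_eigensystem C Z" using maximal_eigensystem_exists by blast
  have bound: "(\<Sum>s\<in>F. real (singular_multiplicity C s) * s powr p) \<le> singular_sum p D"
    if F: "finite F" "F \<subseteq> {0<..}" for F
  proof -
    let ?G = "{e \<in> Z. inner (C e) e \<in> F}"
    have "orthonormal ?G"
      using Z orthonormal_subset[of Z ?G] by (auto simp: maximal_eigensystem_def eigensystem_def)
    have "(\<Sum>s\<in>F. real (singular_multiplicity C s) * s powr p) = (\<Sum>e\<in>?G. inner (C e) e powr p)"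
      by (rule finite_singular_sum(2)[OF C Z F])
    also have "\<dots> \<le> (\<Sum>e\<in>?G. inner (D e) e powr p)"
      using le p pos_ops_nonneg[OF C(1)] by (intro sum_mono powr_mono2) auto
    also have "\<dots> \<le> singular_sum p D"
      by (rule orthonormal_form_sum_le[OF D p summ finite_singular_sum(1)[OF C Z F]]) fact
    finally show ?thesis .
  qed
  then show "singular_summable p C" by (rule singular_summableI)
  then show "singular_sum p C \<le> singular_sum p D"
    unfolding singular_sum_def[of p C] by (rule infsum_le_finite_sums) (rule bound)
qed

text \<open>Let \<open>v\<close> be a unit vector that belongs to a maximal eigensystem \<open>Z\<close> of \<open>C\<close> or is orthogonal to it. Together
  with enough members of \<open>Z\<close> to exhaust the sum for \<open>C\<close> up to \<open>\<epsilon>\<close> it forms an orthonormal family, on which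
  the form of \<open>D\<close> must not exceed the same sum. So \<open>\<langle>Dv, v\<rangle> \<le> \<langle>Cv, v\<rangle>\<close>, and the positive operator \<open>D - C\<close>
  vanishes at \<open>v\<close>. Such vectors span a dense subspace.\<close>

lemma singular_sum_eq_imp_eq:
  assumes C: "C \<in> pos_ops" "compact_op C" and D: "D \<in> pos_ops" "compact_op D"
    and p: "p \<ge> 1" and summ: "singular_summable p D"
    and le: "\<And>x. inner (blinfun_apply C x) x \<le> inner (blinfun_apply D x) x"
    and eq: "singular_sum p C = singular_sum p D"
  shows "C = D"
proof -
  have summC: "singular_summable p C" by (rule singular_sum_mono(1)[OF C D p summ le])
  obtain Z where Z: "maximal_eigensystem C Z" using maximal_eigensystem_exists by blast
  have eZ: "eigensystem C Z" using Z by (simp add: maximal_eigensystem_def)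
  define K where "K = D - C"
  have K: "K \<in> pos_ops"
    using self_adjoint_diff[of D C] C D le
    by (simp add: K_def pos_ops_iff_self_adjoint blinfun.diff_left inner_diff_left)
  have kernel: "K v = 0" if v: "norm v = 1" "v \<in> Z \<or> (\<forall>e\<in>Z. cinner v e = 0)" for v
  proof -
    have "inner (D v) v powr p \<le> inner (C v) v powr p"
    proof (rule field_le_epsilon)
      fix \<epsilon> :: real assume "\<epsilon> > 0"
      have "\<exists>F. finite F \<and> F \<subseteq> {0<..} \<and>
          singular_sum p C - \<epsilon> < (\<Sum>s\<in>F. real (singular_multiplicity C s) * s powr p)"
      proof (rule ccontr)
        assume "\<not> ?thesis"
        then have "(\<Sum>s\<in>F. real (singular_multiplicity C s) * s powr p) \<le> singular_sum p C - \<epsilon>"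
          if "finite F" "F \<subseteq> {0<..}" for F
          using that by (meson not_le)
        from infsum_le_finite_sums[OF summC this]
        have "singular_sum p C \<le> singular_sum p C - \<epsilon>"
          by (simp add: singular_sum_def)
        then show False using \<open>\<epsilon> > 0\<close> by simp
      qed
      then obtain F where F: "finite F" "F \<subseteq> {0<..}"
        and big: "singular_sum p C - \<epsilon> < (\<Sum>s\<in>F. real (singular_multiplicity C s) * s powr p)" by blast
      define G where "G = {e \<in> Z. inner (C e) e \<in> F} - {v}"
      have finG: "finite G" using finite_singular_sum(1)[OF C Z F] by (simp add: G_def)
      have onZ: "orthonormal Z" using eZ by (simp add: eigensystem_def)
      have on: "orthonormal (insert v G)"
      proof (cases "v \<in> Z")
        case True
        then show ?thesis using orthonormal_subset[OF onZ] by (auto simp: G_def)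
      next
        case False
        then show ?thesis
          using v orthonormal_subset[OF onZ, of G] by (intro orthonormal_insert) (auto simp: G_def)
      qed
      have "v \<notin> G" by (simp add: G_def)
      have "singular_sum p C - \<epsilon> < (\<Sum>e\<in>{e \<in> Z. inner (C e) e \<in> F}. inner (C e) e powr p)"
        using big finite_singular_sum(2)[OF C Z F] by simp
      also have "\<dots> \<le> (\<Sum>e\<in>insert v G. inner (C e) e powr p)"
        using finG by (intro sum_mono2) (auto simp: G_def)
      also have "\<dots> = inner (C v) v powr p + (\<Sum>e\<in>G. inner (C e) e powr p)"
        using finG \<open>v \<notin> G\<close> by simp
      also have "(\<Sum>e\<in>G. inner (C e) e powr p) \<le> (\<Sum>e\<in>G. inner (D e) e powr p)"
        using le p pos_ops_nonneg[OF C(1)] by (intro sum_mono powr_mono2) auto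
      finally have "singular_sum p C - \<epsilon> < inner (C v) v powr p + (\<Sum>e\<in>G. inner (D e) e powr p)" by simp
      moreover have "(\<Sum>e\<in>insert v G. inner (D e) e powr p) \<le> singular_sum p C"
        unfolding eq using finG by (intro orthonormal_form_sum_le[OF D p summ _ on]) simp
      ultimately show "inner (D v) v powr p \<le> inner (C v) v powr p + \<epsilon>"
        using finG \<open>v \<notin> G\<close> by simp
    qed
    then have "inner (D v) v \<le> inner (C v) v"
      using powr_less_mono2[of p "inner (C v) v" "inner (D v) v"] p pos_ops_nonneg[OF C(1), of v] by force
    then have "inner (K v) v = 0"
      using le[of v] by (simp add: K_def blinfun.diff_left inner_diff_left)
    then show ?thesis by (rule pos_ops_zero_iff[OF K])
  qed
  have N: "closed_csubspace (nullspace K)"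
    by (rule closed_csubspace_nullspace[OF pos_ops_bounded[OF K]])
  have "x = 0" if x: "x \<in> ortho (nullspace K)" for x
  proof (rule ccontr)
    assume "x \<noteq> 0"
    have "cinner x e = 0" if "e \<in> Z" for e
      using that kernel[of e] x eZ by (auto simp: ortho_def nullspace_def eigensystem_def orthonormal_def)
    then have "\<forall>e\<in>Z. cinner (x /\<^sub>R norm x) e = 0"
      by (simp add: scaleR_scaleC cinner_scaleC_left)
    then have "K (x /\<^sub>R norm x) = 0"
      using \<open>x \<noteq> 0\<close> by (intro kernel) auto
    then have "x \<in> nullspace K" using \<open>x \<noteq> 0\<close> by (simp add: blinfun.scaleR_right nullspace_def)
    then show False using ortho_Int_zero x \<open>x \<noteq> 0\<close> by blast
  qed
  then have "x - orth_proj (nullspace K) x = 0" for x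
    using orth_proj_compl[OF N] by blast
  then have "x \<in> nullspace K" for x
    using orth_proj_mem[OF N, of x] by simp
  then have "D x = C x" for x by (simp add: nullspace_def K_def blinfun.diff_left)
  then show ?thesis by (intro blinfun_eqI) simp
qed

lemma singular_multiplicity_op_abs:
  "T \<in> bounded_ops \<Longrightarrow> singular_multiplicity (op_abs T) s = singular_multiplicity T s"
  by (simp add: singular_multiplicity_def op_abs_of_pos op_abs_pos)

lemma op_abs_square: "T \<in> bounded_ops \<Longrightarrow> op_abs T (op_abs T x) = adj T (blinfun_apply T x)"
  using op_sqrt_square[OF gram_pos, of T] unfolding op_abs_def
  by (metis blinfun_apply_blinfun_compose)

text \<open>The Schatten class is a right ideal. Let \<open>T = RY\<close>, and let the unit vectors \<open>e\<close> be eigenvectors of \<open>|T|\<close> to the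
  eigenvalues \<open>s\<close>. The unit vectors \<open>g = Te/s\<close> are orthonormal eigenvectors of \<open>|T\<^sup>*|\<close> to the same eigenvalues.
  As \<open>\<parallel>T\<^sup>*x\<parallel> = \<parallel>Y\<^sup>*Rx\<parallel> \<le> \<parallel>Y\<^sup>*\<parallel> \<parallel>Rx\<parallel>\<close>, monotonicity of the square root gives \<open>|T\<^sup>*| \<le> \<parallel>Y\<^sup>*\<parallel> R\<close>, hence
  \<open>s \<le> \<parallel>Y\<^sup>*\<parallel> \<langle>Rg, g\<rangle>\<close>, and the sum for \<open>R\<close> bounds the sum of the \<open>s\<^sup>p\<close>.\<close>

lemma singular_summable_compose:
  fixes R Y :: "'a::complex_hilbert_space \<Rightarrow>\<^sub>L 'a"
  assumes R: "R \<in> pos_ops" "compact_op R" and Y: "Y \<in> bounded_ops"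
    and p: "p \<ge> 1" and summ: "singular_summable p R"
  shows "singular_summable p (op_abs (R o\<^sub>L Y))"
proof -
  define T where "T = R o\<^sub>L Y"
  have T: "T \<in> bounded_ops" using R Y by (simp add: T_def pos_ops_bounded)
  have T': "adj T \<in> bounded_ops" using T by simp
  have adjT: "adj T = adj Y o\<^sub>L R"
    using adj_compose[OF pos_ops_bounded[OF R(1)] Y] pos_ops_self_adjoint[OF R(1)]
    by (simp add: T_def self_adjoint_adj)
  define D where "D = op_abs T"
  have D: "D \<in> pos_ops" unfolding D_def by (rule op_abs_pos[OF T])
  have D_compact: "compact_op D"
  proof (rule compact_op_dominated[OF R(2)])
    show "norm (D x) \<le> norm (R (Y x))" for x by (simp add: D_def op_abs_norm[OF T]) (simp add: T_def)
  qed
  define K where "K = op_abs (adj T)"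
  have K: "K \<in> pos_ops" unfolding K_def by (rule op_abs_pos[OF T'])
  define c where "c = norm (adj Y)"
  have K_le: "inner (K x) x \<le> c * inner (R x) x" for x
  proof -
    have "inner (K x) x \<le> inner ((c *\<^sub>R R) x) x"
    proof (rule pos_ops_form_mono[OF K])
      show "c *\<^sub>R R \<in> pos_ops" using R by (intro pos_ops_scaleR) (auto simp: c_def)
      show "norm (K x) \<le> norm ((c *\<^sub>R R) x)" for x
        using norm_blinfun[of "adj Y" "R x"] op_abs_norm[OF T', of x]
        by (simp add: K_def adjT blinfun.scaleR_left c_def)
    qed
    then show ?thesis by (simp add: blinfun.scaleR_left)
  qed
  obtain Z where Z: "maximal_eigensystem D Z" using maximal_eigensystem_exists by blast
  have eZ: "eigensystem D Z" using Z by (simp add: maximal_eigensystem_def)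
  define ev where "ev e = inner (D e) e" for e
  have Z1: "norm e = 1" and DZ: "D e = ev e *\<^sub>R e" and ev_pos: "ev e > 0" if "e \<in> Z" for e
    using that eZ by (auto simp: eigensystem_def orthonormal_def ev_def)
  have gram: "adj T (T e) = (ev e)\<^sup>2 *\<^sub>R e" if e: "e \<in> Z" for e
    using op_abs_square[OF T, of e] DZ[OF e]
    by (simp add: D_def[symmetric] blinfun.scaleR_right power2_eq_square)
  define g where "g e = (1 / ev e) *\<^sub>R T e" for e
  have g1: "norm (g e) = 1" if e: "e \<in> Z" for e
  proof -
    have "norm (T e) = norm (D e)" by (simp add: D_def op_abs_norm[OF T])
    also have "\<dots> = ev e" using DZ[OF e] Z1[OF e] ev_pos[OF e] by simp
    finally show ?thesis using ev_pos[OF e] by (simp add: g_def)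
  qed
  have g_ortho: "cinner (g e) (g f) = 0" if ef: "e \<in> Z" "f \<in> Z" "e \<noteq> f" for e f
  proof -
    have "cinner (T e) (T f) = cinner e (adj T (T f))"
      using adj_inner[OF T] by (intro inner_eq_imp_cinner_eq T')
    also have "\<dots> = 0"
      using eZ ef by (simp add: gram scaleR_scaleC cinner_scaleC_right eigensystem_def orthonormal_def)
    finally show ?thesis by (simp add: g_def scaleR_scaleC cinner_scaleC_left cinner_scaleC_right)
  qed
  have Kg: "K (g e) = ev e *\<^sub>R g e" if e: "e \<in> Z" for e
  proof (rule pos_ops_eigenvector_of_square[OF K ev_pos[OF e]])
    have "K (K (g e)) = T (adj T (g e))"
      using op_abs_square[OF T', of "g e"] T by (simp add: K_def)
    also have "\<dots> = (ev e)\<^sup>2 *\<^sub>R g e"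
      by (simp add: g_def blinfun.scaleR_right gram[OF e])
    finally show "K (K (g e)) = (ev e)\<^sup>2 *\<^sub>R g e" .
  qed
  have "(\<Sum>s\<in>F. real (singular_multiplicity D s) * s powr p) \<le> c powr p * singular_sum p R"
    if F: "finite F" "F \<subseteq> {0<..}" for F
  proof -
    define E where "E = {e \<in> Z. inner (D e) e \<in> F}"
    have E: "finite E" "E \<subseteq> Z"
      using finite_singular_sum(1)[OF D D_compact Z F] by (auto simp: E_def)
    have inj: "inj_on g E"
    proof (rule inj_onI, rule ccontr)
      fix e f assume "e \<in> E" "f \<in> E" "g e = g f" "e \<noteq> f"
      then have "cinner (g e) (g e) = 0" using g_ortho E by (metis subsetD)
      moreover have "norm (g e) = 1" using g1 \<open>e \<in> E\<close> E by blast
      ultimately show False by (simp add: cinner_self)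
    qed
    have on: "orthonormal (g ` E)"
      unfolding orthonormal_def
    proof (intro conjI ballI impI)
      show "norm h = 1" if "h \<in> g ` E" for h using that g1 E by auto
      show "cinner h k = 0" if "h \<in> g ` E" "k \<in> g ` E" "h \<noteq> k" for h k
      proof -
        obtain e f where "h = g e" "k = g f" "e \<in> Z" "f \<in> Z" using \<open>h \<in> g ` E\<close> \<open>k \<in> g ` E\<close> E(2) by blast
        then show ?thesis using g_ortho \<open>h \<noteq> k\<close> by metis
      qed
    qed
    have "(\<Sum>s\<in>F. real (singular_multiplicity D s) * s powr p) = (\<Sum>e\<in>E. ev e powr p)"
      unfolding E_def ev_def by (rule finite_singular_sum(2)[OF D D_compact Z F])
    also have "\<dots> \<le> (\<Sum>e\<in>E. c powr p * inner (R (g e)) (g e) powr p)"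
    proof (rule sum_mono)
      fix e assume "e \<in> E"
      then have e: "e \<in> Z" using E by blast
      have "ev e = inner (K (g e)) (g e)"
        using g1[OF e] by (simp add: Kg[OF e] dot_square_norm)
      also have "\<dots> \<le> c * inner (R (g e)) (g e)" by (rule K_le)
      finally have "ev e powr p \<le> (c * inner (R (g e)) (g e)) powr p"
        using ev_pos[OF e] p by (intro powr_mono2) auto
      then show "ev e powr p \<le> c powr p * inner (R (g e)) (g e) powr p"
        using pos_ops_nonneg[OF R(1), of "g e"] by (simp add: powr_mult c_def)
    qed
    also have "\<dots> = c powr p * (\<Sum>h\<in>g ` E. inner (R h) h powr p)"
      by (simp add: sum.reindex[OF inj] sum_distrib_left)
    also have "\<dots> \<le> c powr p * singular_sum p R"
      using E on by (intro mult_left_mono orthonormal_form_sum_le[OF R p summ]) auto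
    finally show ?thesis .
  qed
  then show ?thesis unfolding T_def[symmetric] D_def[symmetric] by (rule singular_summableI)
qed

lemma schatten_norm_eq_singular_sum: "schatten_norm p T = singular_sum p T powr (1 / p)"
  by (simp add: schatten_norm_def singular_sum_def)

lemma singular_sum_nonneg: "0 \<le> singular_sum p T"
  unfolding singular_sum_def by (intro infsum_nonneg) auto

lemma schatten_norm_op_abs:
  "T \<in> bounded_ops \<Longrightarrow> schatten_norm p (op_abs T) = schatten_norm p T"
  by (simp add: schatten_norm_def singular_multiplicity_op_abs)

lemma singular_sum_eq_schatten_norm: "p \<ge> 1 \<Longrightarrow> schatten_norm p T powr p = singular_sum p T"
  by (simp add: schatten_norm_eq_singular_sum powr_powr singular_sum_nonneg)

section \<open>The minimization problem\<close>

text \<open>The weighted norm of a residual is the Schatten norm of its modulus \<open>D\<close>, and \<open>D\<^sup>2\<close> is its residual form.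
  Since \<open>C \<le> D\<close> for the square root \<open>C\<close> of the shorted operator, the minimum is reached exactly when some
  \<open>D\<close> has the same norm as \<open>C\<close>, hence equals \<open>C\<close>.\<close>

lemma compatible_iff_minimum_schatten:
  fixes A B W :: "'a::complex_hilbert_space \<Rightarrow>\<^sub>L 'a"
  assumes A: "A \<in> bounded_ops" "closed (range A)" and B: "B \<in> bounded_ops" "closed (range B)"
    and W: "W \<in> pos_ops" and NB: "nullspace B = ortho_weighted W (range A)"
    and p: "1 \<le> p" and schatten: "op_sqrt W \<in> schatten_class p"
  shows "compatible W (range A) \<longleftrightarrow>
    is_minimum (\<le>) (schatten_norm p (op_sqrt (shorted W (range A))))
      {schatten_norm_weighted p W (residual A B X) | X. X \<in> bounded_ops}"
proof -
  define R where "R = op_sqrt W"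
  have R: "R \<in> pos_ops" and RR: "R o\<^sub>L R = W"
    unfolding R_def by (rule op_sqrt_pos[OF W], rule op_sqrt_square[OF W])
  have R_compact: "compact_op R" and R_summ: "singular_summable p R"
    using schatten by (auto simp: schatten_class_def R_def)
  have R_adj: "adj R = R" using pos_ops_self_adjoint[OF R] self_adjoint_adj by blast
  define S where "S = shorted W (range A)"
  have S: "S \<in> pos_ops"
    unfolding S_def by (rule shorted_candidate_pos[OF shorted_candidate[OF W csubspace_range[OF A(1)]]])
  define C where "C = op_sqrt S"
  have C: "C \<in> pos_ops" and CC: "C o\<^sub>L C = S"
    unfolding C_def by (rule op_sqrt_pos[OF S], rule op_sqrt_square[OF S])
  have C_norm: "(norm (C x))\<^sup>2 = inner (S x) x" for x
    using pos_root_norm[OF C] CC by simp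
  define Y where "Y X = residual A B X" for X
  define D where "D X = op_abs (R o\<^sub>L Y X)" for X
  have Y: "Y X \<in> bounded_ops" if "X \<in> bounded_ops" for X
    using A B that by (simp add: Y_def residual_def)
  have RY: "R o\<^sub>L Y X \<in> bounded_ops" if "X \<in> bounded_ops" for X
    using Y[OF that] R by (simp add: pos_ops_bounded)
  have gram: "adj (R o\<^sub>L Y X) o\<^sub>L (R o\<^sub>L Y X) = adj (Y X) o\<^sub>L W o\<^sub>L Y X" if X: "X \<in> bounded_ops" for X
    by (rule blinfun_eqI)
      (simp add: adj_compose[OF pos_ops_bounded[OF R] Y[OF X]] R_adj flip: RR)
  have D: "D X \<in> pos_ops" and D_norm: "norm (D X x) = norm (R (Y X x))"
    and DD: "D X o\<^sub>L D X = adj (Y X) o\<^sub>L W o\<^sub>L Y X" if X: "X \<in> bounded_ops" for X x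
    using op_abs_pos[OF RY[OF X]] op_abs_norm[OF RY[OF X]] op_sqrt_square[OF gram_pos[OF RY[OF X]]]
    unfolding D_def gram[OF X, symmetric] by (auto simp: op_abs_def)
  have D_compact: "compact_op (D X)" if X: "X \<in> bounded_ops" for X
    by (rule compact_op_dominated[OF R_compact, where Y = "Y X"]) (simp add: D_norm[OF X])
  have D_summ: "singular_summable p (D X)" if X: "X \<in> bounded_ops" for X
    unfolding D_def by (rule singular_summable_compose[OF R R_compact Y[OF X] p R_summ])
  have norm_le: "norm (C x) \<le> norm (D X x)" if X: "X \<in> bounded_ops" for X x
  proof (rule power2_le_imp_le)
    have "(norm (C x))\<^sup>2 \<le> inner ((adj (Y X) o\<^sub>L W o\<^sub>L Y X) x) x"
      unfolding C_norm S_def Y_def by (rule shorted_form_le_residual[OF A(1) B(1) W X])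
    also have "\<dots> = (norm (D X x))\<^sup>2"
      using pos_root_norm[OF D[OF X], of x] DD[OF X] by simp
    finally show "(norm (C x))\<^sup>2 \<le> (norm (D X x))\<^sup>2" .
  qed simp
  have form_le: "inner (C x) x \<le> inner (D X x) x" if X: "X \<in> bounded_ops" for X x
    by (rule pos_ops_form_mono[OF C D[OF X] norm_le[OF X]])
  have C_compact: "compact_op C"
  proof (rule compact_op_dominated[OF D_compact[of 0]])
    show "norm (C x) \<le> norm (D 0 (id_blinfun x))" for x using norm_le[of 0 x] by simp
  qed simp
  have weighted: "schatten_norm_weighted p W (residual A B X) = schatten_norm p (D X)"
    if X: "X \<in> bounded_ops" for X
    unfolding schatten_norm_weighted_def D_def R_def[symmetric] Y_def[symmetric]
    by (rule schatten_norm_op_abs[OF RY[OF X], symmetric])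
  have attained_iff: "schatten_norm p C = schatten_norm p (D X) \<longleftrightarrow> S = adj (Y X) o\<^sub>L W o\<^sub>L Y X"
    if X: "X \<in> bounded_ops" for X
  proof
    assume "schatten_norm p C = schatten_norm p (D X)"
    then have "singular_sum p C = singular_sum p (D X)"
      using singular_sum_eq_schatten_norm[OF p] by metis
    then have "C = D X"
      by (rule singular_sum_eq_imp_eq[OF C C_compact D[OF X] D_compact[OF X] p D_summ[OF X] form_le[OF X]])
    then show "S = adj (Y X) o\<^sub>L W o\<^sub>L Y X" using CC DD[OF X] by simp
  next
    assume "S = adj (Y X) o\<^sub>L W o\<^sub>L Y X"
    then have "C o\<^sub>L C = D X o\<^sub>L D X" using CC DD[OF X] by simp
    then have "C = D X" by (rule pos_root_unique[OF C D[OF X]])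
    then show "schatten_norm p C = schatten_norm p (D X)" by simp
  qed
  have le: "schatten_norm p C \<le> schatten_norm p (D X)" if X: "X \<in> bounded_ops" for X
    unfolding schatten_norm_eq_singular_sum
    using singular_sum_mono(2)[OF C C_compact D[OF X] D_compact[OF X] p D_summ[OF X] form_le[OF X]] p
    by (intro powr_mono2 singular_sum_nonneg) auto
  have image_eq: "{schatten_norm_weighted p W (residual A B X) | X. X \<in> bounded_ops}
      = (\<lambda>X. schatten_norm p (D X)) ` bounded_ops"
    using weighted by (simp add: Setcompr_eq_image)
  have "is_minimum (\<le>) (schatten_norm p C)
      {schatten_norm_weighted p W (residual A B X) | X. X \<in> bounded_ops} \<longleftrightarrow>
    (\<exists>X\<in>bounded_ops. schatten_norm p C = schatten_norm p (D X))"
    unfolding is_minimum_def image_eq using le by blast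
  also have "\<dots> \<longleftrightarrow> (\<exists>X\<in>bounded_ops. S = adj (Y X) o\<^sub>L W o\<^sub>L Y X)"
    by (intro bex_cong refl attained_iff)
  also have "\<dots> \<longleftrightarrow> S \<in> residual_forms W A B"
    unfolding residual_forms_def Y_def by blast
  also have "\<dots> \<longleftrightarrow> compatible W (range A)"
    unfolding S_def
    using compatible_imp_attained[OF A B W NB] attained_imp_compatible[OF A B(1) W] by blast
  finally show ?thesis by (simp add: C_def S_def)
qed

theorem proposition4p3:
  fixes A B W :: "'a::complex_hilbert_space \<Rightarrow>\<^sub>L 'a"
  assumes separable: "\<exists>D::'a set. countable D \<and> closure D = UNIV"
    and A: "A \<in> bounded_ops" "closed (range A)"
    and B: "B \<in> bounded_ops" "closed (range B)"
    and W: "W \<in> pos_ops"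
    and NB: "nullspace B = ortho_weighted W (range A)"
  shows "(is_minimum minus_le (shorted W (range A)) (residual_forms W A B) \<longleftrightarrow> compatible W (range A)) \<and>
    (compatible W (range A) \<longleftrightarrow> is_minimum op_le (shorted W (range A)) (residual_forms W A B)) \<and>
    (\<forall>p::real. 1 \<le> p \<longrightarrow> op_sqrt W \<in> schatten_class p \<longrightarrow>
      (compatible W (range A) \<longleftrightarrow>
       is_minimum (\<le>) (schatten_norm p (op_sqrt (shorted W (range A))))
         {schatten_norm_weighted p W (residual A B X) | X. X \<in> bounded_ops}))"
proof -
  let ?S = "shorted W (range A)"
  have attained: "?S \<in> residual_forms W A B \<longleftrightarrow> compatible W (range A)"
    using compatible_imp_attained[OF A B W NB] attained_imp_compatible[OF A B(1) W] by blast
  have S: "?S \<in> pos_ops"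
    by (rule shorted_candidate_pos[OF shorted_candidate[OF W csubspace_range[OF A(1)]]])
  have le: "op_le ?S D" if D: "D \<in> residual_forms W A B" for D
  proof -
    obtain X where X: "X \<in> bounded_ops" and D_eq: "D = adj (residual A B X) o\<^sub>L W o\<^sub>L residual A B X"
      using D unfolding residual_forms_def by blast
    have "D \<in> pos_ops"
      unfolding D_eq using A B X by (intro pos_ops_congruence W) (simp add: residual_def)
    then show ?thesis
      using S shorted_form_le_residual[OF A(1) B(1) W X] unfolding D_eq
      by (simp only: op_le_iff pos_ops_self_adjoint) simp
  qed
  have "is_minimum minus_le ?S (residual_forms W A B) \<longleftrightarrow> compatible W (range A)"
    using attained compatible_imp_minus_le[OF A(1) B(1) W NB] unfolding is_minimum_def by blast
  moreover have "is_minimum op_le ?S (residual_forms W A B) \<longleftrightarrow> compatible W (range A)"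
    using attained le unfolding is_minimum_def by blast
  ultimately show ?thesis
    using compatible_iff_minimum_schatten[OF A B W NB] by simp
qed

end
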